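(* Let $n\ge1$, $\mathfrak{gl}=\mathfrak{gl}(n+1|n)$ with $I=\{1,\dots,2n+1\}$, $p(i)=0$ for odd $i$, $p(i)=1$ for even $i$, grading $e_{ij}\in\mathfrak{gl}_{(j-i)/2}$, $f=\sum_{i=1}^{2n}e_{i+1,i}$, and let $w_1,\dots,w_{2n+1}\in\mathcal V(\bar{\mathfrak q})$, $\mathfrak q=\mathfrak{gl}_{\le0}$, be defined by $\operatorname{rdet}(\mathcal A)=\sum_{i=0}^{2n+1}w_{2n+1-i}D^i$, where $\mathcal A_{ij}=\delta_{ij}D+\bar e^{\,ji}$ ($i\le j$), $\mathcal A_{i+1,i}=-1$, other entries $0$, and $e^{ji}=(-1)^{p(j)}e_{ji}$. Let $\mathfrak g=\mathfrak{sl}(n+1|n)=\{X\in\mathfrak{gl}:\operatorname{str}X=0\}$ with the induced grading, $\mathfrak p=\mathfrak g_{\le0}$ (so $\mathfrak q=\mathfrak p\oplus\mathbb CI$, $I$ the identity matrix), and let $\pi_{\mathfrak{sl}}:\mathcal V(\bar{\mathfrak q})\to\mathcal V(\bar{\mathfrak p})$ be the differential algebra homomorphism induced by $\bar X\mapsto\overline{X-\operatorname{str}(X)I}$. Then $$\mathcal W(\bar{\mathfrak g},f)=\mathbb C\big[\pi_{\mathfrak{sl}}(w_i)^{(m)}\mid i=2,\dots,2n+1,\ m\in\mathbb Z_{\ge0}\big].$$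
   Context: $\mathfrak{gl}$ is spanned by matrix units $e_{ij}$ of parity $p(i)+p(j)$, $[e_{ij},e_{kl}]=\delta_{jk}e_{il}-(-1)^{(p(i)+p(j))(p(k)+p(l))}\delta_{il}e_{kj}$, $\operatorname{str}(\sum a_{ij}e_{ij})=\sum(-1)^{p(i)}a_{ii}$, form $(X|Y)=\operatorname{str}(XY)$ (restricted to $\mathfrak{sl}$ for $\mathfrak g$). For $\mathfrak a$ with even supersymmetric invariant form, $\bar{\mathfrak a}$ is a parity-reversed copy ($p(\bar a)=p(a)+1$); $\mathcal V(\bar{\mathfrak a})=S(\mathbb C[D]\otimes\bar{\mathfrak a})$ is the free supercommutative algebra on $D^m\bar a$ with odd derivation $D$ and the SUSY PVA bracket $\{\bar a{}_\chi\bar b\}=(-1)^{p(a)(p(b)+1)}\overline{[a,b]}+\chi(a|b)$ extended by sesquilinearity $\{Dx{}_\chi y\}=-\chi\{x{}_\chi y\}$, $\{x{}_\chi Dy\}=(-1)^{p(x)+1}(D+\chi)\{x{}_\chi y\}$ and the Leibniz rule $\{x{}_\chi yz\}=(-1)^{(p(x)+1)p(y)}y\{x{}_\chi z\}+\{x{}_\chi y\}z$; $\chi$ odd, supercommuting with $\mathcal V$, $D\chi+\chi D=-2\chi^2$. $x^{(m)}=D^mx$. For a grading $\mathfrak g=\bigoplus_j\mathfrak g_j$ and odd $f\in\mathfrak g_{-1/2}$: $\mathfrak n=\mathfrak g_{>0}$, $\mathfrak p=\mathfrak g_{\le0}$, $\mathfrak J$ = differential ideal of $\mathcal V(\bar{\mathfrak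 g})$ generated by $\bar n-(f|n)$, $n\in\mathfrak n$, and $\mathcal W(\bar{\mathfrak g},f)=\{w\in\mathcal V(\bar{\mathfrak p}):\{\bar n{}_\chi w\}\in\mathbb C[\chi]\otimes\mathfrak J\ \forall n\in\mathfrak n\}$. In $\mathcal V[D]$, $D\,a=D(a)+(-1)^{p(a)}aD$, coefficients written on the left. $\operatorname{rdet}(A)=\sum_{\sigma\in S_N}\operatorname{sgn}(\sigma)A_{1\sigma(1)}\cdots A_{N\sigma(N)}$. *)

theory Defs
  imports Complex_Main "HOL-Library.Function_Algebras" "HOL-Library.Product_Lexorder"
    "HOL-Combinatorics.Permutations"
begin

definition Iset :: "nat \<Rightarrow> nat set" where
  "Iset n = {1..2*n+1}"

definition ppar :: "nat \<Rightarrow> nat" where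
  "ppar i = (if odd i then 0 else 1)"

definition pe :: "nat \<Rightarrow> nat \<Rightarrow> nat" where
  "pe i j = (ppar i + ppar j) mod 2"

type_synonym mat = "nat \<Rightarrow> nat \<Rightarrow> complex"

definition in_gl :: "nat \<Rightarrow> mat \<Rightarrow> bool" where
  "in_gl n X \<longleftrightarrow> (\<forall>i j. X i j \<noteq> 0 \<longrightarrow> i \<in> Iset n \<and> j \<in> Iset n)"

definition str :: "nat \<Rightarrow> mat \<Rightarrow> complex" where
  "str n X = (\<Sum>i\<in>Iset n. (-1) ^ ppar i * X i i)"

definition matmul :: "nat \<Rightarrow> mat \<Rightarrow> mat \<Rightarrow> mat" where
  "matmul n X Y = (\<lambda>i j. \<Sum>k\<in>Iset n. X i k * Y k j)"

definition form :: "nat \<Rightarrow> mat \<Rightarrow> mat \<Rightarrow> complex" where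
  "form n X Y = str n (matmul n X Y)"

text \<open>sl(n+1|n), and graded pieces for the grading e_ij in degree (j-i)/2.\<close>
definition sl_set :: "nat \<Rightarrow> mat set" where
  "sl_set n = {X. in_gl n X \<and> str n X = 0}"

definition nil_set :: "nat \<Rightarrow> mat set" where
  "nil_set n = {X\<in>sl_set n. \<forall>i j. X i j \<noteq> 0 \<longrightarrow> i < j}"

definition p_set :: "nat \<Rightarrow> mat set" where
  "p_set n = {X\<in>sl_set n. \<forall>i j. X i j \<noteq> 0 \<longrightarrow> j \<le> i}"

definition fmat :: "nat \<Rightarrow> mat" where
  "fmat n = (\<lambda>i j. if 1 \<le> j \<and> j \<le> 2*n \<and> i = j + 1 then 1 else 0)"

text \<open>Generators: the variable (i,j,m) stands for D^m of bar e_ij; its parity is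
  p(i)+p(j)+1+m mod 2.  A monomial is a finitely supported exponent function; a
  polynomial is a (finitely supported) coefficient function on monomials, the
  monomial s standing for the product of its variables in increasing (lexicographic)
  order.  Odd variables have exponent at most 1.\<close>

type_synonym var = "nat \<times> nat \<times> nat"
type_synonym mono = "var \<Rightarrow> nat"
type_synonym spoly = "mono \<Rightarrow> complex"

definition vpar :: "var \<Rightarrow> nat" where
  "vpar v = (case v of (i, j, m) \<Rightarrow> (ppar i + ppar j + 1 + m) mod 2)"

definition supp_m :: "mono \<Rightarrow> var set" where
  "supp_m s = {v. s v \<noteq> 0}"

definition supp :: "spoly \<Rightarrow> mono set" where
  "supp p = {s. p s \<noteq> 0}"

definition mono_par :: "mono \<Rightarrow> nat" where
  "mono_par s = (\<Sum>v\<in>supp_m s. s v * vpar v) mod 2"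

definition overlap :: "mono \<Rightarrow> mono \<Rightarrow> bool" where
  "overlap s t \<longleftrightarrow> (\<exists>v. vpar v = 1 \<and> s v \<noteq> 0 \<and> t v \<noteq> 0)"

text \<open>Sign from reordering the product of two ordered monomials.\<close>
definition mono_sign :: "mono \<Rightarrow> mono \<Rightarrow> complex" where
  "mono_sign s t = (-1) ^ card {(x, y). vpar x = 1 \<and> vpar y = 1 \<and> s x \<noteq> 0 \<and> t y \<noteq> 0 \<and> y < x}"

definition sp_mult :: "spoly \<Rightarrow> spoly \<Rightarrow> spoly" where
  "sp_mult p q = (\<lambda>u. \<Sum>s\<in>supp p. \<Sum>t\<in>supp q.
      if u = s + t \<and> \<not> overlap s t then p s * q t * mono_sign s t else 0)"

definition sp_const :: "complex \<Rightarrow> spoly" where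
  "sp_const c = (\<lambda>s. if s = (\<lambda>_. 0) then c else 0)"

definition sp_one :: spoly where
  "sp_one = sp_const 1"

definition sp_var :: "var \<Rightarrow> spoly" where
  "sp_var v = (\<lambda>s. if s = (\<lambda>w. if w = v then 1 else 0) then 1 else 0)"

definition sp_scal :: "complex \<Rightarrow> spoly \<Rightarrow> spoly" where
  "sp_scal c p = (\<lambda>s. c * p s)"

definition sp_sigma :: "spoly \<Rightarrow> spoly" where
  "sp_sigma p = (\<lambda>s. (-1) ^ mono_par s * p s)"

primrec sp_word :: "var list \<Rightarrow> spoly" where
  "sp_word [] = sp_one"
| "sp_word (y # ys) = sp_mult (sp_var y) (sp_word ys)"

definition mono_word :: "mono \<Rightarrow> var list" where
  "mono_word s = concat (map (\<lambda>v. replicate (s v) v) (sorted_list_of_set (supp_m s)))"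

definition Dv :: "var \<Rightarrow> var" where
  "Dv v = (case v of (i, j, m) \<Rightarrow> (i, j, Suc m))"

primrec wordD :: "var list \<Rightarrow> spoly" where
  "wordD [] = 0"
| "wordD (y # ys) = sp_mult (sp_var (Dv y)) (sp_word ys)
      + sp_scal ((-1) ^ vpar y) (sp_mult (sp_var y) (wordD ys))"

definition sp_D :: "spoly \<Rightarrow> spoly" where
  "sp_D p = (\<Sum>s\<in>supp p. sp_scal (p s) (wordD (mono_word s)))"

text \<open>Algebra homomorphism determined by images of the generators (parity preserving).\<close>
definition sp_eval :: "(var \<Rightarrow> spoly) \<Rightarrow> spoly \<Rightarrow> spoly" where
  "sp_eval \<phi> p = (\<Sum>s\<in>supp p. sp_scal (p s) (foldr sp_mult (map \<phi> (mono_word s)) sp_one))"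

definition bar :: "nat \<Rightarrow> mat \<Rightarrow> spoly" where
  "bar n X = (\<Sum>i\<in>Iset n. \<Sum>j\<in>Iset n. sp_scal (X i j) (sp_var (i, j, 0)))"

inductive_set alg_gen :: "spoly set \<Rightarrow> spoly set" for G where
  const: "sp_const c \<in> alg_gen G"
| gen: "g \<in> G \<Longrightarrow> g \<in> alg_gen G"
| add: "a \<in> alg_gen G \<Longrightarrow> b \<in> alg_gen G \<Longrightarrow> a + b \<in> alg_gen G"
| scal: "a \<in> alg_gen G \<Longrightarrow> sp_scal c a \<in> alg_gen G"
| mult: "a \<in> alg_gen G \<Longrightarrow> b \<in> alg_gen G \<Longrightarrow> sp_mult a b \<in> alg_gen G"

text \<open>V(bar S) for a subspace S of gl, as the differential subalgebra of V(bar gl)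
  generated by the D^m bar X, X in S.\<close>
definition Vsub :: "nat \<Rightarrow> mat set \<Rightarrow> spoly set" where
  "Vsub n S = alg_gen {(sp_D ^^ m) (bar n X) | X m. X \<in> S}"

inductive_set Jid :: "nat \<Rightarrow> spoly set" for n where
  gen: "X \<in> nil_set n \<Longrightarrow> bar n X - sp_const (form n (fmat n) X) \<in> Jid n"
| zero: "0 \<in> Jid n"
| add: "a \<in> Jid n \<Longrightarrow> b \<in> Jid n \<Longrightarrow> a + b \<in> Jid n"
| lmult: "a \<in> Vsub n (sl_set n) \<Longrightarrow> x \<in> Jid n \<Longrightarrow> sp_mult a x \<in> Jid n"
| rmult: "a \<in> Vsub n (sl_set n) \<Longrightarrow> x \<in> Jid n \<Longrightarrow> sp_mult x a \<in> Jid n"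
| deriv: "x \<in> Jid n \<Longrightarrow> sp_D x \<in> Jid n"

text \<open>Elements of C[chi] (x) V are represented as nat => spoly, k |-> coefficient of
  chi^k (chi written on the left).  chi is odd, supercommutes with V, and
  D chi + chi D = -2 chi^2; hence (D + chi)(chi^k a) = (-1)^k (chi^k D(a) + chi^(k+1) a).\<close>

type_synonym cseries = "nat \<Rightarrow> spoly"

definition cs_Dchi :: "cseries \<Rightarrow> cseries" where
  "cs_Dchi F = (\<lambda>k. sp_scal ((-1) ^ k) (sp_D (F k))
      + (if k = 0 then 0 else sp_scal ((-1) ^ (k - 1)) (F (k - 1))))"

definition lie_bar :: "nat \<Rightarrow> nat \<Rightarrow> nat \<Rightarrow> nat \<Rightarrow> spoly" where
  "lie_bar a b c d = (if b = c then sp_var (a, d, 0) else 0)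
     - (if a = d then sp_scal ((-1) ^ (pe a b * pe c d)) (sp_var (c, b, 0)) else 0)"

definition form_ee :: "nat \<Rightarrow> nat \<Rightarrow> nat \<Rightarrow> nat \<Rightarrow> complex" where
  "form_ee a b c d = (if b = c \<and> a = d then (-1) ^ ppar a else 0)"

definition br_base :: "nat \<Rightarrow> nat \<Rightarrow> nat \<Rightarrow> nat \<Rightarrow> cseries" where
  "br_base a b c d = (\<lambda>k. if k = 0 then sp_scal ((-1) ^ (pe a b * (pe c d + 1))) (lie_bar a b c d)
      else if k = 1 then sp_const (form_ee a b c d) else 0)"

text \<open>{bar e_ab _chi D^m bar e_cd}, by sesquilinearity
  {x _chi Dy} = (-1)^(p(x)+1) (D+chi) {x _chi y}, with p(bar e_ab) = p(e_ab)+1.\<close>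
definition brv :: "nat \<Rightarrow> nat \<Rightarrow> var \<Rightarrow> cseries" where
  "brv a b v = (case v of (c, d, m) \<Rightarrow>
     ((\<lambda>F k. sp_scal ((-1) ^ pe a b) (cs_Dchi F k)) ^^ m) (br_base a b c d))"

text \<open>{bar e_ab _chi y1 ... yk}, by the Leibniz rule.\<close>
primrec brw :: "nat \<Rightarrow> nat \<Rightarrow> var list \<Rightarrow> cseries" where
  "brw a b [] = (\<lambda>_. 0)"
| "brw a b (y # ys) = (\<lambda>k. sp_scal ((-1) ^ (pe a b * vpar y + k * vpar y))
        (sp_mult (sp_var y) (brw a b ys k))
      + sp_mult (brv a b y k) (sp_word ys))"

definition bracket :: "nat \<Rightarrow> mat \<Rightarrow> spoly \<Rightarrow> cseries" where
  "bracket n X w = (\<lambda>k. \<Sum>a\<in>Iset n. \<Sum>b\<in>Iset n. sp_scal (X a b)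
      (\<Sum>s\<in>supp w. sp_scal (w s) (brw a b (mono_word s) k)))"

definition Wset :: "nat \<Rightarrow> spoly set" where
  "Wset n = {w \<in> Vsub n (p_set n). \<forall>X\<in>nil_set n. \<forall>k. bracket n X w k \<in> Jid n}"

text \<open>Elements of V[D]: nat => spoly, k |-> coefficient of D^k (coefficients on the left).\<close>
type_synonym dop = "nat \<Rightarrow> spoly"

definition dop_supp :: "dop \<Rightarrow> nat set" where
  "dop_supp P = {k. P k \<noteq> 0}"

text \<open>Left multiplication by D:  D a = D(a) + sigma(a) D.\<close>
definition dop_lD :: "dop \<Rightarrow> dop" where
  "dop_lD P = (\<lambda>k. sp_D (P k) + (if k = 0 then 0 else sp_sigma (P (k - 1))))"

definition dop_mult :: "dop \<Rightarrow> dop \<Rightarrow> dop" where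
  "dop_mult P Q = (\<Sum>k\<in>dop_supp P. (\<lambda>l. sp_mult (P k) ((dop_lD ^^ k) Q l)))"

definition dop_one :: dop where
  "dop_one = (\<lambda>k. if k = 0 then sp_one else 0)"

definition eup :: "nat \<Rightarrow> nat \<Rightarrow> spoly" where
  "eup j i = sp_scal ((-1) ^ ppar j) (sp_var (j, i, 0))"

definition Amat :: "nat \<Rightarrow> nat \<Rightarrow> dop" where
  "Amat i j = (if i = j then (\<lambda>k. if k = 1 then sp_one else if k = 0 then eup j i else 0)
     else if i < j then (\<lambda>k. if k = 0 then eup j i else 0)
     else if i = j + 1 then (\<lambda>k. if k = 0 then sp_const (-1) else 0)
     else (\<lambda>_. 0))"

definition rdet :: "nat \<Rightarrow> (nat \<Rightarrow> nat \<Rightarrow> dop) \<Rightarrow> dop" where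
  "rdet N A = (\<Sum>\<sigma>\<in>{\<sigma>. \<sigma> permutes {1..N}}.
     (\<lambda>k u. of_int (sign \<sigma>) * foldr dop_mult (map (\<lambda>i. A i (\<sigma> i)) [1..<N+1]) dop_one k u))"

text \<open>rdet(A) = sum_{i=0}^{2n+1} w_{2n+1-i} D^i, so w_j is the coefficient of D^(2n+1-j).\<close>
definition wop :: "nat \<Rightarrow> nat \<Rightarrow> spoly" where
  "wop n j = rdet (2*n+1) Amat (2*n+1 - j)"

text \<open>pi_sl: the differential algebra homomorphism with bar X |-> bar (X - str(X) I);
  on generators D^m bar e_ij |-> D^m (bar e_ij - delta_ij (-1)^p(i) sum_k bar e_kk).\<close>
definition pi_sl :: "nat \<Rightarrow> spoly \<Rightarrow> spoly" where
  "pi_sl n = sp_eval (\<lambda>v. case v of (i, j, m) \<Rightarrow>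
     (sp_D ^^ m) (sp_var (i, j, 0)
        - (if i = j then sp_scal ((-1) ^ ppar i) (\<Sum>k\<in>Iset n. sp_var (k, k, 0)) else 0)))"

end

theory Submission
  imports Defs
begin

text \<open>
  Reducing modulo the ideal turns the brackets with the strictly upper triangular \<open>e\<^sub>a\<^sub>b\<close> into
  superderivations \<open>dl a b k\<close> (the coefficients of \<open>\<chi>\<^sup>k\<close>) of the algebra generated by the
  lower triangular variables, and \<open>W\<close> is their joint kernel.
  The row determinants \<open>R\<^sub>i\<close> of the lower right blocks of \<open>\<A>\<close> satisfy
  \<open>R\<^sub>i = D R\<^sub>i\<^sub>+\<^sub>1 + (\<Sum>j\<ge>i. e\<^sup>j\<^sup>i R\<^sub>j\<^sub>+\<^sub>1)\<close>, so the column \<open>(R\<^sub>j\<^sub>+\<^sub>1)\<^sub>j\<close> is annihilated by all rows of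
  \<open>\<A>\<close> except the first. Downward induction on \<open>i\<close> shows that \<open>e\<^sub>a\<^sub>b\<close> acts on this column as an
  infinitesimal gauge transformation: it sends \<open>R\<^sub>a\<^sub>+\<^sub>1\<close> to \<open>- R\<^sub>b\<^sub>+\<^sub>1\<close> and kills the other
  \<open>R\<^sub>i\<close>, in particular \<open>R\<^sub>1\<close>.

  Conversely, \<open>w\<^sub>d\<close> equals \<open>\<plusminus>e\<^sub>d\<^sub>1\<close> plus terms in the \<open>e\<^sub>j\<^sub>1\<close> with \<open>j < d\<close> and in variables of second index
  at least 2, so the lower triangular variables are generated by the \<open>w\<^sub>d\<close> and the \<open>e\<^sub>s\<^sub>t\<close> with
  \<open>2 \<le> t \<le> s\<close>. The derivation \<open>dl (t - 1) s k\<close> sends the \<open>k\<close>-th derivative of \<open>e\<^sub>s\<^sub>t\<close> to a nonzero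
  constant and kills every other variable whose second index is at least \<open>t\<close>, so these variables
  can be eliminated from an element of the kernel one at a time, starting with \<open>t = 2\<close>.
  Finally \<open>\<pi>\<close> commutes with the derivations \<open>dl a b k\<close>, fixes the subalgebra of \<open>p\<close>, and kills \<open>w\<^sub>1\<close>, which is
  the variable of the identity matrix.
\<close>

section \<open>The supercommutative polynomial algebra as a ring\<close>

text \<open>The kernel argument runs over gl rather than sl: individual diagonal variables have
  nonzero supertrace and so do not lie in V(p), yet the elimination needs every entry of
  \<open>\<A>\<close> as a variable of its own. Returning to sl rests on three facts: the identity
  matrix has supertrace 1, it is central, and it is orthogonal to every off-diagonal matrix unit.
  The quotient by the ideal is never formed. It is replaced by an algebra map \<open>rho\<close> on
  all of V(gl). Since the ideal lives inside V(sl), vanishing under \<open>rho\<close> gives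
  membership only for elements of V(sl). Brackets with matrix units stay there because
  supercommutators have supertrace zero. As \<chi> is odd, the coefficient of \<chi>^k has parity
  p(a)+p(b)+k, so even and odd derivations both occur and the elimination needs an argument for
  each. The determinant is tied to the bracket by the entries -1 below the diagonal: they are
  exactly what the upper triangular generators become after reduction.\<close>

definition adm :: "mono \<Rightarrow> bool" where
  "adm s \<longleftrightarrow> finite (supp_m s) \<and> (\<forall>v. vpar v = 1 \<longrightarrow> s v \<le> 1)"

text \<open>A sum over an infinite set is 0 by convention, so distributivity of
  \<open>sp_mult\<close> fails on arbitrary coefficient functions. The bound on odd exponents in
  \<open>adm\<close> excludes monomials that no product of variables can produce.\<close>

definition good :: "spoly \<Rightarrow> bool" where
  "good p \<longleftrightarrow> finite (supp p) \<and> (\<forall>s\<in>supp p. adm s)"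

lemma vpar_cases: "vpar v = 0 \<or> vpar v = 1"
  by (auto simp: vpar_def split: prod.splits)

lemma adm_zero [simp]: "adm (\<lambda>_. 0)"
  by (simp add: adm_def supp_m_def)

lemma supp_m_add: "supp_m (s + t) = supp_m s \<union> supp_m t"
  by (auto simp: supp_m_def)

lemma adm_add: "adm s \<Longrightarrow> adm t \<Longrightarrow> \<not> overlap s t \<Longrightarrow> adm (s + t)"
  unfolding adm_def supp_m_add overlap_def
proof (intro conjI allI impI)
  fix v assume a: "finite (supp_m s) \<and> (\<forall>v. vpar v = 1 \<longrightarrow> s v \<le> 1)"
    "finite (supp_m t) \<and> (\<forall>v. vpar v = 1 \<longrightarrow> t v \<le> 1)"
    "\<not> (\<exists>v. vpar v = 1 \<and> s v \<noteq> 0 \<and> t v \<noteq> 0)" "vpar v = 1"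
  then have "s v = 0 \<or> t v = 0" "s v \<le> 1" "t v \<le> 1" by blast+
  then show "(s + t) v \<le> 1" by auto
qed simp

lemma good_zero: "good 0"
  by (simp add: good_def supp_def)

lemma supp_add: "supp (p + q) \<subseteq> supp p \<union> supp q"
  by (auto simp: supp_def)

lemma good_add: "good p \<Longrightarrow> good q \<Longrightarrow> good (p + q)"
  unfolding good_def using supp_add[of p q] by (meson UnE finite_UnI finite_subset subsetD)

lemma good_scal: "good p \<Longrightarrow> good (sp_scal c p)"
  unfolding good_def supp_def sp_scal_def by (auto elim: finite_subset[rotated])

lemma good_uminus: "good p \<Longrightarrow> good (- p)"
  unfolding good_def supp_def by simp

lemma good_diff: "good p \<Longrightarrow> good q \<Longrightarrow> good (p - q)"
  using good_add[OF _ good_uminus, of p q] by simp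

lemma good_const: "good (sp_const c)"
proof -
  have "supp (sp_const c) \<subseteq> {\<lambda>_. 0}" by (auto simp: supp_def sp_const_def)
  moreover from this have "finite (supp (sp_const c))" by (rule finite_subset) simp
  ultimately show ?thesis unfolding good_def using adm_zero by blast
qed

lemma good_one: "good sp_one"
  by (simp add: sp_one_def good_const)

lemma adm_var: "adm (\<lambda>w. if w = v then 1 else 0)"
proof -
  have "supp_m (\<lambda>w. if w = v then 1 else 0) = {v}" by (auto simp: supp_m_def)
  then show ?thesis by (simp add: adm_def)
qed

lemma good_var: "good (sp_var v)"
proof -
  have "supp (sp_var v) = {\<lambda>w. if w = v then 1 else 0}" by (auto simp: supp_def sp_var_def)
  then show ?thesis unfolding good_def using adm_var by simp
qed

lemma good_sigma: "good p \<Longrightarrow> good (sp_sigma p)"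
  unfolding good_def supp_def sp_sigma_def by simp

section \<open>Structure constants of the monomial basis and associativity\<close>

definition mc :: "mono \<Rightarrow> mono \<Rightarrow> complex" where
  "mc s t = (if overlap s t then 0 else mono_sign s t)"

lemma sp_mult_eq:
  assumes "finite S" "supp p \<subseteq> S" "finite T" "supp q \<subseteq> T"
  shows "sp_mult p q u = (\<Sum>s\<in>S. \<Sum>t\<in>T. if u = s + t then p s * q t * mc s t else 0)"
proof -
  have "sp_mult p q u = (\<Sum>s\<in>supp p. \<Sum>t\<in>supp q. if u = s + t then p s * q t * mc s t else 0)"
    unfolding sp_mult_def mc_def by (intro sum.cong) auto
  also have "\<dots> = (\<Sum>s\<in>S. \<Sum>t\<in>supp q. if u = s + t then p s * q t * mc s t else 0)"
    by (rule sum.mono_neutral_left) (use assms in \<open>auto simp: supp_def intro!: sum.neutral split: if_splits\<close>)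
  also have "\<dots> = (\<Sum>s\<in>S. \<Sum>t\<in>T. if u = s + t then p s * q t * mc s t else 0)"
    by (intro sum.cong refl sum.mono_neutral_left) (use assms in \<open>auto simp: supp_def split: if_splits\<close>)
  finally show ?thesis .
qed

lemma good_mult:
  assumes "good p" "good q" shows "good (sp_mult p q)"
proof -
  let ?P = "{z \<in> supp p \<times> supp q. \<not> overlap (fst z) (snd z)}"
  have "supp (sp_mult p q) \<subseteq> (\<lambda>z. fst z + snd z) ` ?P"
  proof
    fix u assume "u \<in> supp (sp_mult p q)"
    then have "sp_mult p q u \<noteq> 0" by (simp add: supp_def)
    then obtain s where s: "s \<in> supp p" and s': "(\<Sum>t\<in>supp q. if u = s + t \<and> \<not> overlap s t then p s * q t * mono_sign s t else 0) \<noteq> 0"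
      unfolding sp_mult_def by (rule sum.not_neutral_contains_not_neutral)
    from s' obtain t where "t \<in> supp q" "(if u = s + t \<and> \<not> overlap s t then p s * q t * mono_sign s t else 0) \<noteq> 0"
      by (rule sum.not_neutral_contains_not_neutral)
    then show "u \<in> (\<lambda>z. fst z + snd z) ` ?P" using s
      by (intro image_eqI[of _ _ "(s, t)"]) (auto split: if_splits)
  qed
  moreover have "finite ?P" using assms by (auto simp: good_def)
  moreover have "adm u" if "u \<in> (\<lambda>z. fst z + snd z) ` ?P" for u
    using that assms by (auto simp: good_def intro!: adm_add)
  ultimately show ?thesis unfolding good_def by (meson finite_imageI finite_subset subsetD)
qed

lemma sp_mult_add_left:
  assumes "good p" "good q" "good r" shows "sp_mult (p + q) r = sp_mult p r + sp_mult q r"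
proof
  fix u
  let ?S = "supp p \<union> supp q" and ?T = "supp r"
  have f: "finite ?S" "finite ?T" using assms by (auto simp: good_def)
  have 1: "sp_mult (p + q) r u = (\<Sum>s\<in>?S. \<Sum>t\<in>?T. if u = s + t then (p + q) s * r t * mc s t else 0)"
    by (rule sp_mult_eq) (use f supp_add in auto)
  have 2: "sp_mult p r u = (\<Sum>s\<in>?S. \<Sum>t\<in>?T. if u = s + t then p s * r t * mc s t else 0)"
    by (rule sp_mult_eq) (use f in auto)
  have 3: "sp_mult q r u = (\<Sum>s\<in>?S. \<Sum>t\<in>?T. if u = s + t then q s * r t * mc s t else 0)"
    by (rule sp_mult_eq) (use f in auto)
  show "sp_mult (p + q) r u = (sp_mult p r + sp_mult q r) u"
    unfolding plus_fun_apply[of "sp_mult p r"] 1 2 3 sum.distrib[symmetric]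
    by (intro sum.cong refl) (simp add: algebra_simps)
qed

lemma sp_mult_add_right:
  assumes "good p" "good q" "good r" shows "sp_mult r (p + q) = sp_mult r p + sp_mult r q"
proof
  fix u
  let ?S = "supp p \<union> supp q" and ?T = "supp r"
  have f: "finite ?S" "finite ?T" using assms by (auto simp: good_def)
  have 1: "sp_mult r (p + q) u = (\<Sum>s\<in>?T. \<Sum>t\<in>?S. if u = s + t then r s * (p + q) t * mc s t else 0)"
    by (rule sp_mult_eq) (use f supp_add in auto)
  have 2: "sp_mult r p u = (\<Sum>s\<in>?T. \<Sum>t\<in>?S. if u = s + t then r s * p t * mc s t else 0)"
    by (rule sp_mult_eq) (use f in auto)
  have 3: "sp_mult r q u = (\<Sum>s\<in>?T. \<Sum>t\<in>?S. if u = s + t then r s * q t * mc s t else 0)"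
    by (rule sp_mult_eq) (use f in auto)
  show "sp_mult r (p + q) u = (sp_mult r p + sp_mult r q) u"
    unfolding plus_fun_apply[of "sp_mult r p"] 1 2 3 sum.distrib[symmetric]
    by (intro sum.cong refl) (simp add: algebra_simps)
qed

lemma sp_mult_scal_left:
  assumes "good p" "good r" shows "sp_mult (sp_scal c p) r = sp_scal c (sp_mult p r)"
proof
  fix u
  have f: "finite (supp p)" "finite (supp r)" using assms by (auto simp: good_def)
  have 1: "sp_mult (sp_scal c p) r u = (\<Sum>s\<in>supp p. \<Sum>t\<in>supp r. if u = s + t then sp_scal c p s * r t * mc s t else 0)"
    by (rule sp_mult_eq) (use f in \<open>auto simp: supp_def sp_scal_def\<close>)
  have 2: "sp_mult p r u = (\<Sum>s\<in>supp p. \<Sum>t\<in>supp r. if u = s + t then p s * r t * mc s t else 0)"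
    by (rule sp_mult_eq) (use f in auto)
  show "sp_mult (sp_scal c p) r u = sp_scal c (sp_mult p r) u"
    unfolding sp_scal_def[of c "sp_mult p r"] 1 2 sum_distrib_left
    by (intro sum.cong refl) (simp add: sp_scal_def)
qed

lemma sp_mult_scal_right:
  assumes "good p" "good r" shows "sp_mult r (sp_scal c p) = sp_scal c (sp_mult r p)"
proof
  fix u
  have f: "finite (supp p)" "finite (supp r)" using assms by (auto simp: good_def)
  have 1: "sp_mult r (sp_scal c p) u = (\<Sum>s\<in>supp r. \<Sum>t\<in>supp p. if u = s + t then r s * sp_scal c p t * mc s t else 0)"
    by (rule sp_mult_eq) (use f in \<open>auto simp: supp_def sp_scal_def\<close>)
  have 2: "sp_mult r p u = (\<Sum>s\<in>supp r. \<Sum>t\<in>supp p. if u = s + t then r s * p t * mc s t else 0)"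
    by (rule sp_mult_eq) (use f in auto)
  show "sp_mult r (sp_scal c p) u = sp_scal c (sp_mult r p) u"
    unfolding sp_scal_def[of c "sp_mult r p"] 1 2 sum_distrib_left
    by (intro sum.cong refl) (simp add: sp_scal_def)
qed

definition sp_mono :: "mono \<Rightarrow> spoly" where
  "sp_mono s = (\<lambda>u. if u = s then 1 else 0)"

lemma supp_sp_mono: "supp (sp_mono s) = {s}"
  by (auto simp: supp_def sp_mono_def)

lemma good_mono: "adm s \<Longrightarrow> good (sp_mono s)"
  by (simp add: good_def supp_sp_mono)

lemma sp_mult_mono: "sp_mult (sp_mono s) (sp_mono t) = sp_scal (mc s t) (sp_mono (s + t))"
proof
  fix u
  have "sp_mult (sp_mono s) (sp_mono t) u = (\<Sum>s'\<in>{s}. \<Sum>t'\<in>{t}. if u = s' + t' then sp_mono s s' * sp_mono t t' * mc s' t' else 0)"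
    by (rule sp_mult_eq) (auto simp: supp_sp_mono)
  then show "sp_mult (sp_mono s) (sp_mono t) u = sp_scal (mc s t) (sp_mono (s + t)) u"
    by (simp add: sp_mono_def sp_scal_def)
qed

lemma overlap_add_left: "overlap (s + t) u \<longleftrightarrow> overlap s u \<or> overlap t u"
  unfolding overlap_def plus_fun_apply add_is_0 de_Morgan_conj by blast

lemma overlap_add_right: "overlap u (s + t) \<longleftrightarrow> overlap u s \<or> overlap u t"
  unfolding overlap_def plus_fun_apply add_is_0 de_Morgan_conj by blast

definition inv_set :: "mono \<Rightarrow> mono \<Rightarrow> (var \<times> var) set" where
  "inv_set s t = {(x, y). vpar x = 1 \<and> vpar y = 1 \<and> s x \<noteq> 0 \<and> t y \<noteq> 0 \<and> y < x}"

lemma mono_sign_inv_set: "mono_sign s t = (-1) ^ card (inv_set s t)"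
  by (simp add: mono_sign_def inv_set_def)

lemma finite_inv_set: "adm s \<Longrightarrow> adm t \<Longrightarrow> finite (inv_set s t)"
  by (rule finite_subset[of _ "supp_m s \<times> supp_m t"]) (auto simp: adm_def inv_set_def supp_m_def)

lemma mem_inv_set:
  "z \<in> inv_set s t \<longleftrightarrow> vpar (fst z) = 1 \<and> vpar (snd z) = 1 \<and> s (fst z) \<noteq> 0 \<and> t (snd z) \<noteq> 0 \<and> snd z < fst z"
  by (simp add: inv_set_def case_prod_beta)

lemma inv_set_disjoint_left: "\<not> overlap s t \<Longrightarrow> inv_set s u \<inter> inv_set t u = {}"
  unfolding overlap_def disjoint_iff mem_inv_set by blast

lemma inv_set_disjoint_right: "\<not> overlap s t \<Longrightarrow> inv_set u s \<inter> inv_set u t = {}"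
  unfolding overlap_def disjoint_iff mem_inv_set by blast

lemma inv_set_add_left: "inv_set (s + t) u = inv_set s u \<union> inv_set t u"
  unfolding set_eq_iff Un_iff mem_inv_set plus_fun_apply add_is_0 de_Morgan_conj by blast

lemma inv_set_add_right: "inv_set u (s + t) = inv_set u s \<union> inv_set u t"
  unfolding set_eq_iff Un_iff mem_inv_set plus_fun_apply add_is_0 de_Morgan_conj by blast

lemma mono_sign_add_left:
  assumes "adm s" "adm t" "adm u" "\<not> overlap s t"
  shows "mono_sign (s + t) u = mono_sign s u * mono_sign t u"
  unfolding mono_sign_inv_set inv_set_add_left
  using assms by (simp add: card_Un_disjoint finite_inv_set power_add inv_set_disjoint_left)

lemma mono_sign_add_right:
  assumes "adm s" "adm t" "adm u" "\<not> overlap s t"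
  shows "mono_sign u (s + t) = mono_sign u s * mono_sign u t"
  unfolding mono_sign_inv_set inv_set_add_right
  using assms by (simp add: card_Un_disjoint finite_inv_set power_add inv_set_disjoint_right)

text \<open>Both sides vanish when two of the three monomials share an odd variable. Otherwise
  \<open>mono_sign\<close> is multiplicative in each argument, and both sides are the product of the
  signs of the three pairs.\<close>

lemma mc_cocycle:
  assumes "adm s" "adm t" "adm u"
  shows "mc s t * mc (s + t) u = mc t u * mc s (t + u)"
  using assms
  by (auto simp: mc_def overlap_add_left overlap_add_right mono_sign_add_left mono_sign_add_right)

typedef sp = "{p. good p}"
  morphisms rep_sp abs_sp
  using good_zero by blast

setup_lifting type_definition_sp

instantiation sp :: ab_group_add
begin
lift_definition zero_sp :: sp is "0" by (rule good_zero)
lift_definition plus_sp :: "sp \<Rightarrow> sp \<Rightarrow> sp" is "(+)" by (rule good_add)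
lift_definition uminus_sp :: "sp \<Rightarrow> sp" is "uminus" by (rule good_uminus)
lift_definition minus_sp :: "sp \<Rightarrow> sp \<Rightarrow> sp" is "(-)" by (rule good_diff)
instance by standard (transfer, simp add: algebra_simps)+
end

instantiation sp :: "{times, one}"
begin
lift_definition times_sp :: "sp \<Rightarrow> sp \<Rightarrow> sp" is sp_mult by (rule good_mult)
lift_definition one_sp :: sp is sp_one by (rule good_one)
instance ..
end

lift_definition scl :: "complex \<Rightarrow> sp \<Rightarrow> sp" is sp_scal by (rule good_scal)
lift_definition sig :: "sp \<Rightarrow> sp" is sp_sigma by (rule good_sigma)
lift_definition vr :: "var \<Rightarrow> sp" is sp_var by (rule good_var)
lift_definition cn :: "complex \<Rightarrow> sp" is sp_const by (rule good_const)
lift_definition mon :: "mono \<Rightarrow> sp" is "\<lambda>s. if adm s then sp_mono s else 0"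
  by (simp add: good_mono good_zero)

lemma scl_add: "scl c (p + q) = scl c p + scl c q"
  by transfer (auto simp: sp_scal_def algebra_simps)
lemma scl_add_left: "scl (c + d) p = scl c p + scl d p"
  by transfer (auto simp: sp_scal_def algebra_simps)
lemma scl_scl [simp]: "scl c (scl d p) = scl (c * d) p"
  by transfer (auto simp: sp_scal_def algebra_simps)
lemma scl_zero [simp]: "scl c 0 = 0"
  by transfer (auto simp: sp_scal_def)
lemma scl_zero_left [simp]: "scl 0 p = 0"
  by transfer (auto simp: sp_scal_def)
lemma scl_one [simp]: "scl 1 p = p"
  by transfer (auto simp: sp_scal_def)
lemma scl_minus: "scl c (- p) = - scl c p"
  by transfer (auto simp: sp_scal_def)
lemma scl_minus_left: "scl (- c) p = - scl c p"
  by transfer (auto simp: sp_scal_def)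

lemma scl_sum: "scl c (sum f I) = (\<Sum>i\<in>I. scl c (f i))"
  by (induction I rule: infinite_finite_induct) (auto simp: scl_add)

lemma mult_scl_left [simp]: "scl c p * q = scl c (p * q)"
  by transfer (simp add: sp_mult_scal_left)
lemma mult_scl_right [simp]: "q * scl c p = scl c (q * p)"
  by transfer (simp add: sp_mult_scal_right)

lemma sp_distrib_left: "(r::sp) * (p + q) = r * p + r * q"
  by transfer (simp add: sp_mult_add_right)
lemma sp_distrib_right: "((p::sp) + q) * r = p * r + q * r"
  by transfer (simp add: sp_mult_add_left)

lemma rep_sum: "rep_sp (sum f I) = (\<Sum>i\<in>I. rep_sp (f i))"
  by (induction I rule: infinite_finite_induct) (auto simp: zero_sp.rep_eq plus_sp.rep_eq)

lemma sum_fun_apply: "(\<Sum>i\<in>I. f i) x = (\<Sum>i\<in>I. f i x)" for f :: "_ \<Rightarrow> _ \<Rightarrow> 'a::comm_monoid_add"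
  by (induction I rule: infinite_finite_induct) auto

lemma finite_supp_rep: "finite (supp (rep_sp p))"
  using rep_sp[of p] by (simp add: good_def)

lemma adm_supp_rep: "s \<in> supp (rep_sp p) \<Longrightarrow> adm s"
  using rep_sp[of p] by (simp add: good_def)

lemma mon_expansion: "p = (\<Sum>s\<in>supp (rep_sp p). scl (rep_sp p s) (mon s))"
proof -
  have eq: "rep_sp p u = (\<Sum>s\<in>supp (rep_sp p). rep_sp (scl (rep_sp p s) (mon s)) u)" for u
  proof -
    have "(\<Sum>s\<in>supp (rep_sp p). rep_sp (scl (rep_sp p s) (mon s)) u)
        = (\<Sum>s\<in>supp (rep_sp p). if s = u then rep_sp p s else 0)"
      by (intro sum.cong refl) (simp add: scl.rep_eq mon.rep_eq adm_supp_rep sp_scal_def sp_mono_def)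
    also have "\<dots> = rep_sp p u" using finite_supp_rep by (simp add: sum.delta supp_def)
    finally show ?thesis by simp
  qed
  have "rep_sp p = rep_sp (\<Sum>s\<in>supp (rep_sp p). scl (rep_sp p s) (mon s))"
    unfolding rep_sum by (rule ext, subst sum_fun_apply, rule eq)
  then show ?thesis using rep_sp_inject by blast
qed

lemma sp_mon_induct [case_names zero mon scl add]:
  assumes "P 0" "\<And>s. adm s \<Longrightarrow> P (mon s)" "\<And>c p. P p \<Longrightarrow> P (scl c p)" "\<And>p q. P p \<Longrightarrow> P q \<Longrightarrow> P (p + q)"
  shows "P p"
proof -
  have "P (\<Sum>s\<in>S. scl (rep_sp p s) (mon s))" if "finite S" "\<forall>s\<in>S. adm s" for S
    using that by (induction S) (auto intro: assms)
  from this[of "supp (rep_sp p)"] show ?thesis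
    using mon_expansion[of p] finite_supp_rep adm_supp_rep by simp
qed

lemma mon_mult: "adm s \<Longrightarrow> adm t \<Longrightarrow> mon s * mon t = scl (mc s t) (mon (s + t))"
proof (transfer, goal_cases)
  case (1 s t)
  then show ?case
    by (auto simp: sp_mult_mono mc_def adm_add sp_scal_def)
qed

lemma mon_one: "mon (\<lambda>_. 0) = 1"
  by transfer (auto simp: sp_mono_def sp_one_def sp_const_def)

lemma sp_zero_mult: "(0::sp) * p = 0"
  using mult_scl_left[of 0 0 p] by simp

lemma sp_mult_zero: "(p::sp) * 0 = 0"
  using mult_scl_right[of p 0 0] by simp

lemma mon_mult_assoc:
  assumes "adm s" "adm t" "adm u"
  shows "mon s * mon t * mon u = mon s * (mon t * mon u)"
proof -
  \<comment> \<open>If \<open>s\<close> and \<open>t\<close> overlap, \<open>s + t\<close> is not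
    admissible and \<open>mon_mult\<close> does not apply, but then the coefficient
    \<open>mc s t\<close> is already zero.\<close>
  have 1: "scl (mc s t) (mon (s + t)) * mon u = scl (mc s t * mc (s + t) u) (mon (s + t + u))"
  proof (cases "overlap s t")
    case True
    then show ?thesis by (simp add: mc_def[of s t] sp_zero_mult)
  next
    case False
    then show ?thesis using assms by (simp add: mon_mult adm_add)
  qed
  have 2: "mon s * scl (mc t u) (mon (t + u)) = scl (mc t u * mc s (t + u)) (mon (s + (t + u)))"
  proof (cases "overlap t u")
    case True
    then show ?thesis by (simp add: mc_def[of t u] sp_mult_zero)
  next
    case False
    then show ?thesis using assms by (simp add: mon_mult adm_add)
  qed
  show ?thesis using assms 1 2 mc_cocycle[of s t u] by (simp add: mon_mult add.assoc)
qed

lemma sp_mult_assoc: "(p::sp) * q * r = p * (q * r)"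
proof -
  have 1: "mon s * mon t * r = mon s * (mon t * r)" if "adm s" "adm t" for s t r
    by (induction r rule: sp_mon_induct) (use that in \<open>auto simp: sp_mult_zero mon_mult_assoc sp_distrib_left\<close>)
  have 2: "mon s * q * r = mon s * (q * r)" if "adm s" for s q r
    by (induction q rule: sp_mon_induct) (use that in \<open>auto simp: sp_mult_zero sp_zero_mult 1 sp_distrib_left sp_distrib_right\<close>)
  show ?thesis
    by (induction p rule: sp_mon_induct) (auto simp: sp_zero_mult 2 sp_distrib_right)
qed

lemma mc_zero_left: "mc (\<lambda>_. 0) s = 1" and mc_zero_right: "mc s (\<lambda>_. 0) = 1"
  by (simp_all add: mc_def overlap_def mono_sign_inv_set inv_set_def)

lemma sp_one_mult: "(1::sp) * p = p"
  by (induction p rule: sp_mon_induct)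
     (auto simp: sp_mult_zero sp_distrib_left mon_one[symmetric] mon_mult mc_zero_left plus_fun_def)

lemma sp_mult_one: "(p::sp) * 1 = p"
  by (induction p rule: sp_mon_induct)
     (auto simp: sp_zero_mult sp_distrib_right mon_one[symmetric] mon_mult mc_zero_right plus_fun_def)

lemma sp_zero_neq_one: "(0::sp) \<noteq> 1"
proof
  assume "(0::sp) = 1"
  then have "0 = sp_one" by transfer
  then have "(0::spoly) (\<lambda>_. 0) = sp_one (\<lambda>_. 0)" by (rule arg_cong)
  then show False by (simp add: sp_one_def sp_const_def)
qed

instance sp :: ring_1
  by standard (auto simp: sp_mult_assoc sp_one_mult sp_mult_one sp_distrib_left sp_distrib_right
    sp_zero_neq_one)

lemma eq_neg_imp_zero: "(a::sp) = - a \<Longrightarrow> a = 0"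
proof -
  assume "a = - a"
  then have "a + a = 0" by (metis add.left_inverse)
  then have "scl (1/2) (a + a) = 0" by simp
  then have "scl (1/2 + 1/2) a = 0" unfolding scl_add scl_add_left .
  then show ?thesis by simp
qed

lemma cn_scl: "cn c = scl c 1"
  by transfer (auto simp: sp_const_def sp_scal_def sp_one_def)

section \<open>Words and functionals on words\<close>

definition sg :: "nat \<Rightarrow> 'a::ab_group_add \<Rightarrow> 'a" where
  "sg k a = (if even k then a else - a)"

lemma sg_0 [simp]: "sg 0 a = a" by (simp add: sg_def)
lemma sg_sg [simp]: "sg i (sg j a) = sg (i + j) a" by (simp add: sg_def)
lemma sg_zero [simp]: "sg k 0 = 0" by (simp add: sg_def)
lemma sg_add: "sg k (a + b) = sg k a + sg k b" by (simp add: sg_def)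
lemma sg_minus: "sg k (- a) = - sg k a" by (simp add: sg_def)
lemma sg_mult_left [simp]: "sg k a * b = sg k (a * b)" for a :: "'a::ring" by (simp add: sg_def)
lemma sg_mult_right [simp]: "a * sg k b = sg k (a * b)" for a :: "'a::ring" by (simp add: sg_def)
lemma sg_scl: "sg k (scl c a) = scl c (sg k a)" by (simp add: sg_def scl_minus)
lemma sg_cong: "even i = even j \<Longrightarrow> sg i a = sg j a" by (simp add: sg_def)
lemma scl_pow: "scl ((-1) ^ k) a = sg k a"
  by (cases "even k") (auto simp: sg_def scl_minus_left)

abbreviation word :: "var list \<Rightarrow> sp" where
  "word ys \<equiv> prod_list (map vr ys)"

lemma rep_word: "rep_sp (word ys) = sp_word ys"
  by (induction ys) (auto simp: one_sp.rep_eq times_sp.rep_eq vr.rep_eq)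

definition unit_mono :: "var \<Rightarrow> mono" where
  "unit_mono v = (\<lambda>w. if w = v then 1 else 0)"

lemma adm_unit_mono: "adm (unit_mono v)"
  unfolding unit_mono_def by (rule adm_var)

lemma vr_mon: "vr v = mon (unit_mono v)"
  using adm_unit_mono[of v]
  by transfer (auto simp: sp_var_def sp_mono_def unit_mono_def)

lemma vr_commute: "vr x * vr y = sg (vpar x * vpar y) (vr y * vr x)"
proof (cases "x = y")
  case True
  have "vr x * vr x = 0" if "vpar x = 1"
  proof -
    have "overlap (unit_mono x) (unit_mono x)"
      unfolding overlap_def by (rule exI[of _ x]) (simp add: that unit_mono_def)
    then show ?thesis by (simp add: vr_mon mon_mult adm_unit_mono mc_def)
  qed
  then show ?thesis using True vpar_cases[of x] by auto
next
  case False
  have ov: "\<not> overlap (unit_mono a) (unit_mono b)" if "a \<noteq> b" for a b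
    using that by (auto simp: overlap_def unit_mono_def)
  have inv: "inv_set (unit_mono a) (unit_mono b) = (if vpar a = 1 \<and> vpar b = 1 \<and> b < a then {(a, b)} else {})" for a b
    unfolding inv_set_def unit_mono_def by force
  have "mc (unit_mono x) (unit_mono y) = (-1) ^ (vpar x * vpar y) * mc (unit_mono y) (unit_mono x)"
    using False ov[of x y] ov[of y x] vpar_cases[of x] vpar_cases[of y]
    unfolding mc_def mono_sign_inv_set inv by (auto simp: not_less_iff_gr_or_eq)
  then show ?thesis
    unfolding vr_mon scl_pow[symmetric] by (simp add: mon_mult adm_unit_mono add.commute)
qed

text \<open>Every word is up to sign a permutation of a sorted word, so a function on words that obeys the
  sign rule for swapping adjacent letters is determined by its values on sorted words, i.e. it
  descends to a linear map (\<open>extw\<close>). Repeated odd letters need no separate condition, because swapping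
  two equal odd letters yields \<open>F ys = - F ys\<close>.\<close>

definition swp :: "(var list \<Rightarrow> sp) \<Rightarrow> bool" where
  "swp F \<longleftrightarrow> (\<forall>us x y vs. F (us @ x # y # vs) = sg (vpar x * vpar y) (F (us @ y # x # vs)))"

lemma swp_Cons: "swp F \<Longrightarrow> swp (\<lambda>ys. F (x # ys))"
  unfolding swp_def by (metis append_Cons)

lemma swp_prod:
  assumes "\<And>x y. f x * f y = sg (vpar x * vpar y) (f y * f x)"
  shows "swp (\<lambda>ys. prod_list (map f ys))"
proof -
  have eq: "f x * (f y * p) = sg (vpar x * vpar y) (f y * (f x * p))" for x y p
    using assms[of x y] by (metis mult.assoc sg_mult_left)
  show ?thesis unfolding swp_def
  proof (intro allI)
    fix us x y vs
    show "prod_list (map f (us @ x # y # vs)) = sg (vpar x * vpar y) (prod_list (map f (us @ y # x # vs)))"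
      by (simp add: eq[of x y "prod_list (map f vs)"])
  qed
qed

lemma swp_word: "swp word"
  by (rule swp_prod) (rule vr_commute)

lemma swp_move:
  "\<exists>k. \<forall>F. swp F \<longrightarrow> F (x # us @ vs) = sg k (F (us @ x # vs))"
proof (induction us)
  case Nil
  show ?case by (rule exI[of _ 0]) simp
next
  case (Cons u us)
  then obtain k where k: "\<And>F. swp F \<Longrightarrow> F (x # us @ vs) = sg k (F (us @ x # vs))" by blast
  have "F (x # (u # us) @ vs) = sg (vpar x * vpar u + k) (F ((u # us) @ x # vs))" if "swp F" for F
  proof -
    have "F ([] @ x # u # us @ vs) = sg (vpar x * vpar u) (F ([] @ u # x # us @ vs))"
      using that unfolding swp_def by blast
    also have "F ([] @ u # x # us @ vs) = sg k (F (u # us @ x # vs))"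
      using k[OF swp_Cons[OF that]] by simp
    finally show ?thesis by simp
  qed
  then show ?case by blast
qed

text \<open>The order of the quantifiers is the point: one sign serves every \<open>F\<close> at
  once. The sign relating a word to its sorted form in the algebra is therefore the one relating the
  two values of any other \<open>F\<close>.\<close>

lemma swp_perm:
  "mset xs = mset ys \<Longrightarrow> \<exists>k. \<forall>F. swp F \<longrightarrow> F xs = sg k (F ys)"
proof (induction xs arbitrary: ys)
  case Nil
  then show ?case by (intro exI[of _ 0]) simp
next
  case (Cons x xs)
  then have "x \<in> set ys" by (metis list.set_intros(1) mset_eq_setD)
  then obtain us vs where ys: "ys = us @ x # vs" by (meson split_list)
  then have "mset xs = mset (us @ vs)" using Cons.prems by simp
  then obtain k where k: "\<And>F. swp F \<Longrightarrow> F xs = sg k (F (us @ vs))" using Cons.IH by blast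
  obtain l where l: "\<And>F. swp F \<Longrightarrow> F (x # us @ vs) = sg l (F (us @ x # vs))" using swp_move by blast
  have "F (x # xs) = sg (k + l) (F ys)" if "swp F" for F
    using k[OF swp_Cons[OF that]] l[OF that] ys by simp
  then show ?case by blast
qed

lemma swp_dup:
  assumes "swp F" "vpar x = 1" "count_list ys x \<ge> 2"
  shows "F ys = 0"
proof -
  have "x \<in> set ys" using assms(3) by (metis count_notin not_numeral_le_zero)
  then obtain us vs where ys: "ys = us @ x # vs" by (meson split_list)
  then have "count_list (us @ vs) x \<ge> 1" using assms(3) by simp
  then have "x \<in> set (us @ vs)" by (metis count_notin not_one_le_zero)
  then obtain us' vs' where ys': "us @ vs = us' @ x # vs'" by (meson split_list)
  have "mset (us @ vs) = mset (us' @ x # vs')" using ys' by simp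
  then have "mset ys = mset (x # x # us' @ vs')" using ys by simp
  then obtain k where k: "F ys = sg k (F (x # x # us' @ vs'))" using swp_perm assms(1) by blast
  have "F ([] @ x # x # us' @ vs') = sg (vpar x * vpar x) (F ([] @ x # x # us' @ vs'))"
    using assms(1) unfolding swp_def by blast
  then have "F (x # x # us' @ vs') = - F (x # x # us' @ vs')" using assms(2) by (simp add: sg_def)
  then show ?thesis using k eq_neg_imp_zero by (metis sg_zero)
qed

text \<open>Multiplying by a letter that is at most all later ones creates no inversion, so each
  product of basis monomials has structure constant 1.\<close>

lemma sorted_word:
  assumes "sorted ys" "\<forall>v. vpar v = 1 \<longrightarrow> count_list ys v \<le> 1"
  shows "adm (count_list ys) \<and> word ys = mon (count_list ys)"
  using assms
proof (induction ys)
  case Nil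
  have "count_list [] = (\<lambda>_::var. 0)" by auto
  then show ?case by (simp add: mon_one del: count_list.simps)
next
  case (Cons y ys)
  have "\<forall>v. vpar v = 1 \<longrightarrow> count_list ys v \<le> 1"
  proof (intro allI impI)
    fix v assume "vpar v = 1"
    then have "count_list (y # ys) v \<le> 1" using Cons.prems(2) by blast
    then show "count_list ys v \<le> 1" by (simp split: if_splits)
  qed
  then have IH: "adm (count_list ys)" "word ys = mon (count_list ys)" using Cons by auto
  have eq: "unit_mono y + count_list ys = count_list (y # ys)" by (auto simp: unit_mono_def)
  have "count_list ys y = 0" if "vpar y = 1"
    using Cons.prems(2)[rule_format, OF that] by simp
  then have ov: "\<not> overlap (unit_mono y) (count_list ys)" by (auto simp: overlap_def unit_mono_def)
  have le: "y \<le> z" if "count_list ys z \<noteq> 0" for z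
    using that Cons.prems(1) by (metis count_notin sorted_simps(2))
  have "inv_set (unit_mono y) (count_list ys) = {}"
  proof (rule equals0I)
    fix z assume z: "z \<in> inv_set (unit_mono y) (count_list ys)"
    then have "unit_mono y (fst z) \<noteq> 0" unfolding mem_inv_set by (elim conjE)
    then have "fst z = y" unfolding unit_mono_def by (meson)
    moreover have "y \<le> snd z" using z unfolding mem_inv_set by (intro le) (elim conjE)
    moreover have "snd z < fst z" using z unfolding mem_inv_set by (elim conjE)
    ultimately show False by simp
  qed
  then have "mc (unit_mono y) (count_list ys) = 1" using ov by (simp add: mc_def mono_sign_inv_set)
  then have "mon (unit_mono y) * mon (count_list ys) = mon (count_list (y # ys))"
    using IH(1) by (simp add: mon_mult adm_unit_mono eq del: count_list.simps)
  then have "word (y # ys) = mon (count_list (y # ys))"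
    by (simp add: vr_mon[of y] IH(2) del: count_list.simps)
  then show ?case using adm_add[OF adm_unit_mono IH(1) ov] unfolding eq by blast
qed

lemma count_list_blocks:
  "distinct xs \<Longrightarrow> count_list (concat (map (\<lambda>v. replicate (s v) v) xs)) w = (if w \<in> set xs then s w else 0)"
proof (induction xs)
  case (Cons x xs)
  have "count_list (replicate k v) w = (if w = v then k else 0)" for k v by (induction k) auto
  then show ?case using Cons by auto
qed simp

lemma sorted_blocks:
  "sorted xs \<Longrightarrow> sorted (concat (map (\<lambda>v. replicate (s v) v) xs))"
  by (induction xs) (auto simp: sorted_append)

lemma count_mono_word: "adm s \<Longrightarrow> count_list (mono_word s) = s"
  unfolding mono_word_def by (rule ext) (auto simp: count_list_blocks adm_def supp_m_def)

lemma word_mono_word: "adm s \<Longrightarrow> word (mono_word s) = mon s"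
proof -
  assume a: "adm s"
  have "sorted (mono_word s)" unfolding mono_word_def by (rule sorted_blocks) simp
  then have "word (mono_word s) = mon (count_list (mono_word s))"
    using sorted_word a count_mono_word[OF a] by (simp add: adm_def)
  then show ?thesis using count_mono_word[OF a] by simp
qed

lemma sp_word_induct [case_names word scl add]:
  assumes "\<And>ys. P (word ys)" "\<And>c p. P p \<Longrightarrow> P (scl c p)" "\<And>p q. P p \<Longrightarrow> P q \<Longrightarrow> P (p + q)"
  shows "P p"
proof (induction p rule: sp_mon_induct)
  case zero
  show ?case using assms(2)[OF assms(1)[of "[]"], of 0] by simp
next
  case (mon s)
  then show ?case using assms(1)[of "mono_word s"] by (simp add: word_mono_word)
qed (use assms in auto)

text \<open>The operations \<open>sp_D\<close>, \<open>sp_eval\<close> and \<open>bracket\<close>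
  all sum a function of \<open>mono_word s\<close> over the support, so each of them is an instance
  of this extension, up to matrix coefficients for \<open>bracket\<close>.\<close>

definition extw :: "(var list \<Rightarrow> sp) \<Rightarrow> sp \<Rightarrow> sp" where
  "extw F p = (\<Sum>s\<in>supp (rep_sp p). scl (rep_sp p s) (F (mono_word s)))"

lemma extw_superset:
  "finite S \<Longrightarrow> supp (rep_sp p) \<subseteq> S \<Longrightarrow> extw F p = (\<Sum>s\<in>S. scl (rep_sp p s) (F (mono_word s)))"
  unfolding extw_def by (rule sum.mono_neutral_left) (auto simp: supp_def)

definition lin :: "(sp \<Rightarrow> sp) \<Rightarrow> bool" where
  "lin E \<longleftrightarrow> (\<forall>p q. E (p + q) = E p + E q) \<and> (\<forall>c p. E (scl c p) = scl c (E p))"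

lemma lin_add: "lin E \<Longrightarrow> E (p + q) = E p + E q" by (simp add: lin_def)
lemma lin_scl: "lin E \<Longrightarrow> E (scl c p) = scl c (E p)" by (simp add: lin_def)
lemma lin_zero: "lin E \<Longrightarrow> E 0 = 0" using lin_scl[of E 0 0] by simp
lemma lin_uminus: "lin E \<Longrightarrow> E (- p) = - E p"
  using lin_add[of E p "- p"] by (simp add: lin_zero eq_neg_iff_add_eq_0 add.commute)
lemma lin_diff: "lin E \<Longrightarrow> E (p - q) = E p - E q"
  using lin_add[of E p "- q"] by (simp add: lin_uminus)
lemma lin_sum: "lin E \<Longrightarrow> E (sum f I) = (\<Sum>i\<in>I. E (f i))"
  by (induction I rule: infinite_finite_induct) (auto simp: lin_zero lin_add)
lemma lin_sg: "lin E \<Longrightarrow> E (sg k p) = sg k (E p)"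
  by (simp add: sg_def lin_uminus)
lemma lin_comp: "lin E \<Longrightarrow> lin F \<Longrightarrow> lin (\<lambda>x. E (F x))" by (simp add: lin_def)

lemma lin_extw: "lin (extw F)"
proof -
  have "extw F (p + q) = extw F p + extw F q" for p q
  proof -
    let ?S = "supp (rep_sp p) \<union> supp (rep_sp q)"
    have f: "finite ?S" using finite_supp_rep by simp
    have "supp (rep_sp (p + q)) \<subseteq> ?S" using supp_add by (simp add: plus_sp.rep_eq)
    then show ?thesis
      using f by (simp add: extw_superset[of ?S] plus_sp.rep_eq scl_add_left sum.distrib)
  qed
  moreover have "extw F (scl c p) = scl c (extw F p)" for c p
  proof -
    have "supp (rep_sp (scl c p)) \<subseteq> supp (rep_sp p)" by (auto simp: supp_def scl.rep_eq sp_scal_def)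
    then show ?thesis
      using finite_supp_rep by (simp add: extw_superset[of "supp (rep_sp p)"] scl.rep_eq sp_scal_def scl_sum)
  qed
  ultimately show ?thesis by (simp add: lin_def)
qed

lemma extw_mon: "adm s \<Longrightarrow> extw F (mon s) = F (mono_word s)"
proof -
  assume a: "adm s"
  have "supp (rep_sp (mon s)) = {s}" "rep_sp (mon s) s = 1"
    using a by (simp_all add: mon.rep_eq supp_sp_mono) (simp add: sp_mono_def)
  then show ?thesis by (simp add: extw_def)
qed

lemma extw_word:
  assumes "swp F" shows "extw F (word ys) = F ys"
proof (cases "\<forall>v. vpar v = 1 \<longrightarrow> count_list ys v \<le> 1")
  case True
  let ?s = "count_list ys"
  have "supp_m ?s \<subseteq> set ys" by (rule subsetI, rule ccontr) (simp add: supp_m_def)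
  then have "finite (supp_m ?s)" by (rule finite_subset) simp
  then have adm: "adm ?s" using True unfolding adm_def by blast
  have "count (mset (mono_word ?s)) v = count (mset ys) v" for v
    unfolding count_mset count_mono_word[OF adm] ..
  then have "mset ys = mset (mono_word ?s)" by (intro multiset_eqI) simp
  then obtain k where k: "\<And>F. swp F \<Longrightarrow> F ys = sg k (F (mono_word ?s))" using swp_perm by blast
  have "word ys = sg k (mon ?s)" using k[OF swp_word] word_mono_word[OF adm] by simp
  then show ?thesis using k[OF assms] by (simp add: lin_sg[OF lin_extw] extw_mon[OF adm])
next
  case False
  then obtain v where "vpar v = 1" "\<not> count_list ys v \<le> 1" by blast
  moreover from this have "2 \<le> count_list ys v" by simp
  ultimately show ?thesis using swp_dup[OF swp_word] swp_dup[OF assms] by (simp add: lin_zero[OF lin_extw])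
qed

lemma lin_eqI: "lin E \<Longrightarrow> lin F \<Longrightarrow> (\<And>ys. E (word ys) = F (word ys)) \<Longrightarrow> E p = F p"
  by (induction p rule: sp_word_induct) (auto simp: lin_add lin_scl)

lemma lin_id: "lin (\<lambda>x. x)"
  by (simp add: lin_def)

lemma lin_mult_right: "lin E \<Longrightarrow> lin (\<lambda>x. E x * a)"
  by (simp add: lin_def distrib_right)

lemma lin_mult_left: "lin E \<Longrightarrow> lin (\<lambda>x. a * E x)"
  by (simp add: lin_def distrib_left)

lemma lin_plus: "lin E \<Longrightarrow> lin F \<Longrightarrow> lin (\<lambda>x. E x + F x)"
  by (simp add: lin_def scl_add algebra_simps)

lemma lin_const_sg: "lin E \<Longrightarrow> lin (\<lambda>x. sg k (E x))"
  by (simp add: lin_def sg_add sg_scl)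

subsection \<open>Parity\<close>

lemma lin_sig: "lin sig"
  unfolding lin_def by (transfer, auto simp: sp_sigma_def sp_scal_def algebra_simps)+

lemma sig_sig [simp]: "sig (sig p) = p"
  by transfer (auto simp: sp_sigma_def mult.assoc[symmetric] power_add[symmetric])

lemma sig_mon: "sig (mon s) = sg (mono_par s) (mon s)"
  unfolding scl_pow[symmetric] by transfer (auto simp: sp_sigma_def sp_mono_def sp_scal_def)

lemma even_mono_par:
  assumes "finite S" "supp_m s \<subseteq> S"
  shows "even (mono_par s) \<longleftrightarrow> even (\<Sum>v\<in>S. s v * vpar v)"
proof -
  have "(\<Sum>v\<in>supp_m s. s v * vpar v) = (\<Sum>v\<in>S. s v * vpar v)"
    by (rule sum.mono_neutral_left) (use assms in \<open>auto simp: supp_m_def\<close>)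
  then show ?thesis by (simp add: mono_par_def)
qed

lemma even_mono_par_add:
  assumes "adm s" "adm t"
  shows "even (mono_par (s + t)) \<longleftrightarrow> even (mono_par s + mono_par t)"
proof -
  let ?S = "supp_m s \<union> supp_m t"
  have f: "finite ?S" using assms by (simp add: adm_def)
  show ?thesis
    using even_mono_par[OF f, of "s + t"] even_mono_par[OF f, of s] even_mono_par[OF f, of t]
    by (simp add: supp_m_add sum.distrib distrib_right)
qed

lemma sig_mult: "sig (p * q) = sig p * sig q"
proof -
  have 1: "sig (mon s * mon t) = sig (mon s) * sig (mon t)" if "adm s" "adm t" for s t
  proof -
    have "sg (mono_par (s + t)) (mon (s + t)) = sg (mono_par s + mono_par t) (mon (s + t))"
      by (rule sg_cong) (rule even_mono_par_add[OF that])
    then show ?thesis by (simp add: mon_mult that lin_scl[OF lin_sig] sig_mon sg_scl add.commute)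
  qed
  have 2: "sig (mon s * q) = sig (mon s) * sig q" if "adm s" for s q
    by (induction q rule: sp_mon_induct)
       (use that in \<open>auto simp: 1 distrib_left lin_add[OF lin_sig] lin_scl[OF lin_sig] lin_zero[OF lin_sig]\<close>)
  show ?thesis
    by (induction p rule: sp_mon_induct)
       (auto simp: 2 distrib_right lin_add[OF lin_sig] lin_scl[OF lin_sig] lin_zero[OF lin_sig])
qed

lemma mono_par_zero: "mono_par (\<lambda>_. 0) = 0"
  by (simp add: mono_par_def supp_m_def)

lemma sig_one [simp]: "sig 1 = 1"
  unfolding mon_one[symmetric] by (simp add: sig_mon mono_par_zero)

lemma sig_vr: "sig (vr v) = sg (vpar v) (vr v)"
proof -
  have "supp_m (unit_mono v) = {v}" by (auto simp: supp_m_def unit_mono_def)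
  then have "even (mono_par (unit_mono v)) = even (vpar v)"
    by (simp add: mono_par_def unit_mono_def)
  then show ?thesis unfolding vr_mon sig_mon by (rule sg_cong)
qed

lemma sig_sg: "sig (sg k a) = sg k (sig a)" by (rule lin_sg[OF lin_sig])
lemmas sig_add = lin_add[OF lin_sig]
lemmas sig_scl = lin_scl[OF lin_sig]
lemmas sig_zero [simp] = lin_zero[OF lin_sig]

lemma sig_cn [simp]: "sig (cn c) = cn c"
  by (simp add: cn_scl sig_scl)

text \<open>The sign paid by something of parity \<open>c\<close> for passing \<open>x\<close>, in a
  form that also makes sense when \<open>x\<close> is not homogeneous.\<close>

definition tw :: "nat \<Rightarrow> sp \<Rightarrow> sp" where
  "tw c x = (if even c then x else sig x)"

lemma tw_0 [simp]: "tw 0 x = x" by (simp add: tw_def)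
lemma tw_tw [simp]: "tw i (tw j x) = tw (i + j) x" by (simp add: tw_def)
lemma tw_double [simp]: "tw (i + i) x = x" by (simp add: tw_def)
lemma tw_cong: "even i = even j \<Longrightarrow> tw i x = tw j x" by (simp add: tw_def)
lemma tw_mult: "tw c (x * y) = tw c x * tw c y" by (simp add: tw_def sig_mult)
lemma tw_one [simp]: "tw c 1 = 1" by (simp add: tw_def)
lemma lin_tw: "lin (tw c)"
  using lin_sig by (simp add: lin_def tw_def)
lemma tw_sig: "tw c (sig x) = sig (tw c x)" by (simp add: tw_def)
lemma tw_hom: "sig x = sg k x \<Longrightarrow> tw c x = sg (c * k) x" by (simp add: tw_def sg_def)

lemma tw_vr: "tw c (vr v) = sg (c * vpar v) (vr v)"
  by (rule tw_hom) (rule sig_vr)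

definition wpar :: "var list \<Rightarrow> nat" where
  "wpar ys = sum_list (map vpar ys)"

lemma sig_word: "sig (word ys) = sg (wpar ys) (word ys)"
  by (induction ys) (auto simp: wpar_def sig_mult sig_vr add.commute)

lemma tw_word: "tw c (word ys) = sg (c * wpar ys) (word ys)"
  by (rule tw_hom) (rule sig_word)

lemma vr_word_commute: "vr x * word ys = sg (vpar x * wpar ys) (word ys * vr x)"
proof (induction ys)
  case (Cons y ys)
  have "vr x * word (y # ys) = vr x * vr y * word ys" by (simp add: mult.assoc)
  also have "\<dots> = sg (vpar x * vpar y) (vr y * (vr x * word ys))"
    by (subst vr_commute) (simp add: mult.assoc)
  also have "\<dots> = sg (vpar x * wpar (y # ys)) (word (y # ys) * vr x)"
    unfolding Cons.IH by (simp add: mult.assoc wpar_def distrib_left)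
  finally show ?case .
qed (simp add: wpar_def)

lemma word_commute: "word xs * b = tw (wpar xs) b * word xs"
proof -
  have w: "word xs * word ys = tw (wpar xs) (word ys) * word xs" for ys
  proof (induction xs)
    case (Cons x xs)
    have "word (x # xs) * word ys = vr x * (word xs * word ys)" by (simp add: mult.assoc)
    also have "\<dots> = sg (wpar xs * wpar ys) (vr x * word ys * word xs)"
      unfolding Cons.IH by (simp add: tw_word mult.assoc)
    also have "\<dots> = sg (wpar xs * wpar ys + vpar x * wpar ys) (word ys * word (x # xs))"
      unfolding vr_word_commute by (simp add: mult.assoc)
    finally show ?case by (simp add: tw_word wpar_def distrib_right add.commute)
  qed (simp add: wpar_def)
  show ?thesis
    by (rule lin_eqI[where E = "\<lambda>b. word xs * b" and F = "\<lambda>b. tw (wpar xs) b * word xs"])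
       (intro lin_mult_left lin_mult_right lin_id lin_tw w)+
qed

lemma scl_half: "scl (1/2) (a + a) = a"
  unfolding scl_add scl_add_left[symmetric] by simp

lemma scomm:
  assumes "sig a = sg i a" shows "a * b = tw i b * a"
proof -
  \<comment> \<open>\<open>a + sg i (sig a)\<close> is twice the component of \<open>a\<close> of
    parity \<open>i\<close>. In this form the claim is linear in \<open>a\<close> and can be tested
    on words: a word of the wrong parity contributes 0, any other commutes by
    \<open>word_commute\<close>.\<close>
  have w: "(word xs + sg i (sig (word xs))) * b = tw i b * (word xs + sg i (sig (word xs)))" for xs
  proof (cases "even (i + wpar xs)")
    case True
    then have "sg i (sig (word xs)) = word xs" by (simp add: sig_word) (simp add: sg_def)
    moreover have "tw i b = tw (wpar xs) b" by (rule tw_cong) (use True in simp)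
    ultimately show ?thesis by (simp add: distrib_left distrib_right word_commute)
  next
    case False
    then have "sg i (sig (word xs)) = - word xs" by (simp add: sig_word) (simp add: sg_def)
    then show ?thesis by simp
  qed
  have "(a + sg i (sig a)) * b = tw i b * (a + sg i (sig a))"
    by (rule lin_eqI[where E = "\<lambda>a. (a + sg i (sig a)) * b" and F = "\<lambda>a. tw i b * (a + sg i (sig a))"])
       (intro lin_mult_left lin_mult_right lin_plus lin_id lin_const_sg lin_sig w)+
  moreover have "sg i (sig a) = a" using assms by (simp add: sg_def)
  ultimately have "a * b + a * b = tw i b * a + tw i b * a" by (simp add: distrib_left distrib_right)
  then have "scl (1/2) (a * b + a * b) = scl (1/2) (tw i b * a + tw i b * a)" by (rule arg_cong)
  then show ?thesis unfolding scl_half .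
qed

lemma scomm_right: "sig a = sg i a \<Longrightarrow> b * a = a * tw i b"
  using scomm[of a i "tw i b"] by simp

lemma scomm_hom: "sig a = sg i a \<Longrightarrow> sig b = sg j b \<Longrightarrow> a * b = sg (i * j) (b * a)"
  using scomm[of a i b] by (simp add: tw_hom)

lemma odd_square_zero: "sig a = - a \<Longrightarrow> a * a = 0"
  using scomm[of a 1 a] by (intro eq_neg_imp_zero) (simp add: sg_def tw_def)

subsection \<open>Homomorphisms and superderivations\<close>

definition hom :: "(sp \<Rightarrow> sp) \<Rightarrow> bool" where
  "hom \<phi> \<longleftrightarrow> lin \<phi> \<and> (\<forall>x y. \<phi> (x * y) = \<phi> x * \<phi> y) \<and> \<phi> 1 = 1 \<and> (\<forall>x. \<phi> (sig x) = sig (\<phi> x))"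

lemma hom_lin: "hom \<phi> \<Longrightarrow> lin \<phi>"
  and hom_mult: "hom \<phi> \<Longrightarrow> \<phi> (x * y) = \<phi> x * \<phi> y"
  and hom_one: "hom \<phi> \<Longrightarrow> \<phi> 1 = 1"
  and hom_sig: "hom \<phi> \<Longrightarrow> \<phi> (sig x) = sig (\<phi> x)"
  by (simp_all add: hom_def)

lemma hom_tw: "hom \<phi> \<Longrightarrow> \<phi> (tw c x) = tw c (\<phi> x)" by (simp add: tw_def hom_sig)
lemma hom_cn: "hom \<phi> \<Longrightarrow> \<phi> (cn c) = cn c" by (simp add: cn_scl lin_scl hom_lin hom_one)
lemma hom_id: "hom (\<lambda>x. x)" by (simp add: hom_def lin_id)

text \<open>Superderivations of parity \<open>c\<close> along a homomorphism \<phi>. The general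
  form is needed because composing a derivation with the reduction, with the projection to sl or
  with \<open>sig\<close> yields a derivation only along that map.\<close>

definition pder :: "(sp \<Rightarrow> sp) \<Rightarrow> nat \<Rightarrow> (sp \<Rightarrow> sp) \<Rightarrow> bool" where
  "pder \<phi> c E \<longleftrightarrow> lin E \<and> (\<forall>x y. E (x * y) = E x * \<phi> y + tw c (\<phi> x) * E y)"

lemma pder_lin: "pder \<phi> c E \<Longrightarrow> lin E"
  and pder_mult: "pder \<phi> c E \<Longrightarrow> E (x * y) = E x * \<phi> y + tw c (\<phi> x) * E y"
  by (simp_all add: pder_def)

lemma pder_one:
  assumes "hom \<phi>" "pder \<phi> c E" shows "E 1 = 0"
  using pder_mult[OF assms(2), of 1 1] by (simp add: hom_one[OF assms(1)])

lemma pder_cn: "hom \<phi> \<Longrightarrow> pder \<phi> c E \<Longrightarrow> E (cn a) = 0"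
  by (simp add: cn_scl lin_scl pder_lin pder_one)

lemma pder_unique:
  assumes "hom \<phi>" "pder \<phi> c E" "pder \<phi> c F" "\<And>v. E (vr v) = F (vr v)"
  shows "E p = F p"
proof (rule lin_eqI[where E = E and F = F])
  show "E (word ys) = F (word ys)" for ys
    by (induction ys) (use assms in \<open>auto simp: pder_one pder_mult\<close>)
qed (use assms in \<open>auto intro: pder_lin\<close>)

lemma hom_unique:
  assumes "hom \<phi>" "hom \<psi>" "\<And>v. \<phi> (vr v) = \<psi> (vr v)"
  shows "\<phi> p = \<psi> p"
proof (rule lin_eqI[where E = \<phi> and F = \<psi>])
  show "\<phi> (word ys) = \<psi> (word ys)" for ys
    by (induction ys) (use assms in \<open>auto simp: hom_one hom_mult\<close>)
qed (use assms in \<open>auto intro: hom_lin\<close>)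

primrec dword :: "(var \<Rightarrow> sp) \<Rightarrow> nat \<Rightarrow> var list \<Rightarrow> sp" where
  "dword d c [] = 0"
| "dword d c (y # ys) = d y * word ys + sg (c * vpar y) (vr y * dword d c ys)"

lemma dword_append:
  "dword d c (xs @ ys) = dword d c xs * word ys + tw c (word xs) * dword d c ys"
  by (induction xs) (auto simp: tw_mult tw_vr sg_add distrib_right distrib_left mult.assoc)

text \<open>Since \<open>d v\<close> has parity \<open>c + vpar v\<close>, exchanging two
  neighbouring letters exchanges the two Leibniz terms that differentiate them, each with the same
  sign.\<close>

lemma swp_dword:
  assumes d: "\<And>v. sig (d v) = sg (c + vpar v) (d v)"
  shows "swp (dword d c)"
  unfolding swp_def
proof (intro allI)
  fix us x y vs
  have c1: "d a * vr b = sg ((c + vpar a) * vpar b) (vr b * d a)" for a b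
    by (rule scomm_hom) (rule d, rule sig_vr)
  have e: "dword d c (a # b # vs) = d a * vr b * word vs + sg (c * vpar a) (vr a * d b * word vs)
      + sg (c * vpar a + c * vpar b) (vr a * vr b * dword d c vs)" for a b
    by (simp add: sg_add distrib_left mult.assoc)
  have 1: "d x * vr y = sg (vpar x * vpar y) (sg (c * vpar y) (vr y * d x))"
    unfolding c1 sg_sg by (rule sg_cong) (simp add: algebra_simps)
  have 2: "sg (c * vpar x) (vr x * d y) = sg (vpar x * vpar y) (d y * vr x)"
    unfolding c1 sg_sg by (rule sg_cong) auto
  have 3: "dword d c (x # y # vs) = sg (vpar x * vpar y) (dword d c (y # x # vs))"
  proof -
    have "dword d c (x # y # vs) = d x * vr y * word vs + (sg (c * vpar x) (vr x * d y)) * word vs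
      + sg (c * vpar x + c * vpar y) (vr x * vr y) * dword d c vs"
      unfolding e by simp
    also have "\<dots> = sg (vpar x * vpar y) (dword d c (y # x # vs))"
      unfolding 1 2 vr_commute[of x y] e by (simp add: sg_add algebra_simps)
    finally show ?thesis .
  qed
  have 4: "word (x # y # vs) = sg (vpar x * vpar y) (word (y # x # vs))"
    using swp_word unfolding swp_def by (metis append_Nil)
  show "dword d c (us @ x # y # vs) = sg (vpar x * vpar y) (dword d c (us @ y # x # vs))"
    unfolding dword_append 3 4 by (simp only: sg_mult_right sg_add)
qed

definition der :: "(var \<Rightarrow> sp) \<Rightarrow> nat \<Rightarrow> sp \<Rightarrow> sp" where
  "der d c = extw (dword d c)"

lemma pder_der:
  assumes d: "\<And>v. sig (d v) = sg (c + vpar v) (d v)"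
  shows "pder (\<lambda>x. x) c (der d c)"
proof -
  have l: "lin (der d c)" unfolding der_def by (rule lin_extw)
  have w: "der d c (word ys) = dword d c ys" for ys
    unfolding der_def by (rule extw_word[OF swp_dword[OF d]])
  have 1: "der d c (word xs * word ys) = der d c (word xs) * word ys + tw c (word xs) * der d c (word ys)" for xs ys
    using w[of "xs @ ys"] by (simp add: w dword_append)
  have 2: "der d c (word xs * q) = der d c (word xs) * q + tw c (word xs) * der d c q" for xs q
    by (rule lin_eqI[where E = "\<lambda>q. der d c (word xs * q)"])
       (intro lin_comp[OF l] lin_mult_left lin_plus lin_id l 1)+
  have "der d c (p * q) = der d c p * q + tw c p * der d c q" for p q
    by (rule lin_eqI[where E = "\<lambda>p. der d c (p * q)" and F = "\<lambda>p. der d c p * q + tw c p * der d c q"])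
       (intro lin_comp[OF l] lin_mult_right lin_plus lin_id l 2 lin_tw)+
  then show ?thesis using l by (simp add: pder_def)
qed

lemma der_vr:
  assumes d: "\<And>v. sig (d v) = sg (c + vpar v) (d v)"
  shows "der d c (vr v) = d v"
  using extw_word[OF swp_dword[OF d], of "[v]"] by (simp add: der_def)

text \<open>Both sides are superderivations along \<open>sig\<close>, so it suffices to compare them
  on variables, where homogeneity is assumed.\<close>

lemma pder_sig:
  assumes "pder (\<lambda>x. x) c E" "\<And>v. sig (E (vr v)) = sg (c + vpar v) (E (vr v))"
  shows "E (sig p) = sg c (sig (E p))"
proof (rule pder_unique[where \<phi> = sig and c = c and E = "\<lambda>p. E (sig p)" and F = "\<lambda>p. sg c (sig (E p))"])
  show "hom sig" by (simp add: hom_def lin_sig sig_mult)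
  show "pder sig c (\<lambda>p. E (sig p))"
    using pder_mult[OF assms(1)] lin_comp[OF pder_lin[OF assms(1)] lin_sig] by (simp add: pder_def sig_mult)
  show "pder sig c (\<lambda>p. sg c (sig (E p)))"
    using pder_mult[OF assms(1)] lin_const_sg[OF lin_comp[OF lin_sig pder_lin[OF assms(1)]]]
    by (simp add: pder_def sig_mult sig_add sg_add tw_sig)
  show "E (sig (vr v)) = sg c (sig (E (vr v)))" for v
    unfolding assms(2) sig_vr lin_sg[OF pder_lin[OF assms(1)]] sg_sg by (rule sg_cong) auto
qed

definition ev :: "(var \<Rightarrow> sp) \<Rightarrow> sp \<Rightarrow> sp" where
  "ev \<phi> = extw (\<lambda>ys. prod_list (map \<phi> ys))"

lemma
  assumes f: "\<And>v. sig (\<phi> v) = sg (vpar v) (\<phi> v)"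
  shows hom_ev: "hom (ev \<phi>)" and ev_vr: "ev \<phi> (vr v) = \<phi> v"
proof -
  have l: "lin (ev \<phi>)" unfolding ev_def by (rule lin_extw)
  have s: "swp (\<lambda>ys. prod_list (map \<phi> ys))" by (rule swp_prod) (rule scomm_hom[OF f f])
  have w: "ev \<phi> (word ys) = prod_list (map \<phi> ys)" for ys
    unfolding ev_def by (rule extw_word[OF s])
  show "ev \<phi> (vr v) = \<phi> v" using w[of "[v]"] by simp
  have 1: "ev \<phi> (word xs * word ys) = ev \<phi> (word xs) * ev \<phi> (word ys)" for xs ys
    using w[of "xs @ ys"] by (simp add: w)
  have 2: "ev \<phi> (word xs * q) = ev \<phi> (word xs) * ev \<phi> q" for xs q
    by (rule lin_eqI[where E = "\<lambda>q. ev \<phi> (word xs * q)"])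
       (intro lin_comp[OF l] lin_mult_left lin_id l 1)+
  have 3: "ev \<phi> (p * q) = ev \<phi> p * ev \<phi> q" for p q
    by (rule lin_eqI[where E = "\<lambda>p. ev \<phi> (p * q)" and F = "\<lambda>p. ev \<phi> p * ev \<phi> q"])
       (intro lin_comp[OF l] lin_mult_right lin_id l 2)+
  have "sig (prod_list (map \<phi> ys)) = sg (wpar ys) (prod_list (map \<phi> ys))" for ys
    by (induction ys) (auto simp: wpar_def sig_mult f add.commute)
  then have 4: "ev \<phi> (sig (word ys)) = sig (ev \<phi> (word ys))" for ys
    by (simp add: w sig_word lin_sg[OF l])
  have "ev \<phi> (sig p) = sig (ev \<phi> p)" for p
    by (rule lin_eqI[where E = "\<lambda>p. ev \<phi> (sig p)"]) (intro lin_comp[OF l] lin_comp[OF lin_sig] lin_sig l 4)+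
  then show "hom (ev \<phi>)" using l 3 w[of "[]"] by (simp add: hom_def)
qed

section \<open>The differential superalgebra and its brackets\<close>

lemma rep_sg: "rep_sp (sg k p) = sp_scal ((-1) ^ k) (rep_sp p)"
  by (simp add: scl_pow[symmetric] scl.rep_eq)

lemma rep_extw: "rep_sp (extw F p) = (\<Sum>s\<in>supp (rep_sp p). sp_scal (rep_sp p s) (rep_sp (F (mono_word s))))"
  by (simp add: extw_def rep_sum scl.rep_eq)

definition dif :: "sp \<Rightarrow> sp" where
  "dif = der (\<lambda>v. vr (Dv v)) 1"

lemma even_vpar_Dv: "even (vpar (Dv v)) \<longleftrightarrow> odd (vpar v)"
  by (cases v rule: prod_cases3) (simp add: vpar_def Dv_def)

lemma sig_vr_Dv: "sig (vr (Dv v)) = sg (1 + vpar v) (vr (Dv v))"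
  unfolding sig_vr by (rule sg_cong) (simp add: even_vpar_Dv)

lemma pder_dif: "pder (\<lambda>x. x) 1 dif"
  unfolding dif_def by (rule pder_der) (rule sig_vr_Dv)

lemma dif_vr: "dif (vr v) = vr (Dv v)"
  unfolding dif_def by (rule der_vr) (rule sig_vr_Dv)

lemma rep_dword_Dv: "rep_sp (dword (\<lambda>v. vr (Dv v)) 1 ys) = wordD ys"
  by (induction ys)
     (simp_all add: zero_sp.rep_eq plus_sp.rep_eq times_sp.rep_eq rep_sg vr.rep_eq rep_word)

lemma rep_dif: "rep_sp (dif p) = sp_D (rep_sp p)"
  unfolding dif_def der_def rep_extw sp_D_def rep_dword_Dv ..

lemma lin_dif: "lin dif" by (rule pder_lin[OF pder_dif])
lemmas dif_add = lin_add[OF lin_dif]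
lemmas dif_scl = lin_scl[OF lin_dif]
lemmas dif_zero [simp] = lin_zero[OF lin_dif]

lemma dif_mult: "dif (x * y) = dif x * y + sig x * dif y"
  using pder_mult[OF pder_dif] by (simp add: tw_def)

lemma dif_sig: "dif (sig p) = - sig (dif p)"
  using pder_sig[OF pder_dif, of p] by (simp add: dif_vr sig_vr_Dv sg_def)

lemma dif_cn [simp]: "dif (cn c) = 0"
  by (rule pder_cn[OF hom_id pder_dif])

lemma dif_one [simp]: "dif 1 = 0"
  by (rule pder_one[OF hom_id pder_dif])

lemma hom_dif:
  assumes f: "hom f" and v: "\<And>v. f (vr (Dv v)) = dif (f (vr v))"
  shows "f (dif p) = dif (f p)"
proof (rule pder_unique[where E = "\<lambda>p. f (dif p)" and F = "\<lambda>p. dif (f p)" and \<phi> = f and c = 1])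
  show "pder f 1 (\<lambda>p. f (dif p))"
    using lin_comp[OF hom_lin[OF f] lin_dif] f
    by (simp add: pder_def dif_mult lin_add[OF hom_lin[OF f]] hom_mult hom_sig tw_def)
  show "pder f 1 (\<lambda>p. dif (f p))"
    using lin_comp[OF lin_dif hom_lin[OF f]] f
    by (simp add: pder_def dif_mult hom_mult tw_def)
qed (simp_all add: f dif_vr v)

lemma hom_dif_funpow:
  "(\<And>p. f (dif p) = dif (f p)) \<Longrightarrow> f ((dif ^^ m) p) = (dif ^^ m) (f p)"
  by (induction m) auto

lemma lin_dif_funpow: "lin (dif ^^ m)"
proof (induction m)
  case 0
  then show ?case by (simp add: lin_def)
next
  case (Suc m)
  then show ?case by (simp add: lin_def dif_add dif_scl)
qed

lemma dif_funpow_vr: "(dif ^^ m) (vr (i, j, k)) = vr (i, j, k + m)"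
  by (induction m) (auto simp: dif_vr Dv_def)

lemma rep_dif_funpow: "rep_sp ((dif ^^ m) p) = (sp_D ^^ m) (rep_sp p)"
  by (induction m) (auto simp: rep_dif)

lemma rep_ev: "rep_sp (ev \<phi> p) = sp_eval (\<lambda>v. rep_sp (\<phi> v)) (rep_sp p)"
proof -
  have "rep_sp (prod_list (map \<phi> ys)) = foldr sp_mult (map (\<lambda>v. rep_sp (\<phi> v)) ys) sp_one" for ys
    by (induction ys) (auto simp: one_sp.rep_eq times_sp.rep_eq)
  then show ?thesis unfolding ev_def rep_extw sp_eval_def by simp
qed

section \<open>Brackets with matrix units as families of superderivations\<close>

definition lieS :: "nat \<Rightarrow> nat \<Rightarrow> nat \<Rightarrow> nat \<Rightarrow> sp" where
  "lieS a b c d = (if b = c then vr (a, d, 0) else 0)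
     - (if a = d then sg (pe a b * pe c d) (vr (c, b, 0)) else 0)"

definition brbS :: "nat \<Rightarrow> nat \<Rightarrow> nat \<Rightarrow> nat \<Rightarrow> nat \<Rightarrow> sp" where
  "brbS a b c d k = (if k = 0 then sg (pe a b * (pe c d + 1)) (lieS a b c d)
      else if k = 1 then cn (form_ee a b c d) else 0)"

definition stepS :: "nat \<Rightarrow> (nat \<Rightarrow> sp) \<Rightarrow> nat \<Rightarrow> sp" where
  "stepS P F k = sg P (sg k (dif (F k)) + (if k = 0 then 0 else sg (k - 1) (F (k - 1))))"

definition brvS :: "nat \<Rightarrow> nat \<Rightarrow> var \<Rightarrow> nat \<Rightarrow> sp" where
  "brvS a b v = (case v of (c, d, m) \<Rightarrow> (stepS (pe a b) ^^ m) (brbS a b c d))"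

lemma brvS_Dv: "brvS a b (Dv v) = stepS (pe a b) (brvS a b v)"
  by (cases v) (simp add: brvS_def Dv_def)

lemma rep_lieS: "rep_sp (lieS a b c d) = lie_bar a b c d"
  by (simp add: lieS_def lie_bar_def minus_sp.rep_eq zero_sp.rep_eq vr.rep_eq rep_sg)

lemma rep_brbS: "rep_sp (brbS a b c d k) = br_base a b c d k"
  by (simp add: brbS_def br_base_def rep_sg rep_lieS cn.rep_eq zero_sp.rep_eq)

lemma rep_stepS: "rep_sp (stepS P F k) = sp_scal ((-1) ^ P) (cs_Dchi (\<lambda>k. rep_sp (F k)) k)"
  by (simp add: stepS_def cs_Dchi_def rep_sg plus_sp.rep_eq rep_dif zero_sp.rep_eq)

lemma rep_brvS: "rep_sp (brvS a b v k) = brv a b v k"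
proof -
  obtain c d m where v: "v = (c, d, m)" by (cases v)
  have "(\<lambda>k. rep_sp ((stepS P ^^ m) F k)) = ((\<lambda>F k. sp_scal ((-1) ^ P) (cs_Dchi F k)) ^^ m) (\<lambda>k. rep_sp (F k))" for P F
    by (induction m) (simp_all add: rep_stepS)
  from fun_cong[OF this, of "pe a b" "brbS a b c d" k]
  show ?thesis by (simp add: v brvS_def brv_def rep_brbS)
qed

lemma even_pe [simp]: "even (pe a b) \<longleftrightarrow> even (ppar a + ppar b)"
  by (simp add: pe_def)

lemma even_vpar: "even (vpar (i, j, m)) \<longleftrightarrow> even (ppar i + ppar j + 1 + m)"
  by (simp add: vpar_def)

lemma sig_brbS: "sig (brbS a b c d k) = sg (pe a b + k + vpar (c, d, 0)) (brbS a b c d k)"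
proof -
  have 1: "sig (lieS a b c d) = sg (pe a b + vpar (c, d, 0)) (lieS a b c d)"
    unfolding lieS_def lin_diff[OF lin_sig] if_distrib[of sig] sig_sg sig_vr
    by (auto simp: sg_def even_vpar)
  have 2: "form_ee a b c d = 0 \<or> even (pe a b + 1 + vpar (c, d, 0))"
    by (auto simp: form_ee_def even_vpar)
  show ?thesis
  proof (cases "k = 0")
    case True
    then show ?thesis by (simp add: brbS_def sig_sg 1 add.commute)
  next
    case False
    have "cn (form_ee a b c d) = sg (pe a b + 1 + vpar (c, d, 0)) (cn (form_ee a b c d))"
      using 2
    proof
      assume "form_ee a b c d = 0"
      then show ?thesis by (simp add: cn_scl)
    next
      assume "even (pe a b + 1 + vpar (c, d, 0))"
      then show ?thesis by (simp only: sg_def if_True)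
    qed
    then show ?thesis using False by (simp add: brbS_def)
  qed
qed

lemma sig_stepS:
  assumes "\<And>k. sig (F k) = sg (i + k) (F k)"
  shows "sig (stepS P F k) = sg (i + k + 1) (stepS P F k)"
proof -
  have d: "sig (dif (F k)) = sg (i + k + 1) (dif (F k))" for k
  proof -
    have "sg (i + k) (dif (F k)) = - sig (dif (F k))"
      using dif_sig[of "F k"] unfolding assms lin_sg[OF lin_dif] .
    then have "sig (dif (F k)) = - sg (i + k) (dif (F k))" by (metis minus_minus)
    then show ?thesis by (simp add: sg_def)
  qed
  show ?thesis
  proof (cases k)
    case 0
    then show ?thesis by (simp add: stepS_def sig_sg sig_add d sg_add add.commute)
  next
    case (Suc j)
    show ?thesis unfolding Suc
      by (cases "even P"; cases "even i"; cases "even j")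
         (simp_all add: stepS_def sig_sg sig_add d assms sg_add sg_def lin_diff[OF lin_sig] lin_uminus[OF lin_sig])
  qed
qed

lemma sig_brvS: "sig (brvS a b v k) = sg (pe a b + k + vpar v) (brvS a b v k)"
proof -
  obtain c d m where v: "v = (c, d, m)" by (cases v)
  have "sig (brvS a b (c, d, m) k) = sg (pe a b + vpar (c, d, m) + k) (brvS a b (c, d, m) k)" for k
  proof (induction m arbitrary: k)
    case 0
    then show ?case using sig_brbS[of a b c d k] by (simp add: brvS_def add_ac)
  next
    case (Suc m)
    have e: "brvS a b (c, d, Suc m) = stepS (pe a b) (brvS a b (c, d, m))"
      using brvS_Dv[of a b "(c, d, m)"] by (simp add: Dv_def)
    show ?case unfolding e
      by (subst sig_stepS[OF Suc.IH]) (rule sg_cong, auto simp: even_vpar)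
  qed
  then show ?thesis by (simp add: v add_ac)
qed

text \<open>The parity \<open>pe a b + k\<close> combines the sign of the Leibniz rule with the sign
  for moving a left factor past \<chi>^k.\<close>

definition brk :: "nat \<Rightarrow> nat \<Rightarrow> nat \<Rightarrow> sp \<Rightarrow> sp" where
  "brk a b k = der (\<lambda>v. brvS a b v k) (pe a b + k)"

lemma pder_brk: "pder (\<lambda>x. x) (pe a b + k) (brk a b k)"
  unfolding brk_def by (rule pder_der) (rule sig_brvS)

lemma brk_vr: "brk a b k (vr v) = brvS a b v k"
  unfolding brk_def by (rule der_vr) (rule sig_brvS)

lemma lin_brk: "lin (brk a b k)" by (rule pder_lin[OF pder_brk])

lemma brk_mult: "brk a b k (x * y) = brk a b k x * y + tw (pe a b + k) x * brk a b k y"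
  by (rule pder_mult[OF pder_brk])

lemma brk_sig: "brk a b k (sig p) = sg (pe a b + k) (sig (brk a b k p))"
  by (rule pder_sig[OF pder_brk]) (simp add: brk_vr sig_brvS)

lemma rep_brk:
  "rep_sp (brk a b k p) = (\<Sum>s\<in>supp (rep_sp p). sp_scal (rep_sp p s) (brw a b (mono_word s) k))"
proof -
  have "rep_sp (dword (\<lambda>v. brvS a b v k) (pe a b + k) ys) = brw a b ys k" for ys
    by (induction ys)
       (simp_all add: zero_sp.rep_eq plus_sp.rep_eq times_sp.rep_eq rep_sg vr.rep_eq rep_word
         rep_brvS distrib_right add.commute)
  then show ?thesis unfolding brk_def der_def rep_extw by simp
qed

text \<open>Sesquilinearity, imposed on generators only, extends to the whole algebra: the
  supercommutator of \<open>brk a b k\<close> with \<open>dif\<close> is a superderivation, and so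
  is the signed multiple of \<open>brk a b (k - 1)\<close> that it should equal. Their parities
  agree since \<open>k - 1\<close> and \<open>k + 1\<close> do.\<close>

lemma brk_dif: "brk a b k (dif p) = stepS (pe a b) (\<lambda>k. brk a b k p) k"
proof -
  let ?c = "pe a b + k"
  let ?E = "\<lambda>p. brk a b k (dif p) + sg (?c + 1) (dif (brk a b k p))"
  let ?F = "\<lambda>p. if k = 0 then 0 else sg (pe a b + (k - 1)) (brk a b (k - 1) p)"
  have E: "pder (\<lambda>x. x) (?c + 1) ?E"
  proof -
    have "lin ?E"
      by (rule lin_plus[OF lin_comp[OF lin_brk lin_dif] lin_const_sg[OF lin_comp[OF lin_dif lin_brk]]])
    moreover have "?E (x * y) = ?E x * y + tw (?c + 1) x * ?E y" for x y
    proof -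
      have 1: "brk a b k (dif (x * y)) = brk a b k (dif x) * y + tw ?c (dif x) * brk a b k y
          + sg ?c (sig (brk a b k x) * dif y) + tw ?c (sig x) * brk a b k (dif y)"
        by (simp add: dif_mult brk_mult lin_add[OF lin_brk] brk_sig)
      have 2: "dif (brk a b k (x * y)) = dif (brk a b k x) * y + sig (brk a b k x) * dif y
          + dif (tw ?c x) * brk a b k y + sig (tw ?c x) * dif (brk a b k y)"
        by (simp add: brk_mult dif_mult dif_add)
      have 3: "sg (?c + 1) (dif (tw ?c x)) = - tw ?c (dif x)"
        by (auto simp: sg_def tw_def dif_sig)
      have 4: "sg (?c + 1) (dif (tw ?c x) * q) = - (tw ?c (dif x) * q)" for q
        using arg_cong[OF 3, of "\<lambda>z. z * q"] by simp
      have 5: "sig (tw ?c x) = tw (?c + 1) x" "tw ?c (sig x) = tw (?c + 1) x"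
        by (auto simp: tw_def)
      have 6: "sg (?c + 1) q = - sg ?c q" for q :: sp
        by (simp add: sg_def)
      show ?thesis unfolding 1 2 5 sg_add 4 unfolding 6
        by (simp add: algebra_simps)
    qed
    ultimately show ?thesis by (simp only: pder_def) blast
  qed
  have F: "pder (\<lambda>x. x) (?c + 1) ?F"
  proof (cases "k = 0")
    case True
    then show ?thesis by (simp add: pder_def lin_def)
  next
    case False
    have "tw (pe a b + (k - 1)) x = tw (?c + 1) x" for x
      by (rule tw_cong) (use False in \<open>cases k, auto\<close>)
    then show ?thesis
      using False lin_const_sg[OF lin_brk, of "pe a b + (k - 1)" a b "k - 1"]
      by (simp add: pder_def brk_mult sg_add)
  qed
  have "?E p = ?F p"
  proof (rule pder_unique[OF hom_id E F])
    fix v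
    show "?E (vr v) = ?F (vr v)"
      unfolding dif_vr brk_vr brvS_Dv stepS_def by (cases k) (auto simp: sg_def)
  qed
  then have "brk a b k (dif p) = ?F p - sg (?c + 1) (dif (brk a b k p))" by (simp add: eq_diff_eq)
  then show ?thesis unfolding stepS_def by (cases k) (auto simp: sg_def)
qed

definition bracketS :: "nat \<Rightarrow> mat \<Rightarrow> sp \<Rightarrow> nat \<Rightarrow> sp" where
  "bracketS n X p k = (\<Sum>a\<in>Iset n. \<Sum>b\<in>Iset n. scl (X a b) (brk a b k p))"

lemma rep_bracketS: "rep_sp (bracketS n X p k) = bracket n X (rep_sp p) k"
  unfolding bracketS_def bracket_def rep_sum scl.rep_eq rep_brk ..

definition barS :: "nat \<Rightarrow> mat \<Rightarrow> sp" where
  "barS n X = (\<Sum>i\<in>Iset n. \<Sum>j\<in>Iset n. scl (X i j) (vr (i, j, 0)))"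

lemma rep_barS: "rep_sp (barS n X) = bar n X"
  unfolding barS_def bar_def rep_sum scl.rep_eq vr.rep_eq ..

subsection \<open>Generated subalgebras and ideals\<close>

inductive_set agen :: "sp set \<Rightarrow> sp set" for G where
  const: "cn c \<in> agen G"
| gen: "g \<in> G \<Longrightarrow> g \<in> agen G"
| add: "a \<in> agen G \<Longrightarrow> b \<in> agen G \<Longrightarrow> a + b \<in> agen G"
| scal: "a \<in> agen G \<Longrightarrow> scl c a \<in> agen G"
| mult: "a \<in> agen G \<Longrightarrow> b \<in> agen G \<Longrightarrow> a * b \<in> agen G"

lemma alg_gen_rep: "alg_gen (rep_sp ` G) = rep_sp ` agen G"
proof (intro set_eqI iffI)
  fix x assume "x \<in> alg_gen (rep_sp ` G)"
  then show "x \<in> rep_sp ` agen G"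
  proof induction
    case (const c)
    show ?case unfolding cn.rep_eq[symmetric] by (intro imageI agen.const)
  next
    case (gen g)
    then show ?case using agen.gen by blast
  next
    case (add a b)
    then obtain a' b' where h: "a' \<in> agen G" "a = rep_sp a'" "b' \<in> agen G" "b = rep_sp b'" by blast
    show ?case unfolding h plus_sp.rep_eq[symmetric] by (intro imageI agen.add h)
  next
    case (scal a c)
    then obtain a' where h: "a' \<in> agen G" "a = rep_sp a'" by blast
    show ?case unfolding h scl.rep_eq[symmetric] by (intro imageI agen.scal h)
  next
    case (mult a b)
    then obtain a' b' where h: "a' \<in> agen G" "a = rep_sp a'" "b' \<in> agen G" "b = rep_sp b'" by blast
    show ?case unfolding h times_sp.rep_eq[symmetric] by (intro imageI agen.mult h)
  qed
next
  have "rep_sp a \<in> alg_gen (rep_sp ` G)" if "a \<in> agen G" for a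
    using that
    by induction (unfold cn.rep_eq plus_sp.rep_eq scl.rep_eq times_sp.rep_eq,
      (blast intro: alg_gen.intros)+)
  then show "x \<in> alg_gen (rep_sp ` G)" if "x \<in> rep_sp ` agen G" for x using that by blast
qed

definition VS :: "nat \<Rightarrow> mat set \<Rightarrow> sp set" where
  "VS n S = agen {(dif ^^ m) (barS n X) | X m. X \<in> S}"

lemma Vsub_rep: "Vsub n S = rep_sp ` VS n S"
proof -
  have "{(sp_D ^^ m) (bar n X) | X m. X \<in> S} = rep_sp ` {(dif ^^ m) (barS n X) | X m. X \<in> S}"
    unfolding rep_barS[symmetric] rep_dif_funpow[symmetric] by blast
  then show ?thesis unfolding Vsub_def VS_def by (simp add: alg_gen_rep)
qed

inductive_set JS :: "nat \<Rightarrow> sp set" for n where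
  gen: "X \<in> nil_set n \<Longrightarrow> barS n X - cn (form n (fmat n) X) \<in> JS n"
| zero: "0 \<in> JS n"
| add: "a \<in> JS n \<Longrightarrow> b \<in> JS n \<Longrightarrow> a + b \<in> JS n"
| lmult: "a \<in> VS n (sl_set n) \<Longrightarrow> x \<in> JS n \<Longrightarrow> a * x \<in> JS n"
| rmult: "a \<in> VS n (sl_set n) \<Longrightarrow> x \<in> JS n \<Longrightarrow> x * a \<in> JS n"
| deriv: "x \<in> JS n \<Longrightarrow> dif x \<in> JS n"

lemma Jid_rep: "Jid n = rep_sp ` JS n"
proof (intro set_eqI iffI)
  fix x assume "x \<in> Jid n"
  then show "x \<in> rep_sp ` JS n"
  proof induction
    case (gen X)
    then have "rep_sp (barS n X - cn (form n (fmat n) X)) \<in> rep_sp ` JS n" by (intro imageI JS.gen)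
    then show ?case unfolding minus_sp.rep_eq rep_barS cn.rep_eq .
  next
    case zero
    show ?case unfolding zero_sp.rep_eq[symmetric] by (intro imageI JS.zero)
  next
    case (add a b)
    then obtain a' b' where h: "a' \<in> JS n" "a = rep_sp a'" "b' \<in> JS n" "b = rep_sp b'" by blast
    show ?case unfolding h plus_sp.rep_eq[symmetric] by (intro imageI JS.add h)
  next
    case (lmult a x)
    then obtain a' x' where h: "a' \<in> VS n (sl_set n)" "a = rep_sp a'" "x' \<in> JS n" "x = rep_sp x'"
      unfolding Vsub_rep by blast
    show ?case unfolding h times_sp.rep_eq[symmetric] by (intro imageI JS.lmult h)
  next
    case (rmult a x)
    then obtain a' x' where h: "a' \<in> VS n (sl_set n)" "a = rep_sp a'" "x' \<in> JS n" "x = rep_sp x'"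
      unfolding Vsub_rep by blast
    show ?case unfolding h times_sp.rep_eq[symmetric] by (intro imageI JS.rmult h)
  next
    case (deriv x)
    then obtain x' where h: "x' \<in> JS n" "x = rep_sp x'" by blast
    show ?case unfolding h rep_dif[symmetric] by (intro imageI JS.deriv h)
  qed
next
  have "rep_sp a \<in> Jid n" if "a \<in> JS n" for a
    using that
  proof induction
    case (gen X)
    then show ?case unfolding minus_sp.rep_eq rep_barS cn.rep_eq by (rule Jid.gen)
  qed (unfold zero_sp.rep_eq plus_sp.rep_eq times_sp.rep_eq rep_dif,
    (blast intro: Jid.intros Vsub_rep[THEN equalityD2, THEN subsetD])+)
  then show "x \<in> Jid n" if "x \<in> rep_sp ` JS n" for x using that by blast
qed

definition WS :: "nat \<Rightarrow> sp set" where
  "WS n = {w \<in> VS n (p_set n). \<forall>X\<in>nil_set n. \<forall>k. bracketS n X w k \<in> JS n}"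

lemma Wset_rep: "Wset n = rep_sp ` WS n"
proof -
  have "bracket n X (rep_sp w) k \<in> Jid n \<longleftrightarrow> bracketS n X w k \<in> JS n" for X w k
    unfolding rep_bracketS[symmetric] Jid_rep by (simp add: inj_image_mem_iff inj_def rep_sp_inject)
  then show ?thesis unfolding Wset_def WS_def Vsub_rep by auto
qed

subsection \<open>Differential operators and the row determinant\<close>

definition AS :: "nat \<Rightarrow> nat \<Rightarrow> nat \<Rightarrow> sp" where
  "AS i j k = abs_sp (Amat i j k)"

definition eS :: "nat \<Rightarrow> nat \<Rightarrow> sp" where
  "eS j i = sg (ppar j) (vr (j, i, 0))"

lemma rep_eS: "rep_sp (eS j i) = eup j i"
  by (simp add: eS_def eup_def rep_sg vr.rep_eq)

lemma abs_rep: "abs_sp (rep_sp p) = p" by (rule rep_sp_inverse)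

lemma Amat_rep: "Amat i j k = rep_sp (if i = j then (if k = 1 then 1 else if k = 0 then eS j i else 0)
     else if i < j then (if k = 0 then eS j i else 0)
     else if i = j + 1 then (if k = 0 then cn (-1) else 0) else 0)"
  by (simp add: Amat_def rep_eS one_sp.rep_eq zero_sp.rep_eq cn.rep_eq)

lemma AS_eq: "AS i j k = (if i = j then (if k = 1 then 1 else if k = 0 then eS j i else 0)
     else if i < j then (if k = 0 then eS j i else 0)
     else if i = j + 1 then (if k = 0 then cn (-1) else 0) else 0)"
  unfolding AS_def Amat_rep abs_rep ..

lemma rep_AS: "rep_sp (AS i j k) = Amat i j k"
  unfolding AS_eq Amat_rep ..

definition ldS :: "(nat \<Rightarrow> sp) \<Rightarrow> nat \<Rightarrow> sp" where
  "ldS Q l = dif (Q l) + (if l = 0 then 0 else sig (Q (l - 1)))"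

text \<open>Correct only for a left factor of order at most 1 in \<open>D\<close>. This suffices
  because the row product is folded from the right and every entry of \<open>\<A>\<close> has order
  at most 1.\<close>

definition mS :: "(nat \<Rightarrow> sp) \<Rightarrow> (nat \<Rightarrow> sp) \<Rightarrow> nat \<Rightarrow> sp" where
  "mS P Q l = P 0 * Q l + P 1 * ldS Q l"

definition oneS :: "nat \<Rightarrow> sp" where
  "oneS k = (if k = 0 then 1 else 0)"

lemma rep_ldS: "dop_lD (\<lambda>l. rep_sp (Q l)) = (\<lambda>l. rep_sp (ldS Q l))"
  by (rule ext) (simp add: dop_lD_def ldS_def plus_sp.rep_eq rep_dif zero_sp.rep_eq sig.rep_eq)

lemma sp_mult_zero_left: "sp_mult 0 q = 0"
  by (rule ext) (simp add: sp_mult_def supp_def)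

lemma rep_mS:
  assumes "\<And>k. k \<ge> 2 \<Longrightarrow> P k = 0"
  shows "dop_mult (\<lambda>l. rep_sp (P l)) (\<lambda>l. rep_sp (Q l)) = (\<lambda>l. rep_sp (mS P Q l))"
proof -
  let ?P = "\<lambda>l. rep_sp (P l)" and ?Q = "\<lambda>l. rep_sp (Q l)"
  have "dop_supp ?P \<subseteq> {0, 1}"
  proof
    fix k assume "k \<in> dop_supp ?P"
    then have "P k \<noteq> 0" by (auto simp: dop_supp_def zero_sp.rep_eq)
    then have "\<not> k \<ge> 2" using assms by blast
    then show "k \<in> {0, 1}" by auto
  qed
  then have "dop_mult ?P ?Q = (\<Sum>k\<in>{0, 1}. (\<lambda>l. sp_mult (?P k) ((dop_lD ^^ k) ?Q l)))"
    unfolding dop_mult_def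
  proof (intro sum.mono_neutral_left ballI)
    fix k assume "k \<in> {0, 1} - dop_supp ?P"
    then have "?P k = 0" by (simp add: dop_supp_def)
    then show "(\<lambda>l. sp_mult (?P k) ((dop_lD ^^ k) ?Q l)) = 0"
      by (simp only: sp_mult_zero_left) (simp add: zero_fun_def)
  qed auto
  then show ?thesis
    by (simp add: fun_eq_iff rep_ldS mS_def plus_sp.rep_eq times_sp.rep_eq)
qed

text \<open>Coefficient of \<open>D\<^sup>l\<close> in the row determinant of the block of \<open>\<A>\<close> with rows and columns \<open>a, \<dots>, N\<close>.\<close>

definition rdS :: "nat \<Rightarrow> nat \<Rightarrow> nat \<Rightarrow> sp" where
  "rdS a N l = (\<Sum>\<sigma>\<in>{\<sigma>. \<sigma> permutes {a..N}}.
     scl (of_int (sign \<sigma>)) (foldr mS (map (\<lambda>i. AS i (\<sigma> i)) [a..<N+1]) oneS l))"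

lemma rep_foldr_mS:
  "foldr dop_mult (map (\<lambda>i. Amat i (\<sigma> i)) is) dop_one = (\<lambda>l. rep_sp (foldr mS (map (\<lambda>i. AS i (\<sigma> i)) is) oneS l))"
proof (induction "is")
  case Nil
  then show ?case by (simp add: dop_one_def oneS_def fun_eq_iff one_sp.rep_eq zero_sp.rep_eq)
next
  case (Cons i "is")
  have "AS i (\<sigma> i) k = 0" if "k \<ge> 2" for k using that by (simp add: AS_eq)
  moreover have "Amat i (\<sigma> i) = (\<lambda>k. rep_sp (AS i (\<sigma> i) k))" by (simp add: rep_AS)
  ultimately show ?case using Cons by (simp add: rep_mS)
qed

lemma rep_rdS: "rep_sp (rdS 1 N l) = rdet N Amat l"
  unfolding rdS_def rep_sum scl.rep_eq rdet_def rep_foldr_mS sum_fun_apply sp_scal_def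
  by (rule ext) (simp add: sum_fun_apply)

definition wS :: "nat \<Rightarrow> nat \<Rightarrow> sp" where
  "wS n j = rdS 1 (2*n+1) (2*n+1 - j)"

lemma rep_wS: "rep_sp (wS n j) = wop n j"
  unfolding wS_def wop_def rep_rdS ..

definition piv :: "nat \<Rightarrow> var \<Rightarrow> sp" where
  "piv n v = (case v of (i, j, m) \<Rightarrow> (dif ^^ m) (vr (i, j, 0)
     - (if i = j then sg (ppar i) (\<Sum>k\<in>Iset n. vr (k, k, 0)) else 0)))"

definition piS :: "nat \<Rightarrow> sp \<Rightarrow> sp" where
  "piS n = ev (piv n)"

lemma rep_piS: "rep_sp (piS n p) = pi_sl n (rep_sp p)"
proof -
  have "rep_sp (piv n v) = (case v of (i, j, m) \<Rightarrow>
     (sp_D ^^ m) (sp_var (i, j, 0)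
        - (if i = j then sp_scal ((-1) ^ ppar i) (\<Sum>k\<in>Iset n. sp_var (k, k, 0)) else 0)))" for v
    by (cases v) (simp add: piv_def rep_dif_funpow minus_sp.rep_eq vr.rep_eq rep_sg rep_sum zero_sp.rep_eq)
  then show ?thesis unfolding piS_def rep_ev pi_sl_def by simp
qed

lemma main_rep:
  assumes "WS n = agen {(dif ^^ m) (piS n (wS n i)) | i m. i \<in> {2..2*n+1}}"
  shows "Wset n = alg_gen {(sp_D ^^ m) (pi_sl n (wop n i)) | i m. i \<in> {2..2*n+1}}"
proof -
  have "{(sp_D ^^ m) (pi_sl n (wop n i)) | i m. i \<in> {2..2*n+1}}
      = rep_sp ` {(dif ^^ m) (piS n (wS n i)) | i m. i \<in> {2..2*n+1}}"
    unfolding rep_wS[symmetric] rep_piS[symmetric] rep_dif_funpow[symmetric] by blast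
  then show ?thesis unfolding Wset_rep assms by (simp add: alg_gen_rep)
qed

section \<open>Expansion of the row determinant\<close>

lemma mS_zero_left: "mS (\<lambda>_. 0) Q l = 0"
  by (simp add: mS_def)

lemma mS_zero_right: "mS P (\<lambda>_. 0) l = 0"
  by (simp add: mS_def ldS_def)

lemma ldS_sum_scl: "ldS (\<lambda>l. \<Sum>i\<in>I. scl (c i) (Q i l)) l = (\<Sum>i\<in>I. scl (c i) (ldS (Q i) l))"
  by (simp add: ldS_def lin_sum[OF lin_dif] lin_sum[OF lin_sig] dif_scl sig_scl scl_add sum.distrib)

lemma mS_sum_scl: "mS P (\<lambda>l. \<Sum>i\<in>I. scl (c i) (Q i l)) l = (\<Sum>i\<in>I. scl (c i) (mS P (Q i) l))"
  by (simp add: mS_def ldS_sum_scl sum_distrib_left scl_add sum.distrib)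

lemma mS_uminus: "mS P (\<lambda>l. - Q l) l = - mS P Q l"
  by (simp add: mS_def ldS_def lin_uminus[OF lin_dif] lin_uminus[OF lin_sig] algebra_simps)

lemma mS_minus_one: "mS (AS (Suc a) a) Q l = - Q l"
  by (simp add: mS_def AS_eq cn_scl scl_minus_left)

lemma mS_diag: "mS (AS a a) Q l = eS a a * Q l + ldS Q l"
  by (simp add: mS_def AS_eq)

lemma mS_upper: "a < j \<Longrightarrow> mS (AS a j) Q l = eS j a * Q l"
  by (simp add: mS_def AS_eq)

lemma foldr_mS_zero:
  assumes "x \<in> set xs" "f x = (\<lambda>_. 0)"
  shows "foldr mS (map f xs) Q = (\<lambda>_. 0)"
  using assms(1)
proof (induction xs)
  case (Cons y xs)
  show ?case
  proof (cases "x = y")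
    case True
    then have "f y = (\<lambda>_. 0)" using assms(2) by simp
    then show ?thesis by (intro ext) (simp add: mS_zero_left)
  next
    case False
    then have "foldr mS (map f xs) Q = (\<lambda>_. 0)" using Cons by simp
    then show ?thesis by (intro ext) (simp add: mS_zero_right)
  qed
qed simp

definition tail :: "nat \<Rightarrow> nat \<Rightarrow> (nat \<Rightarrow> nat) \<Rightarrow> nat \<Rightarrow> sp" where
  "tail a N \<sigma> = foldr mS (map (\<lambda>i. AS i (\<sigma> i)) [a..<N+1]) oneS"

text \<open>The determinant of the block with its first row replaced by an arbitrary row
  \<open>r\<close>. With \<open>r\<close> free, the expansion reproduces itself: once row
  \<open>a + 1\<close> has used column \<open>a\<close>, the row \<open>r\<close> stands on top of
  the rows from \<open>a + 2\<close> on, over the columns from \<open>a + 1\<close> on.\<close>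

definition rdT :: "(nat \<Rightarrow> nat \<Rightarrow> sp) \<Rightarrow> nat \<Rightarrow> nat \<Rightarrow> nat \<Rightarrow> sp" where
  "rdT r a N l = (\<Sum>\<sigma>\<in>{\<sigma>. \<sigma> permutes {a..N}}. scl (of_int (sign \<sigma>)) (mS (r (\<sigma> a)) (tail (Suc a) N \<sigma>) l))"

lemma tail_rec: "a \<le> N \<Longrightarrow> tail a N \<sigma> = mS (AS a (\<sigma> a)) (tail (Suc a) N \<sigma>)"
proof -
  assume "a \<le> N"
  then have "[a..<N+1] = a # [Suc a..<N+1]" by (simp add: upt_conv_Cons)
  then show ?thesis by (simp only: tail_def list.map foldr.simps comp_apply)
qed

lemma rdS_tail: "rdS a N l = (\<Sum>\<sigma>\<in>{\<sigma>. \<sigma> permutes {a..N}}. scl (of_int (sign \<sigma>)) (tail a N \<sigma> l))"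
  unfolding rdS_def tail_def ..

lemma rdS_rdT: "a \<le> N \<Longrightarrow> rdS a N l = rdT (AS a) a N l"
  unfolding rdS_tail rdT_def by (simp add: tail_rec)

lemma tail_cong: "(\<And>i. a \<le> i \<Longrightarrow> i \<le> N \<Longrightarrow> \<sigma> i = \<tau> i) \<Longrightarrow> tail a N \<sigma> = tail a N \<tau>"
  unfolding tail_def by (intro arg_cong[where f = "\<lambda>xs. foldr mS xs oneS"] map_cong) auto

lemma rdS_empty: "rdS (Suc N) N l = oneS l"
proof -
  have "{\<sigma>. \<sigma> permutes {Suc N..N}} = {id}" by auto
  then show ?thesis by (simp add: rdS_tail tail_def)
qed

lemma rdT_last: "rdT r N N l = mS (r N) (rdS (Suc N) N) l"
proof -
  have "{\<sigma>. \<sigma> permutes {N..N}} = {id}" by auto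
  moreover have "rdS (Suc N) N = oneS" by (rule ext) (rule rdS_empty)
  ultimately show ?thesis by (simp add: rdT_def tail_def)
qed

text \<open>In a nonzero term the column \<open>a\<close> is used by row \<open>a\<close> or by row \<open>a + 1\<close>; in the
  second case the entry is \<open>-1\<close> and its sign is absorbed by the transposition.\<close>

lemma rdT_rec:
  assumes "a < N"
  shows "rdT r a N l = mS (r a) (rdS (Suc a) N) l + rdT r (Suc a) N l"
proof -
  let ?S = "{\<sigma>. \<sigma> permutes {a..N}}" and ?S' = "{\<sigma>. \<sigma> permutes {Suc a..N}}"
  let ?t = "transpose a (Suc a)"
  let ?g = "\<lambda>\<sigma>. scl (of_int (sign \<sigma>)) (mS (r (\<sigma> a)) (tail (Suc a) N \<sigma>) l)"
  have ins: "insert a {Suc a..N} = {a..N}" using assms by auto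
  have S': "\<sigma> \<in> ?S' \<longleftrightarrow> \<sigma> \<in> ?S \<and> \<sigma> a = a" for \<sigma>
  proof
    assume "\<sigma> \<in> ?S'"
    then have p: "\<sigma> permutes {Suc a..N}" by simp
    have "\<sigma> permutes {a..N}" by (rule permutes_subset[OF p]) auto
    moreover have "\<sigma> a = a" by (rule permutes_not_in[OF p]) simp
    ultimately show "\<sigma> \<in> ?S \<and> \<sigma> a = a" by simp
  next
    assume "\<sigma> \<in> ?S \<and> \<sigma> a = a"
    then have p: "\<sigma> permutes {a..N}" and f: "\<sigma> a = a" by auto
    have "\<sigma> permutes {Suc a..N}"
      by (rule permutes_superset[OF p]) (use f in \<open>auto simp: not_less_eq_eq dest: le_antisym\<close>)
    then show "\<sigma> \<in> ?S'" by simp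
  qed
  let ?S2 = "{\<sigma>. \<sigma> permutes {a..N} \<and> \<sigma> (Suc a) = a}"
  have fin: "finite ?S" by (rule finite_permutations) simp
  have sub: "?S' \<union> ?S2 \<subseteq> ?S" using S' by auto
  have zero: "?g \<sigma> = 0" if "\<sigma> \<in> ?S - (?S' \<union> ?S2)" for \<sigma>
  proof -
    have p: "\<sigma> permutes {a..N}" and n1: "\<sigma> a \<noteq> a" and n2: "\<sigma> (Suc a) \<noteq> a"
      using that S' by auto
    have "a \<in> \<sigma> ` {a..N}" using permutes_image[OF p] assms by simp
    then obtain i where i: "i \<in> {a..N}" "\<sigma> i = a" by (metis imageE)
    then have "i \<noteq> a" "i \<noteq> Suc a" using n1 n2 by auto
    then have i': "Suc (Suc a) \<le> i" using i by auto
    have "tail (Suc a) N \<sigma> = (\<lambda>_. 0)" unfolding tail_def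
      by (rule foldr_mS_zero[of i]) (use i i' in \<open>auto simp: AS_eq fun_eq_iff\<close>)
    then show ?thesis by (simp add: mS_zero_right)
  qed
  have disj: "?S' \<inter> ?S2 = {}"
  proof (rule equals0I)
    fix \<sigma> assume s: "\<sigma> \<in> ?S' \<inter> ?S2"
    then have p: "\<sigma> permutes {a..N}" "\<sigma> a = a" "\<sigma> (Suc a) = a" using S' by auto
    have "inj \<sigma>" using p(1) by (rule permutes_inj)
    then show False using p(2,3) by (metis inj_eq n_not_Suc_n)
  qed
  have "rdT r a N l = sum ?g (?S' \<union> ?S2)"
    unfolding rdT_def by (rule sum.mono_neutral_right[OF fin sub]) (use zero in blast)
  also have "\<dots> = sum ?g ?S' + sum ?g ?S2"
    by (rule sum.union_disjoint) (use fin sub disj in \<open>auto elim: finite_subset[rotated]\<close>)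
  also have "sum ?g ?S' = mS (r a) (rdS (Suc a) N) l"
  proof -
    have "rdS (Suc a) N = (\<lambda>l. \<Sum>\<sigma>\<in>?S'. scl (of_int (sign \<sigma>)) (tail (Suc a) N \<sigma> l))"
      by (rule ext) (rule rdS_tail)
    then show ?thesis unfolding mS_sum_scl[symmetric] using S'
      by (simp add: mS_sum_scl)
  qed
  also have "sum ?g ?S2 = rdT r (Suc a) N l"
  proof -
    have "sum ?g ?S2 = (\<Sum>\<tau>\<in>?S'. ?g (\<tau> \<circ> ?t))"
    proof (rule sum.reindex_bij_witness[of _ "\<lambda>\<tau>. \<tau> \<circ> ?t" "\<lambda>\<sigma>. \<sigma> \<circ> ?t"])
      fix \<sigma> assume s: "\<sigma> \<in> ?S2"
      have tp: "?t permutes {a..N}" by (rule permutes_swap_id) (use assms in auto)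
      show "\<sigma> \<circ> ?t \<circ> ?t = \<sigma>" by (simp add: comp_assoc)
      have "\<sigma> \<circ> ?t \<in> ?S" using s permutes_compose[OF tp] by simp
      moreover have "(\<sigma> \<circ> ?t) a = a" using s by simp
      ultimately show "\<sigma> \<circ> ?t \<in> ?S'" using S' by blast
      show "?g (\<sigma> \<circ> ?t \<circ> ?t) = ?g \<sigma>" by (simp add: comp_assoc)
    next
      fix \<tau> assume s: "\<tau> \<in> ?S'"
      have tp: "?t permutes {a..N}" by (rule permutes_swap_id) (use assms in auto)
      show "\<tau> \<circ> ?t \<circ> ?t = \<tau>" by (simp add: comp_assoc)
      have "\<tau> \<in> ?S" "\<tau> a = a" using s S' by auto
      then show "\<tau> \<circ> ?t \<in> ?S2" using permutes_compose[OF tp] by simp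
    qed
    also have "\<dots> = (\<Sum>\<tau>\<in>?S'. scl (of_int (sign \<tau>)) (mS (r (\<tau> (Suc a))) (tail (Suc (Suc a)) N \<tau>) l))"
    proof (rule sum.cong[OF refl])
      fix \<tau> assume s: "\<tau> \<in> ?S'"
      then have p: "\<tau> permutes {Suc a..N}" by simp
      have pm: "permutation \<tau>" by (rule permutes_imp_permutation[OF _ p]) simp
      have ta: "\<tau> a = a" using s S' by blast
      have sg: "sign (\<tau> \<circ> ?t) = - sign \<tau>"
        using sign_compose[OF pm permutation_swap_id, of a "Suc a"] by (simp add: sign_swap_id)
      have t1: "tail (Suc (Suc a)) N (\<tau> \<circ> ?t) = tail (Suc (Suc a)) N \<tau>"
        by (rule tail_cong) (auto simp: transpose_def)
      have t2: "tail (Suc a) N (\<tau> \<circ> ?t) = (\<lambda>l. - tail (Suc (Suc a)) N \<tau> l)"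
        unfolding tail_rec[OF Suc_leI[OF assms]] t1 using ta by (simp add: fun_eq_iff mS_minus_one)
      show "?g (\<tau> \<circ> ?t) = scl (of_int (sign \<tau>)) (mS (r (\<tau> (Suc a))) (tail (Suc (Suc a)) N \<tau>) l)"
        unfolding sg t2 mS_uminus by (simp add: scl_minus scl_minus_left)
    qed
    finally show ?thesis unfolding rdT_def .
  qed
  finally show ?thesis .
qed

lemma rdT_sum: "a \<le> N \<Longrightarrow> rdT r a N l = (\<Sum>j=a..N. mS (r j) (rdS (Suc j) N) l)"
proof (induction "N - a" arbitrary: a)
  case 0
  then show ?case using rdT_last by simp
next
  case (Suc m)
  then have "a < N" by simp
  then show ?case using Suc by (simp add: rdT_rec sum.atLeast_Suc_atMost)
qed

lemma rdS_rec:
  assumes "a \<le> N"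
  shows "rdS a N l = ldS (rdS (Suc a) N) l + (\<Sum>j=a..N. eS j a * rdS (Suc j) N l)"
proof -
  have "(\<Sum>j=Suc a..N. mS (AS a j) (rdS (Suc j) N) l) = (\<Sum>j=Suc a..N. eS j a * rdS (Suc j) N l)"
    by (rule sum.cong) (auto simp: mS_upper)
  then show ?thesis
    using assms by (simp add: rdS_rdT rdT_sum sum.atLeast_Suc_atMost mS_diag)
qed

text \<open>In the recursion only \<open>ldS\<close> raises the order. The other blocks are strictly
  smaller, so the determinant is monic of order equal to the size of its block.\<close>

lemma rdS_top: "a \<le> Suc N \<Longrightarrow> rdS a N (Suc N - a) = 1 \<and> (\<forall>l > Suc N - a. rdS a N l = 0)"
proof (induction "Suc N - a" arbitrary: a rule: less_induct)
  case less
  show ?case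
  proof (cases "a = Suc N")
    case True
    then show ?thesis by (simp add: rdS_empty oneS_def)
  next
    case False
    then have a: "a \<le> N" using less.prems by simp
    have IH: "rdS (Suc j) N (N - j) = 1" "\<And>l. l > N - j \<Longrightarrow> rdS (Suc j) N l = 0" if "a \<le> j" "j \<le> N" for j
      using less.hyps[of "Suc j"] that by auto
    have s: "(\<Sum>j=a..N. eS j a * rdS (Suc j) N l) = 0" if "l > N - a" for l
    proof (intro sum.neutral ballI)
      fix j assume "j \<in> {a..N}"
      then have "rdS (Suc j) N l = 0" using that by (intro IH(2)) auto
      then show "eS j a * rdS (Suc j) N l = 0" by simp
    qed
    have l1: "ldS (rdS (Suc a) N) (Suc N - a) = 1"
      using a IH[of a] by (simp add: ldS_def Suc_diff_le)
    have l2: "ldS (rdS (Suc a) N) l = 0" if "l > Suc N - a" for l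
    proof -
      have "l > N - a" "l - 1 > N - a" using that a by auto
      then show ?thesis using IH(2)[of a] a by (simp add: ldS_def)
    qed
    show ?thesis
      using a l1 l2 s by (auto simp: rdS_rec)
  qed
qed

lemma sig_eS: "sig (eS j i) = sg (ppar i + ppar j + 1) (eS j i)"
  unfolding eS_def sig_sg sig_vr sg_sg by (rule sg_cong) (auto simp: even_vpar)

lemma even_ppar [simp]: "even (ppar i) \<longleftrightarrow> odd i"
  by (simp add: ppar_def)

text \<open>Because parities alternate along the diagonal, \<open>eS j a\<close> has parity
  \<open>a + j + 1\<close>, which modulo 2 is the difference of the sizes of the blocks starting at
  \<open>a\<close> and at \<open>j + 1\<close>. Hence the determinant is homogeneous of parity equal
  to its size, with \<open>D\<close> counted as odd.\<close>

lemma sig_rdS: "a \<le> Suc N \<Longrightarrow> sig (rdS a N l) = sg (Suc N - a + l) (rdS a N l)"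
proof (induction "Suc N - a" arbitrary: a l rule: less_induct)
  case less
  show ?case
  proof (cases "a = Suc N")
    case True
    then show ?thesis by (simp add: rdS_empty oneS_def)
  next
    case False
    then have a: "a \<le> N" using less.prems by simp
    have IH: "sig (rdS (Suc j) N l) = sg (N - j + l) (rdS (Suc j) N l)" if "a \<le> j" "j \<le> N" for j l
      using less.hyps[of "Suc j" l] that by auto
    have 1: "sig (dif (rdS (Suc a) N l)) = sg (Suc N - a + l) (dif (rdS (Suc a) N l))"
    proof -
      have "- sig (dif (rdS (Suc a) N l)) = sg (N - a + l) (dif (rdS (Suc a) N l))"
        unfolding dif_sig[symmetric] IH[OF order_refl a] lin_sg[OF lin_dif] ..
      then have "sig (dif (rdS (Suc a) N l)) = - sg (N - a + l) (dif (rdS (Suc a) N l))"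
        by (metis minus_minus)
      then show ?thesis using a by (simp add: sg_def Suc_diff_le)
    qed
    have 2: "sig (rdS (Suc a) N (l - 1)) = sg (Suc N - a + l) (rdS (Suc a) N (l - 1))" if "l \<noteq> 0"
      unfolding IH[OF order_refl a] using that a by (intro sg_cong) (cases l, auto simp: Suc_diff_le)
    have 3: "sig (ldS (rdS (Suc a) N) l) = sg (Suc N - a + l) (ldS (rdS (Suc a) N) l)"
      unfolding ldS_def using 1 2 by (cases "l = 0") (simp_all add: sig_add sg_add sig_sg)
    have 4: "sig (eS j a * rdS (Suc j) N l) = sg (Suc N - a + l) (eS j a * rdS (Suc j) N l)" if "j \<in> {a..N}" for j
    proof -
      have j: "a \<le> j" "j \<le> N" using that by auto
      have e: "even (N - j) \<longleftrightarrow> even (N + j)" "even (Suc N - a) \<longleftrightarrow> even (Suc N + a)" using j by auto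
      show ?thesis unfolding sig_mult IH[OF j] sig_eS sg_mult_left sg_mult_right sg_sg
        by (rule sg_cong) (use e in auto)
    qed
    have "sg k (\<Sum>j=a..N. eS j a * rdS (Suc j) N l) = (\<Sum>j=a..N. sg k (eS j a * rdS (Suc j) N l))" for k
      by (simp add: sg_def sum_negf)
    then show ?thesis
      unfolding rdS_rec[OF a] sig_add 3 lin_sum[OF lin_sig] sg_add using 4 by simp
  qed
qed

section \<open>Closure properties of generated subalgebras\<close>

lemma sg_double [simp]: "sg (k + k) a = a"
  by (simp add: sg_def)

lemma agen_subset:
  assumes "G \<subseteq> agen H" "x \<in> agen G" shows "x \<in> agen H"
  using assms(2) by induction (use assms(1) in \<open>auto intro: agen.intros\<close>)

lemma agen_mono: "G \<subseteq> H \<Longrightarrow> x \<in> agen G \<Longrightarrow> x \<in> agen H"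
  by (rule agen_subset) (auto intro: agen.gen)

lemma agen_zero: "0 \<in> agen G"
  using agen.const[of 0 G] by (simp add: cn_scl)

lemma agen_one: "1 \<in> agen G"
  using agen.const[of 1 G] by (simp add: cn_scl)

lemma agen_uminus: "a \<in> agen G \<Longrightarrow> - a \<in> agen G"
  using agen.scal[of a G "-1"] by (simp add: scl_minus_left)

lemma agen_diff: "a \<in> agen G \<Longrightarrow> b \<in> agen G \<Longrightarrow> a - b \<in> agen G"
  using agen.add[OF _ agen_uminus, of a G b] by simp

lemma agen_sg: "a \<in> agen G \<Longrightarrow> sg k a \<in> agen G"
  by (simp add: sg_def agen_uminus)

lemma agen_sum: "(\<And>i. i \<in> I \<Longrightarrow> f i \<in> agen G) \<Longrightarrow> sum f I \<in> agen G"
  by (induction I rule: infinite_finite_induct) (auto intro: agen_zero agen.add)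

text \<open>The product rule for \<open>dif\<close> involves \<open>sig\<close>, so a generated
  subalgebra is closed under \<open>dif\<close> only if it is closed under \<open>sig\<close> as
  well.\<close>

definition sig_stable :: "sp set \<Rightarrow> bool" where
  "sig_stable G \<longleftrightarrow> (\<forall>g\<in>G. sig g \<in> agen G)"

lemma sig_stableI: "(\<And>g. g \<in> G \<Longrightarrow> \<exists>k. sig g = sg k g) \<Longrightarrow> sig_stable G"
  unfolding sig_stable_def by (metis agen.gen agen_sg)

lemma sig_stable_Un: "sig_stable G \<Longrightarrow> sig_stable H \<Longrightarrow> sig_stable (G \<union> H)"
  unfolding sig_stable_def by (auto intro: agen_mono[of G "G \<union> H"] agen_mono[of H "G \<union> H"])

lemma agen_sig:
  assumes "sig_stable G" "x \<in> agen G" shows "sig x \<in> agen G"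
  using assms(2)
proof induction
  case (gen g)
  then show ?case using assms(1) unfolding sig_stable_def by blast
qed (auto simp: sig_add sig_scl sig_mult intro: agen.intros)

lemma agen_tw: "sig_stable G \<Longrightarrow> x \<in> agen G \<Longrightarrow> tw c x \<in> agen G"
  by (simp add: tw_def agen_sig)

lemma agen_dif:
  assumes "sig_stable G" "\<And>g. g \<in> G \<Longrightarrow> dif g \<in> agen G" "x \<in> agen G"
  shows "dif x \<in> agen G"
  using assms(3) by induction (auto simp: dif_add dif_scl dif_mult assms(2)
    intro: agen.intros agen_zero agen_sig[OF assms(1)])

lemma agen_dif_funpow:
  assumes "sig_stable G" "\<And>g. g \<in> G \<Longrightarrow> dif g \<in> agen G" "x \<in> agen G"
  shows "(dif ^^ m) x \<in> agen G"
  by (induction m) (use assms agen_dif in auto)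

lemma agen_hom:
  assumes "hom f" "\<And>g. g \<in> G \<Longrightarrow> f g \<in> agen H" "x \<in> agen G"
  shows "f x \<in> agen H"
  using assms(3)
  by induction (auto simp: hom_cn[OF assms(1)] lin_add[OF hom_lin[OF assms(1)]]
     lin_scl[OF hom_lin[OF assms(1)]] hom_mult[OF assms(1)] assms(2) intro: agen.intros)

lemma agen_hom_fix:
  assumes "hom f" "\<And>g. g \<in> G \<Longrightarrow> f g = g" "x \<in> agen G"
  shows "f x = x"
  using assms(3)
  by induction (auto simp: hom_cn[OF assms(1)] lin_add[OF hom_lin[OF assms(1)]]
     lin_scl[OF hom_lin[OF assms(1)]] hom_mult[OF assms(1)] assms(2))

lemma agen_pder_zero:
  assumes "hom \<phi>" "pder \<phi> c E" "\<And>g. g \<in> G \<Longrightarrow> E g = 0" "x \<in> agen G"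
  shows "E x = 0"
  using assms(4)
  by induction (auto simp: pder_cn[OF assms(1,2)] lin_add[OF pder_lin[OF assms(2)]]
     lin_scl[OF pder_lin[OF assms(2)]] pder_mult[OF assms(2)] assms(3))

section \<open>Lower triangular variables, filtered by their second index\<close>

definition gv :: "nat \<Rightarrow> nat \<Rightarrow> sp set" where
  "gv N T = {vr (s, t, m) | s t m. T \<le> t \<and> t \<le> s \<and> s \<le> N}"

lemma gv_mono: "T \<le> T' \<Longrightarrow> gv N T' \<subseteq> gv N T"
  by (force simp: gv_def)

lemma gv_dif: "g \<in> gv N T \<Longrightarrow> dif g \<in> agen (gv N T)"
proof -
  assume "g \<in> gv N T"
  then obtain s t m where g: "g = vr (s, t, m)" "T \<le> t" "t \<le> s" "s \<le> N" unfolding gv_def by blast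
  then have "dif g = vr (s, t, Suc m)" by (simp add: dif_vr Dv_def)
  then show ?thesis using g(2-4) by (intro agen.gen) (unfold gv_def, blast)
qed

lemma gv_sig_stable: "sig_stable (gv N T)"
  unfolding gv_def using sig_vr by (intro sig_stableI) blast

lemma gv_vr: "T \<le> t \<Longrightarrow> t \<le> s \<Longrightarrow> s \<le> N \<Longrightarrow> vr (s, t, m) \<in> agen (gv N T)"
  by (rule agen.gen) (auto simp: gv_def)

lemma eS_gv: "T \<le> i \<Longrightarrow> i \<le> j \<Longrightarrow> j \<le> N \<Longrightarrow> eS j i \<in> agen (gv N T)"
  unfolding eS_def by (intro agen_sg gv_vr)

lemma agen_gv_mono: "T \<le> T' \<Longrightarrow> x \<in> agen (gv N T') \<Longrightarrow> x \<in> agen (gv N T)"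
  by (rule agen_mono[OF gv_mono])

lemma agen_gv_ldS: "(\<And>l. Q l \<in> agen (gv N T)) \<Longrightarrow> ldS Q l \<in> agen (gv N T)"
  unfolding ldS_def
  by (auto intro!: agen.add agen_dif[OF gv_sig_stable gv_dif] agen_sig[OF gv_sig_stable] agen_zero)

lemma rdS_gv: "a \<le> Suc N \<Longrightarrow> rdS a N l \<in> agen (gv N a)"
proof (induction "Suc N - a" arbitrary: a l rule: less_induct)
  case less
  show ?case
  proof (cases "a = Suc N")
    case True
    then show ?thesis by (simp add: rdS_empty oneS_def agen_one agen_zero)
  next
    case False
    then have a: "a \<le> N" using less.prems by simp
    have IH: "rdS (Suc j) N l \<in> agen (gv N a)" if "a \<le> j" "j \<le> N" for j l
      using less.hyps[of "Suc j" l] that by (auto intro: agen_gv_mono[of a "Suc j"])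
    show ?thesis unfolding rdS_rec[OF a]
      using a IH by (intro agen.add agen_sum agen.mult agen_gv_ldS eS_gv) auto
  qed
qed

section \<open>Reduction modulo the ideal and gauge invariance\<close>

text \<open>The value of (f|e_ij): the product of \<open>f\<close> with e_(i,i+1) is the diagonal
  unit with index \<open>i + 1\<close>.\<close>

definition fe :: "nat \<Rightarrow> nat \<Rightarrow> complex" where
  "fe i j = (if j = Suc i then (-1) ^ ppar j else 0)"

definition rhov :: "var \<Rightarrow> sp" where
  "rhov v = (case v of (i, j, m) \<Rightarrow> if i < j then (if m = 0 then cn (fe i j) else 0) else vr (i, j, m))"

text \<open>Reduction modulo the ideal as an endomorphism: upper triangular variables become their
  constants, hence their derivatives become 0, and all other variables are fixed.\<close>

definition rho :: "sp \<Rightarrow> sp" where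
  "rho = ev rhov"

lemma sig_rhov: "sig (rhov v) = sg (vpar v) (rhov v)"
proof (cases v rule: prod_cases3)
  case (fields i j m)
  have "cn (fe i j) = sg (vpar (i, j, 0)) (cn (fe i j))"
    by (cases "j = Suc i") (auto simp: fe_def sg_def even_vpar cn_scl)
  then show ?thesis by (auto simp: fields rhov_def sig_vr)
qed

lemma hom_rho: "hom rho"
  unfolding rho_def by (rule hom_ev) (rule sig_rhov)

lemma rho_vr: "rho (vr v) = rhov v"
  unfolding rho_def by (rule ev_vr) (rule sig_rhov)

lemma lin_rho: "lin rho" by (rule hom_lin[OF hom_rho])
lemmas rho_add = lin_add[OF lin_rho]
lemmas rho_scl = lin_scl[OF lin_rho]
lemmas rho_zero [simp] = lin_zero[OF lin_rho]
lemmas rho_mult = hom_mult[OF hom_rho]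
lemmas rho_sg = lin_sg[OF lin_rho]
lemmas rho_cn [simp] = hom_cn[OF hom_rho]

lemma rho_dif: "rho (dif p) = dif (rho p)"
proof (rule hom_dif[OF hom_rho])
  fix v
  show "rho (vr (Dv v)) = dif (rho (vr v))"
    unfolding rho_vr by (cases v rule: prod_cases3) (simp add: rhov_def Dv_def dif_vr)
qed

lemma rho_gv: "x \<in> agen (gv N T) \<Longrightarrow> rho x = x"
  by (rule agen_hom_fix[OF hom_rho]) (auto simp: gv_def rho_vr rhov_def)

definition Ah :: "nat \<Rightarrow> nat \<Rightarrow> sp" where
  "Ah i j = (if i \<le> j then eS j i else if i = Suc j then - 1 else 0)"

text \<open>Below the diagonal the sign in \<open>eS\<close> and the sign of the supertrace multiply
  to -1, because neighbouring indices have opposite parity. Thus the constant term of every entry of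
  \<open>\<A>\<close>, up to and including the subdiagonal, is the reduction of the full
  matrix.\<close>

lemma rho_eS: "rho (eS j i) = Ah i j"
proof -
  have "cn (fe j i) = sg (ppar j) (- 1)" if "i = Suc j"
    using that by (simp add: fe_def cn_scl scl_pow) (simp add: sg_def)
  moreover have "cn (fe j i) = 0" if "i \<noteq> Suc j" using that by (simp add: fe_def cn_scl)
  ultimately show ?thesis by (auto simp: eS_def rho_sg rho_vr rhov_def Ah_def)
qed

lemma rho_vr_Ah: "rho (vr (j, i, 0)) = sg (ppar j) (Ah i j)"
  using rho_eS[of j i] unfolding eS_def rho_sg by (metis sg_sg sg_double)

definition dl :: "nat \<Rightarrow> nat \<Rightarrow> nat \<Rightarrow> sp \<Rightarrow> sp" where
  "dl a b k x = rho (brk a b k x)"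

lemma pder_dl: "pder rho (pe a b + k) (dl a b k)"
  unfolding pder_def dl_def
  using lin_comp[OF lin_rho lin_brk] by (simp add: brk_mult rho_add rho_mult hom_tw[OF hom_rho])

lemma lin_dl: "lin (dl a b k)" by (rule pder_lin[OF pder_dl])

lemma dl_dif: "dl a b k (dif x) = stepS (pe a b) (\<lambda>k. dl a b k x) k"
  unfolding dl_def brk_dif stepS_def by (simp add: rho_sg rho_add rho_dif)

lemma dl_sig: "dl a b k (sig x) = sg (pe a b + k) (sig (dl a b k x))"
  unfolding dl_def brk_sig by (simp add: rho_sg hom_sig[OF hom_rho])

lemma dl_one [simp]: "dl a b k 1 = 0"
  by (rule pder_one[OF hom_rho pder_dl])

lemma dl_zero [simp]: "dl a b k 0 = 0"
  by (rule lin_zero[OF lin_dl])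

lemma dl_vr: "dl a b k (vr (c, d, 0)) = rho (brbS a b c d k)"
  by (simp add: dl_def brk_vr brvS_def)

text \<open>The infinitesimal gauge action on the matrix: up to sign, column \<open>b\<close>
  receives column \<open>a\<close> and row \<open>a\<close> loses row \<open>b\<close>. The
  coefficient at \<open>k = 1\<close> comes from the invariant form and plays the role of the
  derivative term of a gauge transformation.\<close>

lemma dl_eS:
  "dl a b k (eS j i) =
    (if k = 0 then (if j = b then sg (pe a b * (ppar b + ppar i)) (Ah i a) else 0)
        - (if i = a then sg (pe a b) (Ah b j) else 0)
     else if k = 1 \<and> i = a \<and> j = b then sg (pe a b) 1 else 0)"
proof -
  have r: "rho (lieS a b j i) = (if b = j then sg (ppar a) (Ah i a) else 0)
     - (if a = i then sg (pe a b * pe j i + ppar j) (Ah b j) else 0)"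
    unfolding lieS_def by (simp add: lin_diff[OF lin_rho] rho_sg rho_vr_Ah)
  have 0: "dl a b 0 (eS j i) = (if j = b then sg (pe a b * (ppar b + ppar i)) (Ah i a) else 0)
        - (if i = a then sg (pe a b) (Ah b j) else 0)"
  proof -
    have s1: "sg (ppar b + (pe a b * (pe b i + 1) + ppar a)) q = sg (pe a b * (ppar b + ppar i)) q" for q :: sp
      by (rule sg_cong) auto
    have s2: "sg (ppar j + (pe a b * (pe j a + 1) + (pe a b * pe j a + ppar j))) q = sg (pe a b) q" for q :: sp
      by (rule sg_cong) auto
    have "dl a b 0 (eS j i) = sg (ppar j + pe a b * (pe j i + 1)) (rho (lieS a b j i))"
      by (simp add: eS_def lin_sg[OF lin_dl] dl_vr brbS_def rho_sg)
    also have "\<dots> = (if b = j then sg (ppar j + pe a b * (pe j i + 1) + ppar a) (Ah i a) else 0)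
        - (if a = i then sg (ppar j + pe a b * (pe j i + 1) + (pe a b * pe j i + ppar j)) (Ah b j) else 0)"
      unfolding r by (auto simp: sg_add sg_minus diff_conv_add_uminus simp del: add_uminus_conv_diff)
    finally show ?thesis using s1 s2 by (auto simp: add.assoc)
  qed
  have 1: "dl a b 1 (eS j i) = (if i = a \<and> j = b then sg (pe a b) 1 else 0)"
  proof -
    have "dl a b 1 (eS j i) = sg (ppar j) (cn (form_ee a b j i))"
      by (simp add: eS_def lin_sg[OF lin_dl] dl_vr brbS_def)
    also have "\<dots> = (if i = a \<and> j = b then sg (ppar b + ppar a) 1 else 0)"
      by (auto simp: form_ee_def cn_scl scl_pow)
    also have "sg (ppar b + ppar a) (1::sp) = sg (pe a b) 1" by (rule sg_cong) auto
    finally show ?thesis .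
  qed
  have 2: "dl a b k (eS j i) = 0" if "k \<ge> 2"
    using that by (simp add: eS_def lin_sg[OF lin_dl] dl_vr brbS_def)
  show ?thesis using 0 1 2 by (cases "k = 0"; cases "k = 1") auto
qed

lemma sum_delta_mult:
  "(\<Sum>j=i..N. (if j = b then f j else 0) * g j) = (if i \<le> b \<and> b \<le> N then f b * g b else 0)"
  for f g :: "nat \<Rightarrow> sp"
proof -
  have "(\<Sum>j=i..N. (if j = b then f j else 0) * g j) = (\<Sum>j=i..N. if j = b then f j * g j else 0)"
    by (rule sum.cong) auto
  then show ?thesis by (simp add: sum.delta')
qed

text \<open>The entries satisfy \<open>Ah b j = 0\<close> for \<open>j < b - 1\<close>, so this is row \<open>b\<close> of the system
  \<open>\<A> \<psi> = 0\<close> with \<open>\<psi>\<^sub>j = rdS (j + 1)\<close>, with its derivative term moved to the right.\<close>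

lemma Ah_row_sum:
  assumes "a < b" "b \<le> N"
  shows "(\<Sum>j=a..N. Ah b j * rdS (Suc j) N l) = - ldS (rdS (Suc b) N) l"
proof -
  have "(\<Sum>j=a..N. Ah b j * rdS (Suc j) N l) = (\<Sum>j=b - 1..N. Ah b j * rdS (Suc j) N l)"
    by (rule sum.mono_neutral_right) (use assms in \<open>auto simp: Ah_def\<close>)
  also have "\<dots> = Ah b (b - 1) * rdS (Suc (b - 1)) N l + (\<Sum>j=Suc (b - 1)..N. Ah b j * rdS (Suc j) N l)"
    by (rule sum.atLeast_Suc_atMost) (use assms in auto)
  also have "(\<Sum>j=Suc (b - 1)..N. Ah b j * rdS (Suc j) N l) = (\<Sum>j=b..N. eS j b * rdS (Suc j) N l)"
    by (rule sum.cong) (use assms in \<open>auto simp: Ah_def\<close>)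
  also have "Ah b (b - 1) * rdS (Suc (b - 1)) N l = - rdS b N l"
    using assms by (cases b) (auto simp: Ah_def)
  also have "rdS b N l = ldS (rdS (Suc b) N) l + (\<Sum>j=b..N. eS j b * rdS (Suc j) N l)"
    using assms by (rule_tac rdS_rec)
  finally show ?thesis by simp
qed

lemma gauge:
  assumes "a < b" "b \<le> N" "i \<le> Suc N"
  shows "dl a b k (rdS i N l) = (if i = Suc a \<and> k = 0 then - rdS (Suc b) N l else 0)"
  using assms(3)
proof (induction "Suc N - i" arbitrary: i k l rule: less_induct)
  case less
  let ?R = "\<lambda>i l. rdS i N l" and ?P = "pe a b"
  show ?case
  proof (cases "i = Suc N")
    case True
    then show ?thesis using assms(1,2) by (simp add: rdS_empty oneS_def)
  next
    case False
    then have i: "i \<le> N" using less.prems by simp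
    have IH: "dl a b k (?R (Suc j) l) = (if j = a \<and> k = 0 then - ?R (Suc b) l else 0)" if "i \<le> j" "j \<le> N" for j k l
      using less.hyps[of "Suc j" k l] that by auto
    have rR: "rho (?R (Suc j) l) = ?R (Suc j) l" if "j \<le> N" for j l
      by (rule rho_gv[OF rdS_gv]) (use that in simp)
    have "dl a b k (eS j i * ?R (Suc j) l)
        = dl a b k (eS j i) * ?R (Suc j) l
        - (if j = a then (if k = 0 then tw (?P + k) (Ah i j) else 0) else 0) * ?R (Suc b) l"
      if "j \<in> {i..N}" for j
      using that by (simp add: pder_mult[OF pder_dl] IH rR rho_eS)
    then have sum: "dl a b k (\<Sum>j=i..N. eS j i * ?R (Suc j) l)
        = (\<Sum>j=i..N. dl a b k (eS j i) * ?R (Suc j) l)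
        - (if i \<le> a \<and> a \<le> N then (if k = 0 then tw (?P + k) (Ah i a) else 0) * ?R (Suc b) l else 0)"
      by (simp add: lin_sum[OF lin_dl] sum_subtractf sum_delta_mult)
    \<comment> \<open>Only \<open>i = a\<close> matters. There \<open>dl_dif\<close> also produces a
      term at \<open>k = 1\<close>, to be cancelled later by the contribution of the invariant
      form.\<close>
    have ld: "dl a b k (ldS (?R (Suc i)) l) = (if i = a then (if k = 0 then - sg ?P (ldS (?R (Suc b)) l)
        else if k = 1 then - sg ?P (?R (Suc b) l) else 0) else 0)"
    proof (cases "i = a")
      case True
      have 1: "dl a b k (dif (?R (Suc i) l)) = (if k = 0 then - sg ?P (dif (?R (Suc b) l))
        else if k = 1 then - sg ?P (?R (Suc b) l) else 0)"
        unfolding dl_dif stepS_def using True i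
        by (cases "k = 0"; cases "k = 1") (auto simp: IH lin_uminus[OF lin_dif] sg_minus)
      have 2: "dl a b k (sig (?R (Suc i) l')) = (if k = 0 then - sg ?P (sig (?R (Suc b) l')) else 0)" for l'
        unfolding dl_sig using True i by (simp add: IH lin_uminus[OF lin_sig] sg_minus)
      show ?thesis
        unfolding ldS_def lin_add[OF lin_dl] 1 using True
        by (cases "l = 0") (simp_all add: 2[unfolded True] sg_add)
    next
      case False
      then show ?thesis
        unfolding ldS_def lin_add[OF lin_dl] dl_dif stepS_def using i
        by (simp add: IH dl_sig)
    qed
    have main: "dl a b k (?R i l) = dl a b k (ldS (?R (Suc i)) l)
        + ((\<Sum>j=i..N. dl a b k (eS j i) * ?R (Suc j) l)
        - (if i \<le> a \<and> a \<le> N then (if k = 0 then tw (?P + k) (Ah i a) else 0) * ?R (Suc b) l else 0))"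
      unfolding rdS_rec[OF i] lin_add[OF lin_dl] sum ..
    show ?thesis
    proof (cases "k = 0")
      case True
      have e: "(\<Sum>j=i..N. dl a b 0 (eS j i) * ?R (Suc j) l) =
          (if i \<le> b then sg (?P * (ppar b + ppar i)) (Ah i a) * ?R (Suc b) l else 0)
          - (if i = a then sg ?P (\<Sum>j=a..N. Ah b j * ?R (Suc j) l) else 0)"
      proof -
        have "(\<Sum>j=i..N. dl a b 0 (eS j i) * ?R (Suc j) l)
          = (\<Sum>j=i..N. (if j = b then sg (?P * (ppar b + ppar i)) (Ah i a) else 0) * ?R (Suc j) l)
          - (\<Sum>j=i..N. (if i = a then sg ?P (Ah b j) else 0) * ?R (Suc j) l)"
          unfolding sum_subtractf[symmetric] by (rule sum.cong[OF refl]) (simp add: dl_eS left_diff_distrib)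
        also have "(\<Sum>j=i..N. (if i = a then sg ?P (Ah b j) else 0) * ?R (Suc j) l)
          = (if i = a then sg ?P (\<Sum>j=a..N. Ah b j * ?R (Suc j) l) else 0)"
          by (auto simp: sg_def sum_negf)
        finally show ?thesis unfolding sum_delta_mult using assms(2) by simp
      qed
      \<comment> \<open>The two exponents differ by \<open>?P * (ppar a + ppar b + 1)\<close>, a
        product of two numbers of opposite parity.\<close>
      have sAh: "tw ?P (Ah i a) = sg (?P * (ppar b + ppar i)) (Ah i a)" if "i \<le> a"
      proof -
        have "tw ?P (Ah i a) = sg (?P * (ppar i + ppar a + 1)) (Ah i a)"
          using that by (simp add: Ah_def tw_hom[OF sig_eS])
        also have "\<dots> = sg (?P * (ppar b + ppar i)) (Ah i a)"
          by (rule sg_cong) auto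
        finally show ?thesis .
      qed
      \<comment> \<open>For \<open>i < a\<close> the change of column \<open>b\<close> cancels the
        change of the factor with index \<open>a + 1\<close>. For \<open>i = a\<close> the row
        change cancels the derivative term as well, by row \<open>b\<close> of the system. For
        \<open>i = a + 1\<close> only the subdiagonal entry -1 survives, and beyond that
        \<open>Ah i a\<close> is 0.\<close>
      consider "i < a" | "i = a" | "i = Suc a" | "Suc a < i" by linarith
      then show ?thesis
      proof cases
        case 1
        then show ?thesis unfolding main ld using True e sAh assms(1,2) by simp
      next
        case 2
        then show ?thesis unfolding main ld Ah_row_sum[OF assms(1,2)]
          using True e sAh assms(1,2) Ah_row_sum[OF assms(1,2), of l] by (simp add: sg_minus)
      next
        case 3
        have "sg (?P * (ppar b + ppar (Suc a))) q = q" for q :: sp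
          by (auto simp: sg_def)
        then show ?thesis unfolding main ld using True e 3 assms(1,2) by (simp add: Ah_def)
      next
        case 4
        then show ?thesis unfolding main ld using True e assms(1,2) by (simp add: Ah_def)
      qed
    next
      case False
      \<comment> \<open>For positive \<open>k\<close> only the contribution of the invariant form
        remains. It is opposite to the term at \<open>k = 1\<close> in \<open>ld\<close>.\<close>
      have e: "(\<Sum>j=i..N. dl a b k (eS j i) * ?R (Suc j) l) = (if k = 1 \<and> i = a then sg ?P (?R (Suc b) l) else 0)"
      proof -
        have "(\<Sum>j=i..N. dl a b k (eS j i) * ?R (Suc j) l)
          = (\<Sum>j=i..N. (if j = b then (if k = 1 \<and> i = a then sg ?P 1 else 0) else 0) * ?R (Suc j) l)"
          by (rule sum.cong[OF refl]) (use False in \<open>auto simp: dl_eS\<close>)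
        then show ?thesis unfolding sum_delta_mult using assms(1,2) by auto
      qed
      show ?thesis unfolding main ld e using False by auto
    qed
  qed
qed

section \<open>Elimination of variables by slices\<close>

lemma cn_mult: "cn c * p = scl c p"
  by (simp add: cn_scl)

lemma sg_cn: "sg k (cn c) = cn ((-1) ^ k * c)"
  by (simp add: cn_scl scl_pow[symmetric])

lemma scl_eq_zero: "c \<noteq> 0 \<Longrightarrow> scl c p = 0 \<Longrightarrow> p = 0"
proof -
  assume c: "c \<noteq> 0" and "scl c p = 0"
  then have "scl (inverse c) (scl c p) = 0" by simp
  then show "p = 0" using c by simp
qed

text \<open>Only existence of the coefficients is recorded, not uniqueness. Letting \<open>f\<close>
  vanish from \<open>J\<close> on allows expansions of different lengths to be added after
  padding.\<close>

definition xexp :: "sp \<Rightarrow> sp set \<Rightarrow> nat \<Rightarrow> (nat \<Rightarrow> sp) \<Rightarrow> sp \<Rightarrow> bool" where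
  "xexp x A J f w \<longleftrightarrow> (\<forall>j. f j \<in> A) \<and> (\<forall>j\<ge>J. f j = 0) \<and> w = (\<Sum>j<J. x ^ j * f j)"

lemma xexp_enlarge: "xexp x A J f w \<Longrightarrow> J \<le> K \<Longrightarrow> xexp x A K f w"
proof -
  assume w: "xexp x A J f w" and JK: "J \<le> K"
  have "(\<Sum>j<J. x ^ j * f j) = (\<Sum>j<K. x ^ j * f j)"
    by (rule sum.mono_neutral_left) (use w JK in \<open>auto simp: xexp_def\<close>)
  then show ?thesis using w JK unfolding xexp_def by simp
qed

lemma xexp_add:
  assumes "xexp x (agen G) J f w" "xexp x (agen G) K g v"
  shows "xexp x (agen G) (max J K) (\<lambda>j. f j + g j) (w + v)"
  using xexp_enlarge[OF assms(1), of "max J K"] xexp_enlarge[OF assms(2), of "max J K"]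
  unfolding xexp_def by (auto simp: distrib_left sum.distrib intro: agen.add)

lemma xexp_mono:
  assumes "a \<in> agen G" shows "xexp x (agen G) (Suc i) (\<lambda>j. if j = i then a else 0) (x ^ i * a)"
  unfolding xexp_def using assms by (auto simp: agen_zero if_distrib[of "\<lambda>z. _ * z"] sum.delta cong: if_cong)

lemma xexp_zero: "xexp x (agen G) 0 (\<lambda>_. 0) 0"
  by (simp add: xexp_def agen_zero)

lemma xexp_ex: "a \<in> agen G \<Longrightarrow> \<exists>J f. xexp x (agen G) J f (x ^ i * a)"
  by (blast intro: xexp_mono)

lemma xexp_sum:
  assumes "\<And>i. i \<in> I \<Longrightarrow> \<exists>J f. xexp x (agen G) J f (w i)"
  shows "\<exists>J f. xexp x (agen G) J f (sum w I)"
  using assms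
proof (induction I rule: infinite_finite_induct)
  case (insert i I)
  obtain J f where f: "xexp x (agen G) J f (w i)" using insert.prems by blast
  obtain K g where g: "xexp x (agen G) K g (sum w I)" using insert.IH insert.prems by blast
  have "sum w (insert i I) = w i + sum w I" using insert.hyps by simp
  then show ?case using xexp_add[OF f g] by auto
next
  case (infinite A)
  show ?case unfolding sum.infinite[OF infinite(1)] using xexp_zero by blast
next
  case empty
  show ?case unfolding sum.empty using xexp_zero by blast
qed

text \<open>Coefficients are moved to the right of all powers of \<open>x\<close>. Each move twists
  them by a power of \<open>sig\<close>, whence the stability required of \<open>G\<close>.\<close>

lemma xexp_agen:
  assumes x: "sig x = sg c x" and G: "sig_stable G" and w: "w \<in> agen (insert x G)"
  shows "\<exists>J f. xexp x (agen G) J f w"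
  using w
proof induction
  case (const k)
  show ?case using xexp_ex[OF agen.const[of k G], of x 0] by simp
next
  case (gen g)
  show ?case
  proof (cases "g \<in> G")
    case True
    then show ?thesis using xexp_ex[OF agen.gen[OF True], of x 0] by simp
  next
    case False
    then have "g = x" using gen by simp
    then show ?thesis using xexp_ex[OF agen_one[of G], of x 1] by simp
  qed
next
  case (add a b)
  then show ?case using xexp_add by blast
next
  case (scal a k)
  then obtain J f where f: "xexp x (agen G) J f a" by blast
  have "xexp x (agen G) J (\<lambda>j. scl k (f j)) (scl k a)"
    using f unfolding xexp_def by (auto simp: scl_sum intro: agen.scal)
  then show ?case by blast
next
  case (mult a b)
  then obtain J f K g where f: "xexp x (agen G) J f a" and g: "xexp x (agen G) K g b" by blast
  have "\<exists>L h. xexp x (agen G) L h ((x ^ i * f i) * (x ^ j * g j))" for i j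
  proof -
    have "sig (x ^ j) = sg (c * j) (x ^ j)" by (induction j) (auto simp: sig_mult x add.commute)
    then have "f i * x ^ j = x ^ j * tw (c * j) (f i)" by (rule scomm_right)
    then have "(x ^ i * f i) * (x ^ j * g j) = x ^ (i + j) * (tw (c * j) (f i) * g j)"
      by (metis mult.assoc power_add)
    moreover have "tw (c * j) (f i) * g j \<in> agen G"
      using f g unfolding xexp_def by (auto intro: agen.mult agen_tw[OF G])
    ultimately show ?thesis using xexp_ex by simp
  qed
  then have "\<exists>L h. xexp x (agen G) L h (\<Sum>i<J. \<Sum>j<K. (x ^ i * f i) * (x ^ j * g j))"
    by (intro xexp_sum)
  then show ?case using f g unfolding xexp_def by (simp add: sum_product)
qed

text \<open>If \<open>E x\<close> is a nonzero constant and \<open>E\<close> kills \<open>G\<close>, then the kernel of \<open>E\<close> on the algebra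
  generated by \<open>x\<close> and \<open>G\<close> does not involve \<open>x\<close>. Applying \<open>E\<close> repeatedly separates the
  powers of \<open>x\<close>, so no algebraic independence is needed.\<close>

lemma slice:
  assumes phi: "hom \<phi>" and E: "pder \<phi> c E" and x: "sig x = sg c x"
    and Ex: "E x = cn \<gamma>" "\<gamma> \<noteq> 0" and px: "\<phi> x = x"
    and G: "sig_stable G" "\<And>g. g \<in> G \<Longrightarrow> E g = 0" "\<And>g. g \<in> G \<Longrightarrow> \<phi> g = g"
    and w: "w \<in> agen (insert x G)" "E w = 0"
  shows "w \<in> agen G"
proof -
  have E0: "E a = 0" if "a \<in> agen G" for a
    by (rule agen_pder_zero[OF phi E G(2) that])
  have p0: "\<phi> a = a" if "a \<in> agen G" for a
    by (rule agen_hom_fix[OF phi G(3) that])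
  have lE: "lin E" by (rule pder_lin[OF E])
  obtain J f where f: "xexp x (agen G) J f w" using xexp_agen[OF x G(1) w(1)] by blast
  have fA: "f j \<in> agen G" for j using f unfolding xexp_def by blast
  show ?thesis
  proof (cases "even c")
    case True
    have ppow: "\<phi> (x ^ j) = x ^ j" for j
      by (induction j) (auto simp: hom_one[OF phi] hom_mult[OF phi] px)
    have Epow: "E (x ^ Suc j) = scl (of_nat (Suc j) * \<gamma>) (x ^ j)" for j
    proof (induction j)
      case 0
      show ?case using Ex by (simp add: cn_scl)
    next
      case (Suc j)
      have "E (x ^ Suc (Suc j)) = E x * x ^ Suc j + x * E (x ^ Suc j)"
        using pder_mult[OF E, of x "x ^ Suc j"] True by (simp add: ppow px tw_def hom_mult[OF phi])
      then show ?case unfolding Suc.IH Ex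
        by (simp add: cn_mult scl_add_left[symmetric] distrib_right)
    qed
    have Emon: "E (x ^ Suc j * a) = x ^ j * scl (of_nat (Suc j) * \<gamma>) a" if "a \<in> agen G" for j a
      using pder_mult[OF E, of "x ^ Suc j" a] E0[OF that] p0[OF that] by (simp only: Epow) simp
    \<comment> \<open>Applying \<open>E\<close> to a relation drops the constant term and lowers
      every exponent by one, with nonzero factors, so a shorter relation results.\<close>
    have indep: "\<forall>j<K. g j = 0" if "\<forall>j. g j \<in> agen G" "(\<Sum>j<K. x ^ j * g j) = 0" for K g
      using that
    proof (induction K arbitrary: g)
      case 0
      then show ?case by simp
    next
      case (Suc K)
      let ?h = "\<lambda>j. scl (of_nat (Suc j) * \<gamma>) (g (Suc j))"
      have gA: "g j \<in> agen G" for j using Suc.prems by blast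
      have "0 = E (\<Sum>j<Suc K. x ^ j * g j)" using Suc.prems lin_zero[OF lE] by simp
      also have "\<dots> = E (g 0) + (\<Sum>j<K. E (x ^ Suc j * g (Suc j)))"
        unfolding sum.lessThan_Suc_shift lin_add[OF lE] lin_sum[OF lE] by simp
      also have "\<dots> = (\<Sum>j<K. x ^ j * ?h j)"
        using E0[OF gA] Emon[OF gA] by simp
      finally have "(\<Sum>j<K. x ^ j * ?h j) = 0" by simp
      then have h0: "\<forall>j<K. ?h j = 0" by (intro Suc.IH) (auto intro: agen.scal gA)
      have s: "g (Suc j) = 0" if "j < K" for j
      proof (rule scl_eq_zero)
        show "scl (of_nat (Suc j) * \<gamma>) (g (Suc j)) = 0" using h0 that by blast
        show "of_nat (Suc j) * \<gamma> \<noteq> 0" using Ex(2) by (simp only: mult_eq_0_iff of_nat_eq_0_iff) simp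
      qed
      have "g 0 = 0" using Suc.prems(2) s by (simp only: sum.lessThan_Suc_shift) simp
      then show ?case using s by (metis less_Suc_eq_0_disj)
    qed
    \<comment> \<open>Padding to \<open>Suc J\<close> lets the constant term be split off even when
      \<open>J = 0\<close>.\<close>
    have w': "w = (\<Sum>j<Suc J. x ^ j * f j)" using xexp_enlarge[OF f, of "Suc J"] unfolding xexp_def by auto
    have "0 = E (\<Sum>j<Suc J. x ^ j * f j)" using w(2) w' by simp
    also have "\<dots> = E (f 0) + (\<Sum>j<J. E (x ^ Suc j * f (Suc j)))"
      unfolding sum.lessThan_Suc_shift lin_add[OF lE] lin_sum[OF lE] by simp
    also have "\<dots> = (\<Sum>j<J. x ^ j * scl (of_nat (Suc j) * \<gamma>) (f (Suc j)))"
      using E0[OF fA] Emon[OF fA] by simp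
    finally have "(\<Sum>j<J. x ^ j * scl (of_nat (Suc j) * \<gamma>) (f (Suc j))) = 0" by simp
    from indep[OF _ this] have h0: "\<forall>j<J. scl (of_nat (Suc j) * \<gamma>) (f (Suc j)) = 0"
      by (auto intro: agen.scal fA)
    have "f (Suc j) = 0" if "j < J" for j
    proof (rule scl_eq_zero)
      show "scl (of_nat (Suc j) * \<gamma>) (f (Suc j)) = 0" using h0 that by blast
      show "of_nat (Suc j) * \<gamma> \<noteq> 0" using Ex(2) by (simp only: mult_eq_0_iff of_nat_eq_0_iff) simp
    qed
    then have "w = f 0" unfolding w' sum.lessThan_Suc_shift by simp
    then show ?thesis using fA by simp
  next
    case False
    \<comment> \<open>For odd \<open>x\<close> the expansion has at most a constant and a linear
      term, so one application of \<open>E\<close> decides.\<close>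
    have "x * x = 0" by (rule odd_square_zero) (use x False in \<open>simp add: sg_def\<close>)
    then have x2: "x ^ Suc (Suc j) = 0" for j by (simp add: mult.assoc[symmetric])
    have "w = (\<Sum>j<Suc (Suc J). x ^ j * f j)" using xexp_enlarge[OF f, of "Suc (Suc J)"] unfolding xexp_def by auto
    also have "\<dots> = f 0 + x * f 1"
      unfolding sum.lessThan_Suc_shift using x2 by simp
    finally have w': "w = f 0 + x * f 1" .
    have "E w = scl \<gamma> (f 1)"
      unfolding w' lin_add[OF lE] pder_mult[OF E] E0[OF fA] p0[OF fA] Ex by (simp add: cn_mult)
    then have "f 1 = 0" using w(2) Ex(2) scl_eq_zero by metis
    then show ?thesis using w' fA by simp
  qed
qed

text \<open>For \<open>N = 2*n+1\<close> these are the derivatives of all the coefficients below the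
  leading one, including that of \<open>D^(N-1)\<close>, which only the projection to sl
  removes.\<close>

definition C0 :: "nat \<Rightarrow> sp set" where
  "C0 N = {(dif ^^ m) (rdS 1 N (N - d)) | d m. 1 \<le> d \<and> d \<le> N}"

lemma sig_dif_funpow: "sig x = sg k x \<Longrightarrow> sig ((dif ^^ m) x) = sg (k + m) ((dif ^^ m) x)"
proof (induction m)
  case (Suc m)
  then have "- sig (dif ((dif ^^ m) x)) = sg (k + m) (dif ((dif ^^ m) x))"
    by (simp only: dif_sig[symmetric] lin_sg[OF lin_dif] Suc.IH)
  then have "sig (dif ((dif ^^ m) x)) = - sg (k + m) (dif ((dif ^^ m) x))" by (metis minus_minus)
  then show ?case by (simp add: sg_def)
qed simp

lemma C0_sig_stable: "sig_stable (C0 N)"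
proof -
  have "\<exists>k. sig ((dif ^^ m) (rdS 1 N (N - d))) = sg k ((dif ^^ m) (rdS 1 N (N - d)))" for d m
    using sig_dif_funpow[OF sig_rdS[of 1 N "N - d"], of m] by auto
  then show ?thesis unfolding C0_def by (intro sig_stableI) blast
qed

lemma C0_dif: "g \<in> C0 N \<Longrightarrow> dif g \<in> C0 N"
proof -
  assume "g \<in> C0 N"
  then obtain d m where g: "g = (dif ^^ m) (rdS 1 N (N - d))" "1 \<le> d" "d \<le> N" unfolding C0_def by blast
  then have "dif g = (dif ^^ Suc m) (rdS 1 N (N - d))" by simp
  then show ?thesis using g(2,3) unfolding C0_def by blast
qed

lemma C0_gv: "g \<in> C0 N \<Longrightarrow> g \<in> agen (gv N 1)"
  unfolding C0_def by (auto intro!: agen_dif_funpow[OF gv_sig_stable gv_dif] rdS_gv)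

lemma dl_dif_funpow_zero:
  assumes "\<And>k. dl a b k x = 0" shows "dl a b k ((dif ^^ m) x) = 0"
proof (induction m arbitrary: k)
  case (Suc m)
  then show ?case by (simp add: dl_dif stepS_def)
qed (simp add: assms)

lemma dl_C0: "1 \<le> a \<Longrightarrow> a < b \<Longrightarrow> b \<le> N \<Longrightarrow> g \<in> C0 N \<Longrightarrow> dl a b k g = 0"
  unfolding C0_def by (auto intro!: dl_dif_funpow_zero simp: gauge)

lemma stepS_const:
  "stepS P (\<lambda>k. if k = j then cn c else 0) = (\<lambda>k. if k = Suc j then cn ((-1) ^ (P + j) * c) else 0)"
proof
  fix k
  show "stepS P (\<lambda>k. if k = j then cn c else 0) k = (if k = Suc j then cn ((-1) ^ (P + j) * c) else 0)"
    by (cases k) (auto simp: stepS_def sg_cn power_add mult.assoc)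
qed

text \<open>Constants have derivative 0, so each application of D + \<chi> merely shifts the power
  of \<chi>. This is why the \<open>m\<close>-th derivative of a variable is detected by the
  coefficient of \<chi>^m and by no other.\<close>

lemma stepS_funpow_const:
  assumes "c \<noteq> 0"
  shows "\<exists>c'. c' \<noteq> 0 \<and> (stepS P ^^ m) (\<lambda>k. if k = 0 then cn c else 0) = (\<lambda>k. if k = m then cn c' else 0)"
proof (induction m)
  case 0
  show ?case using assms by auto
next
  case (Suc m)
  then obtain c' where c': "c' \<noteq> 0"
    "(stepS P ^^ m) (\<lambda>k. if k = 0 then cn c else 0) = (\<lambda>k. if k = m then cn c' else 0)" by blast
  show ?case
    by (rule exI[of _ "(-1) ^ (P + m) * c'"]) (use c' in \<open>simp add: stepS_const\<close>)
qed

lemma stepS_funpow_zero: "(stepS P ^^ m) (\<lambda>k. 0) = (\<lambda>k. 0)"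
proof (induction m)
  case (Suc m)
  have "stepS P (\<lambda>k. 0) = (\<lambda>k. 0)" by (simp add: stepS_def fun_eq_iff)
  then show ?case using Suc by simp
qed simp

lemma dl_vr_funpow: "(\<lambda>k. dl a b k (vr (c, d, m))) = (stepS (pe a b) ^^ m) (\<lambda>k. rho (brbS a b c d k))"
proof (induction m)
  case 0
  show ?case by (simp add: dl_vr)
next
  case (Suc m)
  have "(\<lambda>k. dl a b k (vr (c, d, Suc m))) = stepS (pe a b) (\<lambda>k. dl a b k (vr (c, d, m)))"
    using dl_dif[of a b _ "vr (c, d, m)"] by (simp add: dif_vr Dv_def)
  then show ?case using Suc by simp
qed

text \<open>As \<open>a < t\<close>, the bracket of e_ab with e_st has no form term and can only
  contain e_at, when \<open>s = b\<close>. That element reduces to a nonzero constant only if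
  \<open>t = a + 1\<close>.\<close>

lemma dl_slice_zero:
  assumes "Suc a \<le> t" "t \<noteq> Suc a \<or> s \<noteq> b"
  shows "dl a b k (vr (s, t, m)) = 0"
proof -
  have "(\<lambda>k. rho (brbS a b s t k)) = (\<lambda>k. 0)"
    using assms by (auto simp: brbS_def lieS_def rho_sg rho_vr rhov_def form_ee_def fe_def cn_scl)
  then show ?thesis using fun_cong[OF dl_vr_funpow[of a b s t m], of k] by (simp add: stepS_funpow_zero)
qed

text \<open>The bracket of e_ab with e_(b,a+1) is, up to sign, e_(a,a+1), which pairs nontrivially
  with \<open>f\<close>.\<close>

lemma dl_slice_const:
  "\<exists>c. c \<noteq> 0 \<and> (\<forall>k. dl a b k (vr (b, Suc a, m)) = (if k = m then cn c else 0))"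
proof -
  let ?c = "(-1) ^ (pe a b * (pe b (Suc a) + 1)) * fe a (Suc a)"
  have e: "(\<lambda>k. rho (brbS a b b (Suc a) k)) = (\<lambda>k. if k = 0 then cn ?c else 0)"
    by (auto simp: brbS_def lieS_def rho_sg rho_vr rhov_def form_ee_def sg_cn cn_scl[of 0])
  have "?c \<noteq> 0" by (simp add: fe_def)
  from stepS_funpow_const[OF this, of m "pe a b"] obtain c' where c': "c' \<noteq> 0"
    "(stepS (pe a b) ^^ m) (\<lambda>k. if k = 0 then cn ?c else 0) = (\<lambda>k. if k = m then cn c' else 0)"
    by (elim exE conjE) (rule that)
  have "dl a b k (vr (b, Suc a, m)) = (if k = m then cn c' else 0)" for k
    using fun_cong[OF dl_vr_funpow[of a b b "Suc a" m], of k] unfolding e c'(2) .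
  then show ?thesis using c'(1) by blast
qed

text \<open>A column contains infinitely many variables because of the derivatives, but a given
  element involves finitely many, so eliminating them one at a time terminates.\<close>

lemma agen_finite:
  assumes "w \<in> agen (G \<union> Y)"
  shows "\<exists>F. finite F \<and> F \<subseteq> Y \<and> w \<in> agen (G \<union> F)"
  using assms
proof induction
  case (const c)
  show ?case by (rule exI[of _ "{}"]) (auto intro: agen.const)
next
  case (gen g)
  show ?case
  proof (cases "g \<in> G")
    case True
    then show ?thesis by (intro exI[of _ "{}"]) (auto intro: agen.gen)
  next
    case False
    then show ?thesis using gen by (intro exI[of _ "{g}"]) (auto intro: agen.gen)
  qed
next
  case (add a b)
  then obtain F F' where "finite F" "F \<subseteq> Y" "a \<in> agen (G \<union> F)" "finite F'" "F' \<subseteq> Y" "b \<in> agen (G \<union> F')"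
    by blast
  then show ?case
    by (intro exI[of _ "F \<union> F'"]) (auto intro!: agen.add elim: agen_mono[rotated])
next
  case (scal a c)
  then show ?case by (meson agen.scal)
next
  case (mult a b)
  then obtain F F' where "finite F" "F \<subseteq> Y" "a \<in> agen (G \<union> F)" "finite F'" "F' \<subseteq> Y" "b \<in> agen (G \<union> F')"
    by blast
  then show ?case
    by (intro exI[of _ "F \<union> F'"]) (auto intro!: agen.mult elim: agen_mono[rotated])
qed

lemma eliminate_step:
  assumes T: "1 \<le> T" and w: "w \<in> agen (C0 N \<union> gv N (Suc T))"
    and inv: "\<And>a b k. 1 \<le> a \<Longrightarrow> a < b \<Longrightarrow> b \<le> N \<Longrightarrow> dl a b k w = 0"
  shows "w \<in> agen (C0 N \<union> gv N (Suc (Suc T)))"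
proof -
  let ?G = "C0 N \<union> gv N (Suc (Suc T))"
  let ?Y = "{vr (s, Suc T, m) | s m. Suc T \<le> s \<and> s \<le> N}"
  have "gv N (Suc T) \<subseteq> gv N (Suc (Suc T)) \<union> ?Y"
  proof
    fix g assume "g \<in> gv N (Suc T)"
    then obtain s t m where g: "g = vr (s, t, m)" "Suc T \<le> t" "t \<le> s" "s \<le> N" unfolding gv_def by blast
    show "g \<in> gv N (Suc (Suc T)) \<union> ?Y"
    proof (cases "t = Suc T")
      case True
      then show ?thesis using g by blast
    next
      case False
      then have "Suc (Suc T) \<le> t" using g by simp
      then show ?thesis using g unfolding gv_def by blast
    qed
  qed
  then have "w \<in> agen (?G \<union> ?Y)" using w by (elim agen_mono[rotated]) blast
  from agen_finite[OF this] obtain F where F: "finite F" "F \<subseteq> ?Y" "w \<in> agen (?G \<union> F)"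
    by (elim exE conjE) (rule that)
  have "F \<subseteq> ?Y \<Longrightarrow> w \<in> agen (?G \<union> F) \<Longrightarrow> w \<in> agen ?G"
    using F(1)
  proof (induction F rule: finite_induct)
    case empty
    then show ?case by simp
  next
    case (insert x F)
    then obtain s m where x: "x = vr (s, Suc T, m)" and s: "Suc T \<le> s" "s \<le> N" by auto
    have Fgv: "\<exists>s' m'. g = vr (s', Suc T, m')" if "g \<in> F" for g using insert.prems(1) that by blast
    obtain c where c: "c \<noteq> 0" "\<And>k. dl T s k (vr (s, Suc T, m)) = (if k = m then cn c else 0)"
      using dl_slice_const[of T s m] by blast
    have "w \<in> agen (?G \<union> F)"
    \<comment> \<open>The matrix unit with indices \<open>T\<close>, \<open>s\<close> is the partner
      of \<open>x\<close>: their bracket reaches the superdiagonal entry (T, T+1), and the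
      coefficient of \<chi>^m singles out the \<open>m\<close>-th derivative.\<close>
    proof (rule slice[OF hom_rho pder_dl[of T s m]])
      show "sig x = sg (pe T s + m) x"
        unfolding x sig_vr by (rule sg_cong) (auto simp: even_vpar)
      show "dl T s m x = cn c" using c(2)[of m] x by simp
      show "c \<noteq> 0" by (rule c(1))
      show "rho x = x" using s by (simp add: x rho_vr rhov_def)
      show "sig_stable (?G \<union> F)"
      proof (intro sig_stable_Un C0_sig_stable gv_sig_stable)
        show "sig_stable F" by (rule sig_stableI) (metis Fgv sig_vr)
      qed
      show "w \<in> agen (insert x (?G \<union> F))" using insert.prems(2) by simp
      show "dl T s m w = 0" using inv T s by simp
      fix g assume g: "g \<in> ?G \<union> F"
      have "g \<in> C0 N \<or> (\<exists>s' t' m'. g = vr (s', t', m') \<and> Suc T \<le> t' \<and> t' \<le> s' \<and> s' \<le> N \<and> g \<noteq> x)"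
      proof -
        consider "g \<in> C0 N" | "g \<in> gv N (Suc (Suc T))" | "g \<in> F" using g by blast
        then show ?thesis
        proof cases
          case 2
          then obtain s' t' m' where h: "g = vr (s', t', m')" "Suc (Suc T) \<le> t'" "t' \<le> s'" "s' \<le> N"
            unfolding gv_def by blast
          \<comment> \<open>Distinctness of \<open>g\<close> and \<open>x\<close> as ring elements
            is read off from the derivation, which kills one and not the other.\<close>
          have "dl T s m g = 0" unfolding h by (rule dl_slice_zero) (use h in auto)
          moreover have "dl T s m x \<noteq> 0"
            using c(2)[of m] c(1) scl_eq_zero[of c 1] by (auto simp: x cn_scl)
          ultimately have "g \<noteq> x" by auto
          moreover have "Suc T \<le> t'" using h(2) by simp
          ultimately show ?thesis using h(1,3,4) by blast
        next
          case 3
          then have "g \<noteq> x" using insert.hyps by blast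
          then show ?thesis using 3 insert.prems(1) by blast
        qed simp
      qed
      then show "dl T s m g = 0"
      proof (elim disjE exE conjE)
        assume "g \<in> C0 N"
        then show ?thesis using dl_C0 T s by simp
      next
        fix s' t' m' assume h: "g = vr (s', t', m')" "Suc T \<le> t'" "g \<noteq> x"
        show ?thesis
        proof (cases "t' = Suc T \<and> s' = s")
          case True
          \<comment> \<open>Same matrix entry but another derivative: only the coefficient of
            \<chi>^m' sees it, while the derivation in use takes that of \<chi>^m.\<close>
          then have "m' \<noteq> m" using h x by auto
          obtain c' where "\<And>k. dl T s k (vr (s, Suc T, m')) = (if k = m' then cn c' else 0)"
            using dl_slice_const[of T s m'] by blast
          then show ?thesis using h True \<open>m' \<noteq> m\<close> by simp
        next
          case False
          then show ?thesis unfolding h(1) using h(2) by (intro dl_slice_zero) auto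
        qed
      qed
      show "rho g = g"
      proof -
        have "g \<in> agen (gv N 1)"
          using g C0_gv Fgv agen.gen[of g "gv N (Suc (Suc T))"] insert.prems(1)
            agen_gv_mono[of 1 "Suc (Suc T)" g N]
          by (auto intro!: gv_vr)
        then show ?thesis by (rule rho_gv)
      qed
    qed
    then show ?case using insert.IH insert.prems by blast
  qed
  then show ?thesis using F by blast
qed

lemma eliminate:
  assumes w: "w \<in> agen (C0 N \<union> gv N 2)"
    and inv: "\<And>a b k. 1 \<le> a \<Longrightarrow> a < b \<Longrightarrow> b \<le> N \<Longrightarrow> dl a b k w = 0"
  shows "w \<in> agen (C0 N)"
proof -
  have "w \<in> agen (C0 N \<union> gv N (Suc (Suc T)))" for T
  proof (induction T)
    case 0
    then show ?case using w by (simp add: numeral_2_eq_2)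
  next
    case (Suc T)
    show ?case by (rule eliminate_step[OF _ Suc inv]) simp_all
  qed
  \<comment> \<open>No column index exceeds \<open>N\<close>, so \<open>gv N (Suc (Suc N))\<close>
    is empty.\<close>
  from this[of N] show ?thesis by (rule agen_mono[rotated]) (auto simp: gv_def)
qed

lemma gen_dif: "x \<in> agen (C0 N \<union> gv N 2) \<Longrightarrow> (dif ^^ m) x \<in> agen (C0 N \<union> gv N 2)"
proof (rule agen_dif_funpow)
  show "sig_stable (C0 N \<union> gv N 2)" by (intro sig_stable_Un C0_sig_stable gv_sig_stable)
  fix g assume "g \<in> C0 N \<union> gv N 2"
  then show "dif g \<in> agen (C0 N \<union> gv N 2)"
    using C0_dif[of g N] gv_dif[of g N 2] by (auto intro: agen.gen agen_mono)
qed

text \<open>Expanding the first row, the coefficient of \<open>D\<^bsup>N-d\<^esup>\<close> is \<open>eS d 1\<close> plus terms in the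
  \<open>eS j 1\<close> with \<open>j < d\<close> and in variables with second index at least 2.\<close>

lemma gen_first_column:
  assumes "1 \<le> d" "d \<le> N"
  shows "vr (d, 1, 0) \<in> agen (C0 N \<union> gv N 2)"
  using assms
proof (induction d rule: less_induct)
  case (less d)
  let ?A = "agen (C0 N \<union> gv N 2)"
  have gvA: "x \<in> ?A" if "x \<in> agen (gv N 2)" for x using that by (rule agen_mono[rotated]) simp
  have e: "rdS 1 N (N - d) = ldS (rdS 2 N) (N - d) + (eS d 1 * rdS (Suc d) N (N - d)
      + (\<Sum>j\<in>{1..N} - {d}. eS j 1 * rdS (Suc j) N (N - d)))"
    using less.prems rdS_rec[of 1 N "N - d"] sum.remove[of "{1..N}" d "\<lambda>j. eS j 1 * rdS (Suc j) N (N - d)"]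
    by (simp add: numeral_2_eq_2)
  have one: "rdS (Suc d) N (N - d) = 1" using rdS_top[of "Suc d" N] less.prems by simp
  have "eS j 1 * rdS (Suc j) N (N - d) \<in> ?A" if j: "j \<in> {1..N} - {d}" for j
  proof (cases "j < d")
    case True
    then have "vr (j, 1, 0) \<in> ?A" using less.IH[of j] j less.prems by auto
    moreover have "rdS (Suc j) N (N - d) \<in> ?A"
      by (rule gvA, rule agen_gv_mono[OF _ rdS_gv]) (use j in auto)
    ultimately show ?thesis unfolding eS_def by (intro agen.mult agen_sg)
  next
    case False
    \<comment> \<open>Here \<open>j > d\<close>, so the block has size \<open>N - j\<close>, less
      than the requested order \<open>N - d\<close>.\<close>
    then have "rdS (Suc j) N (N - d) = 0" using rdS_top[of "Suc j" N] j less.prems by auto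
    then show ?thesis by (simp add: agen_zero)
  qed
  then have s: "(\<Sum>j\<in>{1..N} - {d}. eS j 1 * rdS (Suc j) N (N - d)) \<in> ?A" by (rule agen_sum)
  have l: "ldS (rdS 2 N) (N - d) \<in> ?A"
    by (rule gvA, rule agen_gv_ldS, rule rdS_gv) (use less.prems in simp)
  have "rdS 1 N (N - d) \<in> C0 N"
    unfolding C0_def using less.prems by (intro CollectI exI[of _ d] exI[of _ 0]) simp
  then have "rdS 1 N (N - d) \<in> ?A" by (intro agen.gen) simp
  then have "rdS 1 N (N - d) - ldS (rdS 2 N) (N - d) - (\<Sum>j\<in>{1..N} - {d}. eS j 1 * rdS (Suc j) N (N - d)) \<in> ?A"
    using s l by (intro agen_diff)
  then have "eS d 1 \<in> ?A" unfolding e one by simp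
  then have "sg (ppar d) (eS d 1) \<in> ?A" by (rule agen_sg)
  then show ?case by (simp add: eS_def)
qed

lemma generation: "x \<in> agen (gv N 1) \<Longrightarrow> x \<in> agen (C0 N \<union> gv N 2)"
proof (erule agen_subset[rotated], rule subsetI)
  fix g assume "g \<in> gv N 1"
  then obtain s t m where g: "g = vr (s, t, m)" "1 \<le> t" "t \<le> s" "s \<le> N" unfolding gv_def by blast
  show "g \<in> agen (C0 N \<union> gv N 2)"
  proof (cases "t = 1")
    case True
    have "(dif ^^ m) (vr (s, 1, 0)) \<in> agen (C0 N \<union> gv N 2)"
      by (rule gen_dif, rule gen_first_column) (use g in auto)
    then show ?thesis using g True by (simp add: dif_funpow_vr)
  next
    case False
    then have "2 \<le> t" using g by simp
    then have "g \<in> gv N 2" using g unfolding gv_def by blast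
    then show ?thesis by (intro agen.gen) simp
  qed
qed

theorem kernel_generated:
  assumes "w \<in> agen (gv N 1)"
    and "\<And>a b k. 1 \<le> a \<Longrightarrow> a < b \<Longrightarrow> b \<le> N \<Longrightarrow> dl a b k w = 0"
  shows "w \<in> agen (C0 N)"
  by (rule eliminate[OF generation[OF assms(1)] assms(2)])

section \<open>The subalgebras of \<open>sl(n+1|n)\<close> and the ideal\<close>

lemma dif_funpow_barS: "(dif ^^ m) (barS n X) = (\<Sum>i\<in>Iset n. \<Sum>j\<in>Iset n. scl (X i j) (vr (i, j, m)))"
  unfolding barS_def by (simp add: lin_sum[OF lin_dif_funpow] lin_scl[OF lin_dif_funpow] dif_funpow_vr)

lemma VS_mono: "S \<subseteq> T \<Longrightarrow> x \<in> VS n S \<Longrightarrow> x \<in> VS n T"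
  unfolding VS_def by (rule agen_mono) auto

lemma p_subset_sl: "p_set n \<subseteq> sl_set n"
  by (auto simp: p_set_def)

lemma VS_barS: "X \<in> S \<Longrightarrow> (dif ^^ m) (barS n X) \<in> VS n S"
  unfolding VS_def by (rule agen.gen) auto

text \<open>The effect of \<open>sig\<close> on matrices. Elements of sl need not be homogeneous, so
  stability under \<open>sig\<close> is obtained from invariance of sl and p under this
  twist.\<close>

definition par_twist :: "mat \<Rightarrow> mat" where
  "par_twist X = (\<lambda>i j. (-1) ^ (ppar i + ppar j + 1) * X i j)"

lemma sig_barS: "sig (barS n X) = barS n (par_twist X)"
proof -
  have "sig (vr (i, j, 0)) = scl ((-1) ^ (ppar i + ppar j + 1)) (vr (i, j, 0))" for i j
    unfolding sig_vr scl_pow by (rule sg_cong) (simp add: even_vpar)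
  then show ?thesis
    unfolding barS_def par_twist_def lin_sum[OF lin_sig] sig_scl by (simp add: mult.commute)
qed

lemma sig_dif_funpow_sg: "sig ((dif ^^ m) x) = sg m ((dif ^^ m) (sig x))"
proof (induction m)
  case (Suc m)
  have "sig (dif y) = - dif (sig y)" for y using dif_sig[of y] by simp
  then show ?case using Suc by (simp add: lin_sg[OF lin_dif]) (simp add: sg_def)
qed simp

lemma VS_sig_stable:
  assumes "\<And>X. X \<in> S \<Longrightarrow> par_twist X \<in> S"
  shows "sig_stable {(dif ^^ m) (barS n X) | X m. X \<in> S}"
proof -
  have "sig ((dif ^^ m) (barS n X)) \<in> VS n S" if "X \<in> S" for X m
    unfolding sig_dif_funpow_sg sig_barS VS_def
    by (rule agen_sg) (use VS_barS[OF assms[OF that]] in \<open>simp add: VS_def\<close>)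
  then show ?thesis unfolding sig_stable_def VS_def by blast
qed

lemma VS_dif_gen: "g \<in> {(dif ^^ m) (barS n X) | X m. X \<in> S} \<Longrightarrow> dif g \<in> agen {(dif ^^ m) (barS n X) | X m. X \<in> S}"
proof -
  assume "g \<in> {(dif ^^ m) (barS n X) | X m. X \<in> S}"
  then obtain X m where "g = (dif ^^ m) (barS n X)" "X \<in> S" by blast
  then show ?thesis using VS_barS[of X S "Suc m" n] by (simp add: VS_def)
qed

lemma par_twist_sl: "X \<in> sl_set n \<Longrightarrow> par_twist X \<in> sl_set n"
proof -
  assume X: "X \<in> sl_set n"
  have "str n (par_twist X) = - str n X"
    by (simp add: str_def par_twist_def sum_negf)
  then show ?thesis using X by (auto simp: sl_set_def in_gl_def par_twist_def)
qed

lemma par_twist_p: "X \<in> p_set n \<Longrightarrow> par_twist X \<in> p_set n"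
  using par_twist_sl[of X n] by (auto simp: p_set_def par_twist_def)

lemma VS_dif: "(\<And>X. X \<in> S \<Longrightarrow> par_twist X \<in> S) \<Longrightarrow> x \<in> VS n S \<Longrightarrow> (dif ^^ m) x \<in> VS n S"
  unfolding VS_def by (rule agen_dif_funpow[OF VS_sig_stable VS_dif_gen])

lemma VS_tw: "(\<And>X. X \<in> S \<Longrightarrow> par_twist X \<in> S) \<Longrightarrow> x \<in> VS n S \<Longrightarrow> tw c x \<in> VS n S"
  unfolding VS_def by (rule agen_tw[OF VS_sig_stable])

lemma VS_p_gv: "x \<in> VS n (p_set n) \<Longrightarrow> x \<in> agen (gv (2*n+1) 1)"
  unfolding VS_def
proof (erule agen_subset[rotated], rule subsetI)
  fix g assume "g \<in> {(dif ^^ m) (barS n X) | X m. X \<in> p_set n}"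
  then obtain X m where g: "g = (dif ^^ m) (barS n X)" "X \<in> p_set n" by blast
  have "scl (X i j) (vr (i, j, m)) \<in> agen (gv (2*n+1) 1)" if "i \<in> Iset n" "j \<in> Iset n" for i j
  proof (cases "X i j = 0")
    case True
    then show ?thesis by (simp add: agen_zero)
  next
    case False
    then have "j \<le> i" using g(2) by (auto simp: p_set_def)
    then show ?thesis using that by (intro agen.scal gv_vr) (auto simp: Iset_def)
  qed
  then show "g \<in> agen (gv (2*n+1) 1)"
    unfolding g(1) dif_funpow_barS by (intro agen_sum)
qed

section \<open>The ideal as the kernel of the reduction on V(sl)\<close>

definition lowm :: "mat \<Rightarrow> mat" where
  "lowm X = (\<lambda>i j. if j \<le> i then X i j else 0)"

definition upm :: "mat \<Rightarrow> mat" where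
  "upm X = (\<lambda>i j. if i < j then X i j else 0)"

lemma lowm_p: "X \<in> sl_set n \<Longrightarrow> lowm X \<in> p_set n"
  by (auto simp: p_set_def sl_set_def in_gl_def str_def lowm_def split: if_splits)

lemma upm_nil: "X \<in> sl_set n \<Longrightarrow> upm X \<in> nil_set n"
  by (auto simp: nil_set_def sl_set_def in_gl_def str_def upm_def split: if_splits)

lemma barS_split: "barS n X = barS n (lowm X) + barS n (upm X)"
  unfolding barS_def sum.distrib[symmetric]
  by (intro sum.cong refl) (auto simp: lowm_def upm_def)

lemma form_fmat: "form n (fmat n) X = (\<Sum>i\<in>Iset n. \<Sum>j\<in>Iset n. X i j * fe i j)"
proof -
  have "form n (fmat n) X = (\<Sum>j\<in>Iset n. \<Sum>i\<in>Iset n. (-1) ^ ppar j * (fmat n j i * X i j))"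
    by (simp add: form_def str_def matmul_def sum_distrib_left)
  also have "\<dots> = (\<Sum>j\<in>Iset n. \<Sum>i\<in>Iset n. X i j * fe i j)"
    by (intro sum.cong refl) (auto simp: fmat_def fe_def Iset_def)
  also have "\<dots> = (\<Sum>i\<in>Iset n. \<Sum>j\<in>Iset n. X i j * fe i j)" by (rule sum.swap)
  finally show ?thesis .
qed

lemma form_upm: "form n (fmat n) (upm X) = form n (fmat n) X"
  unfolding form_fmat by (intro sum.cong refl) (auto simp: upm_def fe_def)

lemma cn_add: "cn (c + d) = cn c + cn d"
  by (simp add: cn_scl scl_add_left)

lemma cn_zero: "cn 0 = 0"
  by (simp add: cn_scl)

lemma cn_sum: "cn (sum f I) = (\<Sum>i\<in>I. cn (f i))"
  by (induction I rule: infinite_finite_induct) (auto simp: cn_add cn_zero)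

lemma sg_diff: "sg k (a - b) = sg k a - sg k b"
  by (simp add: sg_def)

lemma rho_barS: "rho (barS n X) = barS n (lowm X) + cn (form n (fmat n) X)"
  unfolding barS_def form_fmat cn_sum lin_sum[OF lin_rho] rho_scl rho_vr sum.distrib[symmetric]
  by (intro sum.cong refl) (auto simp: rhov_def lowm_def fe_def cn_scl)

lemma barS_nil_low: "X \<in> nil_set n \<Longrightarrow> barS n (lowm X) = 0"
proof -
  assume a: "X \<in> nil_set n"
  have "X i j = 0" if "j \<le> i" for i j
    using a that unfolding nil_set_def by simp (meson leD)
  then show ?thesis unfolding barS_def by (intro sum.neutral ballI) (simp add: lowm_def)
qed

lemma rho_dif_funpow: "rho ((dif ^^ m) x) = (dif ^^ m) (rho x)"
  by (rule hom_dif_funpow) (rule rho_dif)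

lemma rho_JS: "x \<in> JS n \<Longrightarrow> rho x = 0"
  by (induction rule: JS.induct)
     (auto simp: lin_diff[OF lin_rho] rho_barS barS_nil_low rho_add rho_mult rho_dif)

lemma JS_scl: "x \<in> JS n \<Longrightarrow> scl c x \<in> JS n"
  using JS.lmult[of "cn c" n x] by (simp add: VS_def agen.const cn_mult)

lemma JS_dif_funpow: "x \<in> JS n \<Longrightarrow> (dif ^^ m) x \<in> JS n"
  by (induction m) (auto intro: JS.deriv)

lemma dif_funpow_cn: "(dif ^^ m) (cn c) = (if m = 0 then cn c else 0)"
  by (induction m) auto

text \<open>V(sl) is V(p) plus the ideal, with \<open>rho\<close> as the projection. Consequently an
  element of V(sl) that reduces to 0 lies in the ideal, which is the converse of
  \<open>rho_JS\<close> on V(sl).\<close>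

lemma VS_sl_rho:
  assumes "x \<in> VS n (sl_set n)"
  shows "rho x \<in> VS n (p_set n) \<and> x - rho x \<in> JS n"
  using assms unfolding VS_def
proof (induction rule: agen.induct)
  case (const c)
  show ?case by (simp add: agen.const JS.zero)
next
  case (gen g)
  then obtain X m where g: "g = (dif ^^ m) (barS n X)" "X \<in> sl_set n" by blast
  have r: "rho g = (dif ^^ m) (barS n (lowm X)) + (dif ^^ m) (cn (form n (fmat n) X))"
    by (simp add: g rho_dif_funpow rho_barS lin_add[OF lin_dif_funpow])
  have "g - rho g = (dif ^^ m) (barS n (upm X) - cn (form n (fmat n) (upm X)))"
    unfolding r unfolding g barS_split[of n X] form_upm
    by (simp add: lin_add[OF lin_dif_funpow] lin_diff[OF lin_dif_funpow])
  moreover have "barS n (upm X) - cn (form n (fmat n) (upm X)) \<in> JS n"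
    by (rule JS.gen) (rule upm_nil[OF g(2)])
  moreover have "(dif ^^ m) (barS n (lowm X)) \<in> VS n (p_set n)"
    by (rule VS_barS) (rule lowm_p[OF g(2)])
  ultimately show ?case unfolding r
    by (auto simp: VS_def dif_funpow_cn JS_dif_funpow intro: agen.add agen.const)
next
  case (add a b)
  have e: "a + b - rho (a + b) = (a - rho a) + (b - rho b)" by (simp add: rho_add)
  have "a + b - rho (a + b) \<in> JS n" unfolding e using add by (blast intro: JS.add)
  then show ?case using add by (simp add: rho_add agen.add)
next
  case (scal a c)
  have e: "scl c a - rho (scl c a) = scl c (a - rho a)" by (simp add: rho_scl lin_def lin_diff[of "scl c"] scl_add mult.commute)
  have "scl c a - rho (scl c a) \<in> JS n" unfolding e using scal by (blast intro: JS_scl)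
  then show ?case using scal by (simp add: rho_scl agen.scal)
next
  case (mult a b)
  have e: "a * b - rho (a * b) = (a - rho a) * b + rho a * (b - rho b)"
    by (simp add: rho_mult algebra_simps)
  have b: "b \<in> VS n (sl_set n)" using mult by (simp add: VS_def)
  have ra: "rho a \<in> VS n (sl_set n)"
    by (rule VS_mono[OF p_subset_sl]) (use mult in \<open>simp add: VS_def\<close>)
  show ?case unfolding e
    using mult by (auto simp: rho_mult intro: agen.mult JS.add JS.lmult[OF ra] JS.rmult[OF b])
qed

text \<open>Supercommutators of matrices have supertrace 0, so brackets of generators already lie in
  V(sl). This is what makes \<open>VS_sl_rho\<close> applicable to brackets.\<close>

lemma brk_VS_sl:
  assumes ab: "a \<in> Iset n" "b \<in> Iset n" and y: "y \<in> VS n (sl_set n)"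
  shows "brk a b k y \<in> VS n (sl_set n)"
proof -
  let ?V = "VS n (sl_set n)"
  have V: "?V = agen {(dif ^^ m) (barS n X) | X m. X \<in> sl_set n}" by (simp add: VS_def)
  have lie: "lieS a b c d \<in> ?V" if cd: "c \<in> Iset n" "d \<in> Iset n" for c d
  proof -
    define Z :: mat where "Z = (\<lambda>i j. (if b = c \<and> i = a \<and> j = d then 1 else 0)
      - (if a = d \<and> i = c \<and> j = b then (-1) ^ (pe a b * pe c d) else 0))"
    have del: "(\<Sum>i\<in>Iset n. \<Sum>j\<in>Iset n. scl (if q \<and> i = u \<and> j = v then s else 0) (vr (i, j, 0)))
        = (if q then scl s (vr (u, v, 0)) else 0)" if "u \<in> Iset n" "v \<in> Iset n" for q u v s
    proof -
      have "(\<Sum>j\<in>Iset n. scl (if q \<and> i = u \<and> j = v then s else 0) (vr (i, j, 0)))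
          = (if i = u then (if q then scl s (vr (u, v, 0)) else 0) else 0)" for i
      proof -
        have "(\<Sum>j\<in>Iset n. scl (if q \<and> i = u \<and> j = v then s else 0) (vr (i, j, 0)))
          = (\<Sum>j\<in>Iset n. if j = v then (if q \<and> i = u then scl s (vr (i, v, 0)) else 0) else 0)"
          by (rule sum.cong) auto
        then show ?thesis using that by (simp add: Iset_def)
      qed
      then show ?thesis using that by (simp add: Iset_def)
    qed
    have "barS n Z = lieS a b c d"
      unfolding barS_def Z_def diff_conv_add_uminus scl_add_left sum.distrib scl_minus_left sum_negf
        del[OF ab(1) cd(2)] del[OF cd(1) ab(2)] lieS_def scl_pow by simp
    moreover have "str n Z = 0"
    proof -
      have "(\<Sum>i\<in>Iset n. (-1) ^ ppar i * (if q \<and> i = u \<and> i = v then s else (0::complex)))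
          = (if q \<and> u = v then (-1) ^ ppar u * s else 0)" if "u \<in> Iset n" for q u v s
      proof -
        have "(\<Sum>i\<in>Iset n. (-1) ^ ppar i * (if q \<and> i = u \<and> i = v then s else (0::complex)))
          = (\<Sum>i\<in>Iset n. if i = u then (if q \<and> u = v then (-1) ^ ppar u * s else 0) else 0)"
          by (rule sum.cong) auto
        then show ?thesis using that by (simp add: Iset_def)
      qed
      note st = this[OF ab(1), of "b = c" d 1] this[OF cd(1), of "a = d" b "(-1) ^ (pe a b * pe c d)"]
      \<comment> \<open>The two terms of \<open>Z\<close> have diagonal entries only when
        \<open>b = c\<close> and \<open>a = d\<close>, hence both or neither. This sign identity
        makes their supertraces cancel.\<close>
      have "(-1) ^ ppar a = (-1) ^ ppar b * (-1 :: complex) ^ (pe a b * pe b a)"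
        unfolding power_add[symmetric] by (rule minus_one_power_iff[THEN trans]) (auto simp: minus_one_power_iff)
      then show ?thesis
        unfolding str_def Z_def right_diff_distrib sum_subtractf st by auto
    qed
    moreover have "in_gl n Z" using ab cd by (auto simp: in_gl_def Z_def split: if_splits)
    ultimately show ?thesis using VS_barS[of Z "sl_set n" 0 n] by (simp add: sl_set_def)
  qed
  have dV: "dif x \<in> ?V" if "x \<in> ?V" for x using VS_dif[OF par_twist_sl that, of 1] by simp
  have var: "brvS a b (c, d, m) k \<in> ?V" if "c \<in> Iset n" "d \<in> Iset n" for c d m k
  proof (induction m arbitrary: k)
    case 0
    show ?case using lie[OF that] by (auto simp: brvS_def brbS_def V intro: agen_sg agen.const agen_zero)
  next
    case (Suc m)
    have "brvS a b (c, d, Suc m) k = stepS (pe a b) (brvS a b (c, d, m)) k"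
      using brvS_Dv[of a b "(c, d, m)"] by (simp add: Dv_def)
    also have "\<dots> \<in> ?V"
      unfolding stepS_def using Suc dV by (auto simp: V intro!: agen_sg agen.add agen_zero)
    finally show ?case .
  qed
  show ?thesis using y[unfolded V]
  proof (induction rule: agen.induct)
    case (const c)
    show ?case by (simp add: pder_cn[OF hom_id pder_brk] V agen_zero)
  next
    case (gen g)
    then obtain X m where g: "g = (dif ^^ m) (barS n X)" by blast
    have "brk a b k g = (\<Sum>i\<in>Iset n. \<Sum>j\<in>Iset n. scl (X i j) (brvS a b (i, j, m) k))"
      unfolding g dif_funpow_barS by (simp add: lin_sum[OF lin_brk] lin_scl[OF lin_brk] brk_vr)
    also have "\<dots> \<in> ?V" using var unfolding V by (intro agen_sum agen.scal)
    finally show ?case .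
  next
    case (add a' b')
    then show ?case by (auto simp: lin_add[OF lin_brk] V intro: agen.add)
  next
    case (scal a' c)
    then show ?case by (auto simp: lin_scl[OF lin_brk] V intro: agen.scal)
  next
    case (mult x y)
    have x: "tw (pe a b + k) x \<in> ?V" 
    proof (rule VS_tw[OF par_twist_sl])
      show "x \<in> ?V" unfolding V by (rule mult.hyps(1))
    qed
    show ?case unfolding brk_mult using x mult unfolding V by (intro agen.add agen.mult)
  qed
qed

lemma bracketS_JS:
  assumes y: "y \<in> VS n (p_set n)" and X: "X \<in> nil_set n"
    and inv: "\<And>a b k. 1 \<le> a \<Longrightarrow> a < b \<Longrightarrow> b \<le> 2*n+1 \<Longrightarrow> dl a b k y = 0"
  shows "bracketS n X y k \<in> JS n"
proof -
  have "y \<in> VS n (sl_set n)" by (rule VS_mono[OF p_subset_sl y])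
  then have V: "bracketS n X y k \<in> VS n (sl_set n)"
    unfolding bracketS_def using brk_VS_sl by (simp add: VS_def agen_sum agen.scal)
  have "scl (X a b) (dl a b k y) = 0" if "a \<in> Iset n" "b \<in> Iset n" for a b
  proof (cases "X a b = 0")
    case False
    then have "a < b" using X by (auto simp: nil_set_def)
    then show ?thesis using inv that by (simp add: Iset_def)
  qed simp
  then have "rho (bracketS n X y k) = 0"
    unfolding bracketS_def lin_sum[OF lin_rho] rho_scl dl_def[symmetric] by (simp add: sum.neutral)
  then show ?thesis using VS_sl_rho[OF V] by simp
qed

definition em :: "nat \<Rightarrow> nat \<Rightarrow> mat" where
  "em a b = (\<lambda>i j. if i = a \<and> j = b then 1 else 0)"

lemma em_nil: "1 \<le> a \<Longrightarrow> a < b \<Longrightarrow> b \<le> 2*n+1 \<Longrightarrow> em a b \<in> nil_set n"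
  by (auto simp: nil_set_def sl_set_def in_gl_def str_def em_def Iset_def intro!: sum.neutral split: if_splits)

lemma sum_em:
  assumes "a \<in> Iset n" "b \<in> Iset n"
  shows "(\<Sum>i\<in>Iset n. \<Sum>j\<in>Iset n. scl (em a b i j) (F i j)) = F a b"
proof -
  have "(\<Sum>j\<in>Iset n. scl (em a b i j) (F i j)) = (if i = a then F a b else 0)" for i
  proof -
    have "(\<Sum>j\<in>Iset n. scl (em a b i j) (F i j)) = (\<Sum>j\<in>Iset n. if j = b then (if i = a then F i b else 0) else 0)"
      by (rule sum.cong) (auto simp: em_def)
    then show ?thesis using assms by (simp add: Iset_def)
  qed
  then show ?thesis using assms by (simp add: Iset_def)
qed

section \<open>The projection to \<open>sl(n+1|n)\<close>\<close>

definition ZS :: "nat \<Rightarrow> sp" where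
  "ZS n = (\<Sum>k\<in>Iset n. vr (k, k, 0))"

lemma piv_eq: "piv n (i, j, m) = vr (i, j, m) - (if i = j then sg (ppar i) ((dif ^^ m) (ZS n)) else 0)"
  by (simp add: piv_def ZS_def lin_diff[OF lin_dif_funpow] dif_funpow_vr lin_sg[OF lin_dif_funpow]
    lin_zero[OF lin_dif_funpow])

lemma sig_ZS: "sig (ZS n) = sg 1 (ZS n)"
  unfolding ZS_def lin_sum[OF lin_sig] sig_vr
  by (simp add: sg_def even_vpar sum_negf)

lemma sig_piv: "sig (piv n v) = sg (vpar v) (piv n v)"
proof (cases v rule: prod_cases3)
  case (fields i j m)
  have z: "sig ((dif ^^ m) (ZS n)) = sg (vpar (j, j, m)) ((dif ^^ m) (ZS n))"
    unfolding sig_dif_funpow[OF sig_ZS] by (rule sg_cong) (auto simp: even_vpar)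
  then show ?thesis
    unfolding fields piv_eq by (auto simp: lin_diff[OF lin_sig] sig_vr sig_sg sg_diff z add.commute)
qed

lemma hom_pi: "hom (piS n)"
  unfolding piS_def by (rule hom_ev) (rule sig_piv)

lemma pi_vr: "piS n (vr v) = piv n v"
  unfolding piS_def by (rule ev_vr) (rule sig_piv)

lemmas lin_pi = hom_lin[OF hom_pi]

lemma pi_dif: "piS n (dif p) = dif (piS n p)"
proof (rule hom_dif[OF hom_pi])
  fix v
  show "piS n (vr (Dv v)) = dif (piS n (vr v))"
    unfolding pi_vr by (cases v rule: prod_cases3) (simp add: piv_def Dv_def)
qed

lemma pi_dif_funpow: "piS n ((dif ^^ m) x) = (dif ^^ m) (piS n x)"
  by (rule hom_dif_funpow) (rule pi_dif)

lemma pi_barS: "piS n (barS n X) = barS n X - scl (str n X) (ZS n)"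
proof -
  have "(\<Sum>j\<in>Iset n. scl (X i j) (piS n (vr (i, j, 0))))
      = (\<Sum>j\<in>Iset n. scl (X i j) (vr (i, j, 0))) - scl ((-1) ^ ppar i * X i i) (ZS n)" if "i \<in> Iset n" for i
  proof -
    have "(\<Sum>j\<in>Iset n. scl (X i j) (piS n (vr (i, j, 0))))
      = (\<Sum>j\<in>Iset n. scl (X i j) (vr (i, j, 0)) + (if j = i then - scl ((-1) ^ ppar i * X i i) (ZS n) else 0))"
      by (rule sum.cong)
         (auto simp: pi_vr piv_eq diff_conv_add_uminus scl_add scl_minus scl_pow[symmetric] mult.commute
           simp del: add_uminus_conv_diff)
    then show ?thesis using that by (simp add: sum.distrib Iset_def)
  qed
  moreover have "scl (str n X) (ZS n) = (\<Sum>i\<in>Iset n. scl ((-1) ^ ppar i * X i i) (ZS n))"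
  proof -
    have "scl (sum f I) p = (\<Sum>i\<in>I. scl (f i) p)" for f I p
      by (induction I rule: infinite_finite_induct) (auto simp: scl_add_left)
    then show ?thesis by (simp add: str_def)
  qed
  ultimately show ?thesis
    unfolding barS_def lin_sum[OF lin_pi] lin_scl[OF lin_pi] by (simp add: sum_subtractf)
qed

lemma pi_fix: "x \<in> VS n (p_set n) \<Longrightarrow> piS n x = x"
  unfolding VS_def
proof (erule agen_hom_fix[OF hom_pi, rotated])
  fix g assume "g \<in> {(dif ^^ m) (barS n X) | X m. X \<in> p_set n}"
  then obtain X m where g: "g = (dif ^^ m) (barS n X)" "X \<in> p_set n" by blast
  then have "str n X = 0" by (simp add: p_set_def sl_set_def)
  then show "piS n g = g" by (simp add: g pi_dif_funpow pi_barS)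
qed

text \<open>The supertrace of the identity is (n+1) - n = 1. Therefore X - str(X) I has supertrace
  0, and the projection kills the identity.\<close>

lemma sum_signs: "(\<Sum>k\<in>Iset n. (-1) ^ ppar k) = (1 :: complex)"
proof (induction n)
  case 0
  show ?case by (simp add: Iset_def ppar_def)
next
  case (Suc n)
  have "Iset (Suc n) = insert (2*n+3) (insert (2*n+2) (Iset n))" by (auto simp: Iset_def)
  then show ?case using Suc by (simp add: Iset_def ppar_def)
qed

lemma ZS_barS: "ZS n = barS n (\<lambda>i j. if i = j \<and> i \<in> Iset n then 1 else 0)"
proof -
  have "(\<Sum>j\<in>Iset n. scl (if i = j \<and> i \<in> Iset n then 1 else 0) (vr (i, j, 0))) = vr (i, i, 0)" if "i \<in> Iset n" for i
  proof -
    have "(\<Sum>j\<in>Iset n. scl (if i = j \<and> i \<in> Iset n then 1 else 0) (vr (i, j, 0)))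
        = (\<Sum>j\<in>Iset n. if j = i then vr (i, i, 0) else 0)"
      by (rule sum.cong) (use that in auto)
    then show ?thesis using that by (simp add: Iset_def)
  qed
  then show ?thesis unfolding ZS_def barS_def by simp
qed

lemma str_id: "str n (\<lambda>i j. if i = j \<and> i \<in> Iset n then 1 else 0) = 1"
proof -
  have "str n (\<lambda>i j. if i = j \<and> i \<in> Iset n then 1 else 0) = (\<Sum>k\<in>Iset n. (-1) ^ ppar k)"
    unfolding str_def by (rule sum.cong) auto
  then show ?thesis by (simp only: sum_signs)
qed

lemma pi_ZS: "piS n (ZS n) = 0"
  unfolding ZS_barS pi_barS str_id by (simp add: ZS_barS)

lemma pi_gv_VS:
  assumes "x \<in> agen (gv (2*n+1) 1)" shows "piS n x \<in> VS n (p_set n)"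
  using assms unfolding VS_def
proof (elim agen_hom[OF hom_pi, rotated])
  fix g assume "g \<in> gv (2*n+1) 1"
  then obtain s t m where g: "g = vr (s, t, m)" "1 \<le> t" "t \<le> s" "s \<le> 2*n+1" unfolding gv_def by blast
  then have st: "s \<in> Iset n" "t \<in> Iset n" by (auto simp: Iset_def)
  let ?id = "\<lambda>i j. if i = j \<and> i \<in> Iset n then 1 else (0::complex)"
  define c :: complex where "c = (if s = t then (-1) ^ ppar s else 0)"
  \<comment> \<open>\<open>c\<close> is the supertrace of the matrix unit, so \<open>Y\<close> is
    its projection to sl. It stays lower triangular because only the diagonal is changed.\<close>
  define Y where "Y = (\<lambda>i j. em s t i j - c * ?id i j)"
  have "barS n Y = vr (s, t, 0) - scl c (ZS n)"
    unfolding Y_def ZS_barS barS_def scl_sum sum_em[OF st, of "\<lambda>i j. vr (i, j, 0)", symmetric] sum_subtractf[symmetric]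
    by (intro sum.cong refl) (simp add: diff_conv_add_uminus scl_add_left scl_minus_left del: add_uminus_conv_diff)
  then have "piS n (vr (s, t, 0)) = barS n Y"
    by (simp add: pi_vr piv_eq c_def scl_pow)
  then have "piS n g = (dif ^^ m) (barS n Y)"
    using pi_dif_funpow[of n m "vr (s, t, 0)"] by (simp add: g(1) dif_funpow_vr)
  moreover have "Y \<in> p_set n"
  proof -
    have "str n Y = str n (em s t) - c * str n ?id"
      unfolding str_def Y_def sum_distrib_left sum_subtractf[symmetric]
      by (intro sum.cong refl) (simp add: algebra_simps)
    also have "str n (em s t) = c"
    proof -
      have "str n (em s t) = (\<Sum>i\<in>Iset n. if i = s then c else 0)"
        unfolding str_def by (rule sum.cong) (auto simp: em_def c_def)
      then show ?thesis using st by (simp add: Iset_def)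
    qed
    finally have "str n Y = 0" unfolding str_id by simp
    moreover have "in_gl n Y" using st by (auto simp: in_gl_def Y_def em_def split: if_splits)
    moreover have "\<forall>i j. Y i j \<noteq> 0 \<longrightarrow> j \<le> i" using g by (auto simp: Y_def em_def c_def split: if_splits)
    ultimately show ?thesis by (simp add: p_set_def sl_set_def)
  qed
  ultimately show "piS n g \<in> agen {(dif ^^ m) (barS n X) | X m. X \<in> p_set n}"
    using VS_barS[of Y "p_set n" m n] by (simp add: VS_def)
qed

text \<open>The identity is central, and its pairing with e_ab is the supertrace of e_ab, which is 0
  off the diagonal.\<close>

lemma brk_ZS:
  assumes "a \<noteq> b" "a \<in> Iset n" "b \<in> Iset n" shows "brk a b k (ZS n) = 0"
proof -
  have "brk a b k (vr (c, c, 0)) = (if c = b then (if k = 0 then sg (pe a b) (vr (a, b, 0)) else 0) else 0)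
      + (if c = a then - (if k = 0 then sg (pe a b) (vr (a, b, 0)) else 0) else 0)" for c
  proof -
    have "even (pe c c)" by simp
    then show ?thesis using assms(1)
      by (auto simp: brk_vr brvS_def brbS_def lieS_def form_ee_def cn_scl sg_def)
  qed
  then show ?thesis
    unfolding ZS_def lin_sum[OF lin_brk] using assms by (simp add: sum.distrib Iset_def)
qed

text \<open>On a variable, the projection subtracts a derivative of the identity, which the bracket
  kills. Conversely the bracket of two generators has supertrace 0, so the projection fixes
  it.\<close>

lemma brk_pi:
  assumes ab: "a \<noteq> b" "a \<in> Iset n" "b \<in> Iset n"
  shows "brk a b k (piS n x) = piS n (brk a b k x)"
proof (rule pder_unique[where \<phi> = "piS n" and c = "pe a b + k" and E = "\<lambda>x. brk a b k (piS n x)" and F = "\<lambda>x. piS n (brk a b k x)"])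
  show "hom (piS n)" by (rule hom_pi)
  show "pder (piS n) (pe a b + k) (\<lambda>x. brk a b k (piS n x))"
    using lin_comp[OF lin_brk lin_pi] by (simp add: pder_def hom_mult[OF hom_pi] brk_mult)
  show "pder (piS n) (pe a b + k) (\<lambda>x. piS n (brk a b k x))"
    using lin_comp[OF lin_pi lin_brk]
    by (simp add: pder_def hom_mult[OF hom_pi] brk_mult lin_add[OF lin_pi] hom_tw[OF hom_pi])
  fix v :: var
  obtain c d m where v: "v = (c, d, m)" by (cases v rule: prod_cases3)
  have Z: "brk a b k ((dif ^^ m) (ZS n)) = 0" for m k
  proof (induction m arbitrary: k)
    case 0
    show ?case using brk_ZS[OF ab] by simp
  next
    case (Suc m)
    then show ?case by (simp add: brk_dif stepS_def)
  qed
  have "brk a b k (piS n (vr v)) = brvS a b v k"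
    by (simp add: v pi_vr piv_eq lin_diff[OF lin_brk] brk_vr lin_sg[OF lin_brk] Z lin_zero[OF lin_brk])
  moreover have "piS n (brvS a b (c, d, m) k) = brvS a b (c, d, m) k" for k
  proof (induction m arbitrary: k)
    case 0
    \<comment> \<open>For \<open>c = b\<close> and \<open>d = a\<close> both terms of the commutator
      are diagonal, and with this sign their two corrections by \<open>ZS n\<close> cancel.\<close>
    have "sg (pe a b * pe b a) (sg (ppar b) q) = sg (ppar a) q" for q :: sp
      unfolding sg_sg by (rule sg_cong) auto
    then have "piS n (lieS a b c d) = lieS a b c d"
      using ab(1) by (auto simp: lieS_def lin_diff[OF lin_pi] lin_zero[OF lin_pi] lin_sg[OF lin_pi] pi_vr piv_eq
        sg_diff simp del: sg_sg)
    then show ?case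
      by (simp add: brvS_def brbS_def lin_sg[OF lin_pi] hom_cn[OF hom_pi] lin_zero[OF lin_pi])
  next
    case (Suc m)
    have "brvS a b (c, d, Suc m) k = stepS (pe a b) (brvS a b (c, d, m)) k" for k
      using brvS_Dv[of a b "(c, d, m)"] by (simp add: Dv_def)
    then show ?case
      by (simp add: stepS_def lin_sg[OF lin_pi] lin_add[OF lin_pi] pi_dif Suc lin_zero[OF lin_pi])
  qed
  ultimately show "brk a b k (piS n (vr v)) = piS n (brk a b k (vr v))"
    by (simp add: v brk_vr)
qed

lemma rho_pi: "rho (piS n x) = piS n (rho x)"
proof (rule hom_unique[where \<phi> = "\<lambda>x. rho (piS n x)" and \<psi> = "\<lambda>x. piS n (rho x)"])
  show "hom (\<lambda>x. rho (piS n x))"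
    using lin_comp[OF lin_rho lin_pi] hom_rho hom_pi[of n] by (simp add: hom_def)
  show "hom (\<lambda>x. piS n (rho x))"
    using lin_comp[OF lin_pi lin_rho] hom_rho hom_pi[of n] by (simp add: hom_def)
  have "rho (ZS n) = ZS n"
    by (simp add: ZS_def lin_sum[OF lin_rho] rho_vr rhov_def)
  then show "rho (piS n (vr v)) = piS n (rho (vr v))" for v
    by (cases v rule: prod_cases3)
       (auto simp: pi_vr piv_eq rho_vr rhov_def lin_diff[OF lin_rho] rho_sg rho_dif_funpow
         hom_cn[OF hom_pi] lin_zero[OF lin_pi])
qed

lemma dl_pi:
  assumes "a \<noteq> b" "a \<in> Iset n" "b \<in> Iset n"
  shows "dl a b k (piS n x) = piS n (dl a b k x)"
  unfolding dl_def brk_pi[OF assms] rho_pi ..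

text \<open>To this order each diagonal entry occurs once, accompanied by \<open>D\<close> in all
  other rows. Such an entry is odd, so the \<open>j - a\<close> factors \<open>D\<close> to its left
  pass it with one sign each.\<close>

lemma rdS_subtop:
  assumes "a \<le> N" shows "rdS a N (N - a) = (\<Sum>j=a..N. sg (j - a) (eS j j))"
  using assms
proof (induction "N - a" arbitrary: a)
  case 0
  then show ?case by (simp add: rdS_rec rdS_empty oneS_def ldS_def)
next
  case (Suc q)
  then have a: "a < N" by simp
  have top: "rdS (Suc a) N (N - a) = 1" using rdS_top[of "Suc a" N] a by simp
  have z: "rdS (Suc j) N (N - a) = 0" if "j \<in> {Suc a..N}" for j
    using rdS_top[of "Suc j" N] that by auto
  have IH: "rdS (Suc a) N (N - Suc a) = (\<Sum>j=Suc a..N. sg (j - Suc a) (eS j j))"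
    using Suc.hyps(1)[of "Suc a"] Suc.hyps(2) a by simp
  have "(\<Sum>j=a..N. eS j a * rdS (Suc j) N (N - a)) = eS a a + (\<Sum>j=Suc a..N. eS j a * rdS (Suc j) N (N - a))"
    using a by (simp add: sum.atLeast_Suc_atMost top)
  also have "(\<Sum>j=Suc a..N. eS j a * rdS (Suc j) N (N - a)) = 0"
    by (rule sum.neutral) (simp add: z)
  finally have 1: "(\<Sum>j=a..N. eS j a * rdS (Suc j) N (N - a)) = eS a a" by simp
  have 2: "ldS (rdS (Suc a) N) (N - a) = sig (rdS (Suc a) N (N - Suc a))"
    using a by (simp add: ldS_def top)
  have "sig (sg (j - Suc a) (eS j j)) = sg (j - a) (eS j j)" if "j \<in> {Suc a..N}" for j
  proof -
    have "j - a = Suc (j - Suc a)" using that by auto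
    then show ?thesis unfolding sig_sg sig_eS by (simp add: sg_def)
  qed
  then have 3: "sig (\<Sum>j=Suc a..N. sg (j - Suc a) (eS j j)) = (\<Sum>j=Suc a..N. sg (j - a) (eS j j))"
    unfolding lin_sum[OF lin_sig] by (rule sum.cong[OF refl])
  show ?case
    unfolding rdS_rec[OF Suc.prems] 1 2 IH 3 using a by (simp add: sum.atLeast_Suc_atMost add.commute)
qed

text \<open>The sign (-1)^(j-1) from commuting with \<open>D\<close> is (-1)^p(j), which cancels the
  sign built into \<open>eS j j\<close> and leaves the plain sum of diagonal variables.\<close>

lemma wS_1: "wS n 1 = ZS n"
proof -
  have "sg (j - 1) (eS j j) = vr (j, j, 0)" if "j \<in> {1..2*n+1}" for j
    unfolding eS_def sg_sg using that by (cases j) (auto simp: sg_def)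
  then show ?thesis
    using rdS_subtop[of 1 "2*n+1"] by (simp add: wS_def ZS_def Iset_def)
qed

section \<open>Equality of the W-algebra with the generated subalgebra\<close>

lemma WS_generated: "WS n = agen {(dif ^^ m) (piS n (wS n i)) | i m. i \<in> {2..2*n+1}}"
proof (intro set_eqI iffI)
  let ?N = "2*n+1" and ?G = "{(dif ^^ m) (piS n (wS n i)) | i m. i \<in> {2..2*n+1}}"
  fix w
  {
    assume "w \<in> WS n"
    then have w: "w \<in> VS n (p_set n)" and J: "\<And>X k. X \<in> nil_set n \<Longrightarrow> bracketS n X w k \<in> JS n"
      unfolding WS_def by blast+
    have "dl a b k w = 0" if "1 \<le> a" "a < b" "b \<le> ?N" for a b k
    proof -
      have "bracketS n (em a b) w k = brk a b k w"
        unfolding bracketS_def by (rule sum_em) (use that in \<open>auto simp: Iset_def\<close>)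
      then show ?thesis using rho_JS[OF J[OF em_nil[OF that]], of k] by (simp add: dl_def)
    qed
    then have "w \<in> agen (C0 ?N)" by (rule kernel_generated[OF VS_p_gv[OF w]])
    \<comment> \<open>An expression of \<open>w\<close> through all the coefficients over gl becomes
      one through their projections, and its value does not change because \<open>w\<close> lies in
      V(p).\<close>
    then have "piS n w \<in> agen ?G"
    proof (elim agen_hom[OF hom_pi, rotated])
      fix g assume "g \<in> C0 ?N"
      then obtain d m where g: "g = (dif ^^ m) (wS n d)" "1 \<le> d" "d \<le> ?N"
        unfolding C0_def wS_def by blast
      show "piS n g \<in> agen ?G"
      proof (cases "d = 1")
        case True
        then have "piS n g = 0"
          using g wS_1[of n] by (simp add: pi_dif_funpow pi_ZS lin_zero[OF lin_dif_funpow])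
        then show ?thesis by (simp add: agen_zero)
      next
        case False
        then have "d \<in> {2..2*n+1}" using g by auto
        then show ?thesis unfolding g(1) pi_dif_funpow by (intro agen.gen) blast
      qed
    qed
    then show "w \<in> agen ?G" by (simp add: pi_fix[OF w])
  next
    assume w: "w \<in> agen ?G"
    have wgv: "wS n i \<in> agen (gv ?N 1)" for i
      unfolding wS_def by (rule rdS_gv) simp
    have "?G \<subseteq> VS n (p_set n)"
      using VS_dif[OF par_twist_p pi_gv_VS[OF wgv]] by blast
    then have wV: "w \<in> VS n (p_set n)"
      using w unfolding VS_def by (rule agen_subset)
    have "dl a b k w = 0" if ab: "1 \<le> a" "a < b" "b \<le> ?N" for a b k
    proof (rule agen_pder_zero[OF hom_rho pder_dl _ w])
      fix g assume "g \<in> ?G"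
      then obtain i m where g: "g = (dif ^^ m) (piS n (wS n i))" by blast
      have "dl a b k (piS n (wS n i)) = 0" for k
      proof -
        have "dl a b k (piS n (wS n i)) = piS n (dl a b k (wS n i))"
          by (rule dl_pi) (use ab in \<open>auto simp: Iset_def\<close>)
        also have "dl a b k (wS n i) = 0" unfolding wS_def using gauge[of a b ?N 1] ab by simp
        finally show ?thesis by (simp add: lin_zero[OF lin_pi])
      qed
      then show "dl a b k g = 0" unfolding g by (rule dl_dif_funpow_zero)
    qed
    then show "w \<in> WS n" unfolding WS_def using wV bracketS_JS by blast
  }
qed

theorem mainTheorem4:
  fixes n :: nat
  assumes "1 \<le> n"
  shows "Wset n = alg_gen {(sp_D ^^ m) (pi_sl n (wop n i)) | i m. i \<in> {2..2*n+1}}"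
  by (rule main_rep) (rule WS_generated)

end
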